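(* Let $X,Y$ be complex Banach spaces and let $\phi\in\mathcal{H}L_0(B_Y,X)$ with $\phi(B_Y)\subseteq B_X$. Consider the following statements: (1) $C_\phi^L\colon\mathcal{H}L_0(B_X)\to\mathcal{H}L_0(B_Y)$ is compact. (2) $C_\phi^L\colon\mathcal{H}L_0(B_X)\to\mathcal{H}L_0(B_Y)$ does not fix any copy of $\ell_\infty$ and $\phi(B_Y)$ is relatively compact. (3) $\|\phi(y)\|<\|y\|$ for every $y\in\overline{B}_Y\setminus\{0\}$ and $\phi(B_Y)$ is relatively compact. (4) $C_\phi^\infty\colon\mathcal{H}^\infty(B_X)\to\mathcal{H}^\infty(B_Y)$ is compact. Then $(1)\Rightarrow(2)\Rightarrow(3)$. If $\dim(Y)<\infty$, then $(3)\Rightarrow(4)$. If $\dim(X)<\infty$, then $(4)\Rightarrow(1)$. Thus, for $X$ and $Y$ finite-dimensional, all the statements are equivalent.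
   Context: $B_X$ denotes the open unit ball of $X$ and $\overline{B}_X$ the closed unit ball. $\mathcal{H}L_0(B_Y,X)$ is the Banach space of all holomorphic Lipschitz maps $f\colon B_Y\to X$ with $f(0)=0$, normed by the Lipschitz constant $L(f)$; $\mathcal{H}L_0(B_X)=\mathcal{H}L_0(B_X,\mathbb C)$. $\mathcal{H}^\infty(B_X)$ is the Banach space of bounded holomorphic functions $B_X\to\mathbb C$ with the supremum norm. Every Lipschitz map on $B_Y$ with values in a Banach space is identified with its unique Lipschitz extension to $\overline{B}_Y$; this gives meaning to $\phi(y)$ for $y\in\overline{B}_Y$. $C_\phi^L$ and $C_\phi^\infty$ both denote the operator $f\mapsto f\circ\phi$, acting respectively $\mathcal{H}L_0(B_X)\to\mathcal{H}L_0(B_Y)$ and $\mathcal{H}^\infty(B_X)\to\mathcal{H}^\infty(B_Y)$. A bounded operator $T\colon E\to F$ between Banach spaces fixes a copy of $\ell_\infty$ if there is a subspace $G\subseteq E$ isomorphic to $\ell_\infty$ such that $T|_G$ is an isomorphism onto its image. Relative compactness of $\phi(B_Y)$ is in the norm topology of $X$. *)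

theory Defs
  imports "HOL-Analysis.Analysis"
begin

section \<open>Complex normed spaces\<close>

class scaleC =
  fixes scaleC :: "complex \<Rightarrow> 'a \<Rightarrow> 'a"  (infixr \<open>*\<^sub>C\<close> 75)

text \<open>
  The underlying real normed space is kept, so that the library's Frechet derivative, Lipschitz
  maps and topology apply unchanged; complex scalar multiplication extends the real one.
\<close>

class complex_normed_vector = real_normed_vector + scaleC +
  assumes scaleC_add_right: "c *\<^sub>C (x + y) = c *\<^sub>C x + c *\<^sub>C y"
    and scaleC_add_left: "(c + d) *\<^sub>C x = c *\<^sub>C x + d *\<^sub>C x"
    and scaleC_scaleC: "c *\<^sub>C (d *\<^sub>C x) = (c * d) *\<^sub>C x"
    and scaleC_of_real: "complex_of_real r *\<^sub>C x = r *\<^sub>R x"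
    and norm_scaleC: "norm (c *\<^sub>C x) = cmod c * norm x"

class complex_banach = complex_normed_vector + complete_space

global_interpretation complex_vector:
  vector_space "scaleC :: complex \<Rightarrow> 'a \<Rightarrow> 'a::complex_normed_vector"
proof
  fix x :: 'a
  show "1 *\<^sub>C x = x"
    using scaleC_of_real[of 1 x] by simp
qed (simp_all add: scaleC_add_right scaleC_add_left scaleC_scaleC)

abbreviation clinear :: "('a::complex_normed_vector \<Rightarrow> 'b::complex_normed_vector) \<Rightarrow> bool" where
  "clinear \<equiv> Vector_Spaces.linear scaleC scaleC"

definition finite_dimensional :: "'a::complex_normed_vector set \<Rightarrow> bool" where
  "finite_dimensional V \<longleftrightarrow> (\<exists>B. finite B \<and> complex_vector.span B = V)"

lemma clinear_iff:
  "clinear f \<longleftrightarrow> (\<forall>x y. f (x + y) = f x + f y) \<and> (\<forall>c x. f (c *\<^sub>C x) = c *\<^sub>C f x)"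
  by (simp add: Vector_Spaces.linear_iff complex_vector.vector_space_axioms)

lemma clinearI:
  assumes "\<And>x y. f (x + y) = f x + f y" "\<And>c x. f (c *\<^sub>C x) = c *\<^sub>C f x"
  shows "clinear f"
  using assms by (simp add: clinear_iff)

lemma clinear_compose: "clinear f \<Longrightarrow> clinear g \<Longrightarrow> clinear (\<lambda>x. g (f x))"
  by (simp add: clinear_iff)

lemma clinear_add: "clinear f \<Longrightarrow> clinear g \<Longrightarrow> clinear (\<lambda>x. f x + g x)"
  by (simp add: clinear_iff scaleC_add_right)

lemma clinear_scaleC: "clinear f \<Longrightarrow> clinear (\<lambda>x. c *\<^sub>C f x)"
  by (simp add: clinear_iff scaleC_add_right scaleC_scaleC mult.commute)

lemma bounded_linear_scaleC: "bounded_linear (\<lambda>x::'a::complex_normed_vector. c *\<^sub>C x)"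
proof (rule bounded_linear_intro)
  fix x y :: 'a and r :: real
  show "c *\<^sub>C (x + y) = c *\<^sub>C x + c *\<^sub>C y"
    by (rule scaleC_add_right)
  show "c *\<^sub>C (r *\<^sub>R x) = r *\<^sub>R (c *\<^sub>C x)"
    by (simp add: scaleC_scaleC mult.commute flip: scaleC_of_real)
  show "norm (c *\<^sub>C x) \<le> norm x * cmod c"
    by (simp add: norm_scaleC)
qed

instantiation complex :: complex_banach
begin

definition scaleC_complex :: "complex \<Rightarrow> complex \<Rightarrow> complex" where
  "scaleC_complex = (*)"

instance
  by standard (simp_all add: scaleC_complex_def algebra_simps norm_mult scaleR_conv_of_real)

end

text \<open>Every map on the discrete space \<^typ>\<open>nat\<close> is continuous, so this is the space of all
  bounded complex sequences with the supremum norm.\<close>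

type_synonym linfty = "(nat, complex) bcontfun"

instantiation bcontfun :: (topological_space, complex_normed_vector) complex_normed_vector
begin

definition scaleC_bcontfun :: "complex \<Rightarrow> ('a, 'b) bcontfun \<Rightarrow> ('a, 'b) bcontfun" where
  "scaleC_bcontfun c f = Bcontfun (\<lambda>x. c *\<^sub>C apply_bcontfun f x)"

lemma apply_bcontfun_scaleC:
  "apply_bcontfun (c *\<^sub>C f) x = c *\<^sub>C apply_bcontfun f x" for f :: "('a, 'b) bcontfun"
proof -
  have "bounded (range (\<lambda>x. c *\<^sub>C apply_bcontfun f x))"
    using bounded_linear_image[OF bounded_apply_bcontfun bounded_linear_scaleC[of c]]
    by (simp add: image_image)
  then have "(\<lambda>x. c *\<^sub>C apply_bcontfun f x) \<in> bcontfun"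
    by (auto simp: bcontfun_def intro!: bounded_linear.continuous_on[OF bounded_linear_scaleC])
  then show ?thesis
    by (simp add: scaleC_bcontfun_def Bcontfun_inverse)
qed

instance
proof
  fix c d :: complex and r :: real and f g :: "('a, 'b) bcontfun"
  show "c *\<^sub>C (f + g) = c *\<^sub>C f + c *\<^sub>C g"
    by (rule bcontfun_eqI) (simp add: apply_bcontfun_scaleC scaleC_add_right)
  show "(c + d) *\<^sub>C f = c *\<^sub>C f + d *\<^sub>C f"
    by (rule bcontfun_eqI) (simp add: apply_bcontfun_scaleC scaleC_add_left)
  show "c *\<^sub>C (d *\<^sub>C f) = (c * d) *\<^sub>C f"
    by (rule bcontfun_eqI) (simp add: apply_bcontfun_scaleC scaleC_scaleC)
  show scR: "complex_of_real r *\<^sub>C f = r *\<^sub>R f" for r and f :: "('a, 'b) bcontfun"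
    by (rule bcontfun_eqI) (simp add: apply_bcontfun_scaleC scaleC_of_real)
  have le: "norm (c *\<^sub>C h) \<le> cmod c * norm h" for c and h :: "('a, 'b) bcontfun"
  proof (rule norm_bound)
    fix x
    show "norm (apply_bcontfun (c *\<^sub>C h) x) \<le> cmod c * norm h"
      by (simp add: apply_bcontfun_scaleC norm_scaleC mult_left_mono norm_bounded)
  qed
  show "norm (c *\<^sub>C f) = cmod c * norm f"
  proof (cases "c = 0")
    case True
    then show ?thesis using scR[of 0 f] by simp
  next
    case False
    have "(1 / c) *\<^sub>C (c *\<^sub>C f) = f"
      using False by (intro bcontfun_eqI) (simp add: apply_bcontfun_scaleC scaleC_scaleC)
    then have "norm f \<le> cmod (1 / c) * norm (c *\<^sub>C f)"
      using le[of "1 / c" "c *\<^sub>C f"] by simp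
    then have "cmod c * norm f \<le> norm (c *\<^sub>C f)"
      using False by (simp add: norm_divide field_simps)
    with le[of c f] show ?thesis by simp
  qed
qed

end


section \<open>Operators\<close>

definition compact_operator ::
    "('a::complex_normed_vector \<Rightarrow> 'b::complex_normed_vector) \<Rightarrow> bool" where
  "compact_operator T \<longleftrightarrow> clinear T \<and> compact (closure (T ` ball 0 1))"

text \<open>
  Isomorphisms of normed spaces are linear homeomorphisms. The definition is meant for linear
  \<open>T\<close>, whose restriction to \<open>G\<close> is then automatically linear.
\<close>

definition fixes_copy_of_linfty ::
    "('a::complex_normed_vector \<Rightarrow> 'b::complex_normed_vector) \<Rightarrow> bool" where
  "fixes_copy_of_linfty T \<longleftrightarrow>
     (\<exists>G. complex_vector.subspace G \<and>
        (\<exists>J J'. clinear J \<and> homeomorphism (UNIV :: linfty set) G J J') \<and>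
        (\<exists>S. homeomorphism G (T ` G) T S))"


section \<open>Holomorphic maps\<close>

text \<open>Used for open \<open>U\<close> only: complex Frechet differentiability at every point.\<close>

definition holomorphic_map_on ::
    "'a set \<Rightarrow> ('a::complex_normed_vector \<Rightarrow> 'b::complex_normed_vector) \<Rightarrow> bool" where
  "holomorphic_map_on U f \<longleftrightarrow> (\<forall>x\<in>U. \<exists>D. clinear D \<and> (f has_derivative D) (at x))"

lemma holomorphic_map_on_const: "holomorphic_map_on U (\<lambda>_. c)"
  unfolding holomorphic_map_on_def
  by (intro ballI exI[of _ "\<lambda>_. 0"] conjI clinearI) (auto intro: derivative_intros)

lemma holomorphic_map_onE:
  assumes "holomorphic_map_on U f" "x \<in> U"
  obtains D where "clinear D" "(f has_derivative D) (at x)"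
  using assms unfolding holomorphic_map_on_def by blast

lemma holomorphic_map_on_add:
  assumes "holomorphic_map_on U f" "holomorphic_map_on U g"
  shows "holomorphic_map_on U (\<lambda>x. f x + g x)"
  unfolding holomorphic_map_on_def
proof
  fix x assume x: "x \<in> U"
  obtain D where D: "clinear D" "(f has_derivative D) (at x)"
    using assms(1) x by (rule holomorphic_map_onE)
  obtain E where E: "clinear E" "(g has_derivative E) (at x)"
    using assms(2) x by (rule holomorphic_map_onE)
  show "\<exists>D. clinear D \<and> ((\<lambda>x. f x + g x) has_derivative D) (at x)"
    using clinear_add[OF D(1) E(1)] has_derivative_add[OF D(2) E(2)] by (intro exI conjI)
qed

lemma holomorphic_map_on_scaleC:
  assumes "holomorphic_map_on U f"
  shows "holomorphic_map_on U (\<lambda>x. c *\<^sub>C f x)"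
  unfolding holomorphic_map_on_def
proof
  fix x assume x: "x \<in> U"
  obtain D where D: "clinear D" "(f has_derivative D) (at x)"
    using assms x by (rule holomorphic_map_onE)
  show "\<exists>D. clinear D \<and> ((\<lambda>x. c *\<^sub>C f x) has_derivative D) (at x)"
    using clinear_scaleC[OF D(1)] bounded_linear.has_derivative[OF bounded_linear_scaleC D(2)]
    by (intro exI conjI)
qed

lemma holomorphic_map_on_compose:
  assumes "holomorphic_map_on U f" "holomorphic_map_on V g" "f ` U \<subseteq> V"
  shows "holomorphic_map_on U (\<lambda>x. g (f x))"
  unfolding holomorphic_map_on_def
proof
  fix x assume x: "x \<in> U"
  obtain D where D: "clinear D" "(f has_derivative D) (at x)"
    using assms(1) x by (rule holomorphic_map_onE)
  obtain E where E: "clinear E" "(g has_derivative E) (at (f x))"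
    by (rule holomorphic_map_onE[OF assms(2), of "f x"]) (use assms(3) x in auto)
  show "\<exists>D. clinear D \<and> ((\<lambda>x. g (f x)) has_derivative D) (at x)"
    using clinear_compose[OF D(1) E(1)] has_derivative_compose[OF D(2) E(2)]
    by (intro exI conjI)
qed

lemma holomorphic_map_on_cong:
  assumes "open U" "\<And>x. x \<in> U \<Longrightarrow> f x = g x" "holomorphic_map_on U f"
  shows "holomorphic_map_on U g"
  unfolding holomorphic_map_on_def
proof
  fix x assume x: "x \<in> U"
  obtain D where D: "clinear D" "(f has_derivative D) (at x)"
    using assms(3) x by (rule holomorphic_map_onE)
  have "(g has_derivative D) (at x)"
    by (rule has_derivative_transform_within_open[OF D(2) assms(1) x]) (simp add: assms(2))
  with D(1) show "\<exists>D. clinear D \<and> (g has_derivative D) (at x)" by blast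
qed


section \<open>The space of holomorphic Lipschitz maps vanishing at 0\<close>

lemma ex_lipschitz_on_zero: "\<exists>C. C-lipschitz_on U (\<lambda>_. 0 :: 'b::real_normed_vector)"
  by (rule exI[of _ 0]) (simp add: lipschitz_on_def)

text \<open>A map on the open unit ball is represented by its extension by 0 to the whole space.\<close>

typedef (overloaded) ('a::complex_normed_vector, 'b::complex_normed_vector) hlip0 =
  "{f :: 'a \<Rightarrow> 'b. holomorphic_map_on (ball 0 1) f \<and> (\<exists>C. C-lipschitz_on (ball 0 1) f) \<and>
      f 0 = 0 \<and> (\<forall>x. x \<notin> ball 0 1 \<longrightarrow> f x = 0)}"
  morphisms apply_hlip0 Abs_hlip0
  by (rule exI[of _ "\<lambda>_. 0"]) (simp add: holomorphic_map_on_const ex_lipschitz_on_zero)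

setup_lifting type_definition_hlip0

text \<open>The pairs with \<open>x = y\<close> contribute \<open>0 / 0 = 0\<close>, which keeps the set nonempty also on the
  zero space and does not change the supremum otherwise.\<close>

definition lipschitz_const ::
    "'a set \<Rightarrow> ('a::real_normed_vector \<Rightarrow> 'b::real_normed_vector) \<Rightarrow> real" where
  "lipschitz_const U f = (SUP (x, y)\<in>U \<times> U. norm (f x - f y) / norm (x - y))"

lemma lipschitz_const_bound:
  assumes "C-lipschitz_on U f" "x \<in> U" "y \<in> U"
  shows "norm (f x - f y) \<le> lipschitz_const U f * norm (x - y)"
proof (cases "x = y")
  case False
  have *: "norm (f x - f y) / norm (x - y) \<le> C" if "x \<in> U" "y \<in> U" for x y
  proof (cases "x = y")
    case True
    then show ?thesis using lipschitz_on_nonneg[OF assms(1)] by simp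
  next
    case False
    then show ?thesis
      using lipschitz_onD[OF assms(1) that] by (simp add: dist_norm divide_le_eq)
  qed
  have "bdd_above ((\<lambda>(x, y). norm (f x - f y) / norm (x - y)) ` (U \<times> U))"
    using * by (intro bdd_aboveI[of _ C]) auto
  then have "norm (f x - f y) / norm (x - y) \<le> lipschitz_const U f"
    unfolding lipschitz_const_def
    using cSUP_upper[of "(x, y)" "U \<times> U" "\<lambda>(x, y). norm (f x - f y) / norm (x - y)"]
      assms(2,3) by simp
  then show ?thesis
    using False by (simp add: divide_le_eq)
qed simp

lemma lipschitz_const_least:
  assumes "U \<noteq> {}" "0 \<le> C" "\<And>x y. x \<in> U \<Longrightarrow> y \<in> U \<Longrightarrow> norm (f x - f y) \<le> C * norm (x - y)"
  shows "lipschitz_const U f \<le> C"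
  unfolding lipschitz_const_def
proof (rule cSUP_least)
  fix p assume "p \<in> U \<times> U"
  then show "(case p of (x, y) \<Rightarrow> norm (f x - f y) / norm (x - y)) \<le> C"
    using assms(2,3) by (cases "fst p = snd p") (auto simp: divide_le_eq)
qed (use assms(1) in auto)

lemma lipschitz_const_nonneg:
  assumes "C-lipschitz_on U f" "U \<noteq> {}"
  shows "0 \<le> lipschitz_const U f"
proof (cases "\<exists>x\<in>U. \<exists>y\<in>U. x \<noteq> y")
  case True
  then obtain x y where xy: "x \<in> U" "y \<in> U" "x \<noteq> y" by blast
  have "0 \<le> lipschitz_const U f * norm (x - y)"
    using lipschitz_const_bound[OF assms(1) xy(1,2)] norm_ge_zero order_trans by blast
  then show ?thesis
    using xy(3) by (simp add: zero_le_mult_iff)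
next
  case False
  with assms(2) obtain u where "U = {u}" by blast
  then show ?thesis by (simp add: lipschitz_const_def)
qed

lemma apply_hlip0_eqI:
  assumes "\<And>x. norm x < 1 \<Longrightarrow> apply_hlip0 f x = apply_hlip0 g x"
  shows "f = g"
proof -
  have "apply_hlip0 f x = apply_hlip0 g x" for x
    using assms[of x] apply_hlip0[of f] apply_hlip0[of g] by (cases "norm x < 1") auto
  then show ?thesis
    by (simp add: apply_hlip0_inject[symmetric] fun_eq_iff)
qed

lemma lipschitz_on_scaleC:
  fixes f :: "'a::metric_space \<Rightarrow> 'b::complex_normed_vector"
  assumes "C-lipschitz_on U f"
  shows "(cmod c * C)-lipschitz_on U (\<lambda>x. c *\<^sub>C f x)"
proof (rule lipschitz_onI)
  fix x y assume xy: "x \<in> U" "y \<in> U"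
  have "dist (c *\<^sub>C f x) (c *\<^sub>C f y) = cmod c * dist (f x) (f y)"
    by (simp add: dist_norm norm_scaleC flip: complex_vector.scale_right_diff_distrib)
  also have "\<dots> \<le> cmod c * (C * dist x y)"
    by (intro mult_left_mono lipschitz_onD[OF assms xy]) auto
  finally show "dist (c *\<^sub>C f x) (c *\<^sub>C f y) \<le> cmod c * C * dist x y" by simp
qed (use lipschitz_on_nonneg[OF assms] in auto)

instantiation hlip0 :: (complex_normed_vector, complex_normed_vector) complex_normed_vector
begin

lift_definition zero_hlip0 :: "('a, 'b) hlip0" is "\<lambda>_. 0"
  by (simp add: holomorphic_map_on_const ex_lipschitz_on_zero)

lift_definition plus_hlip0 :: "('a, 'b) hlip0 \<Rightarrow> ('a, 'b) hlip0 \<Rightarrow> ('a, 'b) hlip0"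
  is "\<lambda>f g x. f x + g x"
proof clarify
  fix f g :: "'a \<Rightarrow> 'b" and C D
  assume "holomorphic_map_on (ball 0 1) f" "holomorphic_map_on (ball 0 1) g"
    and "C-lipschitz_on (ball 0 1) f" "D-lipschitz_on (ball 0 1) g"
    and "f 0 = 0" "g 0 = 0" "\<forall>x. x \<notin> ball 0 1 \<longrightarrow> f x = 0" "\<forall>x. x \<notin> ball 0 1 \<longrightarrow> g x = 0"
  then show "holomorphic_map_on (ball 0 1) (\<lambda>x. f x + g x) \<and>
      (\<exists>C. C-lipschitz_on (ball 0 1) (\<lambda>x. f x + g x)) \<and> f 0 + g 0 = 0 \<and>
      (\<forall>x. x \<notin> ball 0 1 \<longrightarrow> f x + g x = 0)"
    by (intro conjI exI[of _ "C + D"] holomorphic_map_on_add lipschitz_on_add) auto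
qed

lift_definition scaleC_hlip0 :: "complex \<Rightarrow> ('a, 'b) hlip0 \<Rightarrow> ('a, 'b) hlip0"
  is "\<lambda>c f x. c *\<^sub>C f x"
proof clarify
  fix c and f :: "'a \<Rightarrow> 'b" and C
  assume "holomorphic_map_on (ball 0 1) f" "C-lipschitz_on (ball 0 1) f"
    and "f 0 = 0" "\<forall>x. x \<notin> ball 0 1 \<longrightarrow> f x = 0"
  then show "holomorphic_map_on (ball 0 1) (\<lambda>x. c *\<^sub>C f x) \<and>
      (\<exists>C. C-lipschitz_on (ball 0 1) (\<lambda>x. c *\<^sub>C f x)) \<and> c *\<^sub>C f 0 = 0 \<and>
      (\<forall>x. x \<notin> ball 0 1 \<longrightarrow> c *\<^sub>C f x = 0)"
    using holomorphic_map_on_scaleC[of "ball 0 1" f c] lipschitz_on_scaleC[of C "ball 0 1" f c]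
    by (intro conjI exI[of _ "cmod c * C"]) simp_all
qed

definition uminus_hlip0 :: "('a, 'b) hlip0 \<Rightarrow> ('a, 'b) hlip0" where
  "uminus_hlip0 f = (- 1) *\<^sub>C f"

definition minus_hlip0 :: "('a, 'b) hlip0 \<Rightarrow> ('a, 'b) hlip0 \<Rightarrow> ('a, 'b) hlip0" where
  "minus_hlip0 f g = f + (- g)"

definition scaleR_hlip0 :: "real \<Rightarrow> ('a, 'b) hlip0 \<Rightarrow> ('a, 'b) hlip0" where
  "scaleR_hlip0 r f = complex_of_real r *\<^sub>C f"

lift_definition norm_hlip0 :: "('a, 'b) hlip0 \<Rightarrow> real" is "lipschitz_const (ball 0 1)" .

definition dist_hlip0 :: "('a, 'b) hlip0 \<Rightarrow> ('a, 'b) hlip0 \<Rightarrow> real" where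
  "dist_hlip0 f g = norm (f - g)"

definition sgn_hlip0 :: "('a, 'b) hlip0 \<Rightarrow> ('a, 'b) hlip0" where
  "sgn_hlip0 f = inverse (norm f) *\<^sub>R f"

definition uniformity_hlip0 :: "(('a, 'b) hlip0 \<times> ('a, 'b) hlip0) filter" where
  "uniformity_hlip0 = (INF e\<in>{0 <..}. principal {(f, g). dist f g < e})"

definition open_hlip0 :: "('a, 'b) hlip0 set \<Rightarrow> bool" where
  "open_hlip0 S = (\<forall>x\<in>S. \<forall>\<^sub>F (x', y) in uniformity. x' = x \<longrightarrow> y \<in> S)"

instance
proof
  fix f g h :: "('a, 'b) hlip0" and a b :: real and c d :: complex
  have ball: "ball (0::'a) 1 \<noteq> {}" by simp
  have bound: "norm (apply_hlip0 f x - apply_hlip0 f y) \<le> norm f * norm (x - y)"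
    if "x \<in> ball 0 1" "y \<in> ball 0 1" for f :: "('a, 'b) hlip0" and x y
  proof -
    obtain C where "C-lipschitz_on (ball 0 1) (apply_hlip0 f)"
      using apply_hlip0[of f] by auto
    then show ?thesis
      unfolding norm_hlip0.rep_eq using that by (rule lipschitz_const_bound)
  qed
  have least: "norm f \<le> C"
    if "0 \<le> C" "\<And>x y. x \<in> ball 0 1 \<Longrightarrow> y \<in> ball 0 1 \<Longrightarrow>
        norm (apply_hlip0 f x - apply_hlip0 f y) \<le> C * norm (x - y)"
    for f :: "('a, 'b) hlip0" and C
    using that unfolding norm_hlip0.rep_eq by (intro lipschitz_const_least) auto
  have nonneg: "0 \<le> norm f" for f :: "('a, 'b) hlip0"
  proof -
    obtain C where "C-lipschitz_on (ball 0 1) (apply_hlip0 f)"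
      using apply_hlip0[of f] by auto
    then show ?thesis
      unfolding norm_hlip0.rep_eq using ball by (rule lipschitz_const_nonneg)
  qed
  show "f + g + h = f + (g + h)" by transfer (simp add: add.assoc)
  show "f + g = g + f" by transfer (simp add: add.commute)
  show "0 + f = f" by transfer simp
  show "- f + f = 0"
    unfolding uminus_hlip0_def by transfer simp
  show "f - g = f + - g" by (rule minus_hlip0_def)
  show 1: "c *\<^sub>C (f + g) = c *\<^sub>C f + c *\<^sub>C g" for c and f g :: "('a, 'b) hlip0"
    by transfer (simp add: scaleC_add_right)
  show 2: "(c + d) *\<^sub>C f = c *\<^sub>C f + d *\<^sub>C f" for c d and f :: "('a, 'b) hlip0"
    by transfer (simp add: scaleC_add_left)
  show 3: "c *\<^sub>C (d *\<^sub>C f) = (c * d) *\<^sub>C f" for c d and f :: "('a, 'b) hlip0"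
    by transfer (simp add: scaleC_scaleC)
  show "complex_of_real a *\<^sub>C f = a *\<^sub>R f" by (simp add: scaleR_hlip0_def)
  show "a *\<^sub>R (f + g) = a *\<^sub>R f + a *\<^sub>R g" by (simp add: scaleR_hlip0_def 1)
  show "(a + b) *\<^sub>R f = a *\<^sub>R f + b *\<^sub>R f" by (simp add: scaleR_hlip0_def 2)
  show "a *\<^sub>R b *\<^sub>R f = (a * b) *\<^sub>R f" by (simp add: scaleR_hlip0_def 3)
  show "1 *\<^sub>R f = f" unfolding scaleR_hlip0_def by transfer simp
  show "dist f g = norm (f - g)" by (rule dist_hlip0_def)
  show "sgn f = inverse (norm f) *\<^sub>R f" by (rule sgn_hlip0_def)
  show "uniformity = (INF e\<in>{0 <..}. principal {(f :: ('a, 'b) hlip0, g). dist f g < e})"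
    by (rule uniformity_hlip0_def)
  show "open S = (\<forall>x\<in>S. \<forall>\<^sub>F (x', y) in uniformity. x' = x \<longrightarrow> y \<in> S)" for S :: "('a, 'b) hlip0 set"
    by (rule open_hlip0_def)
  have zero: "0 *\<^sub>C f = (0 :: ('a, 'b) hlip0)" for f :: "('a, 'b) hlip0" by transfer simp
  have norm0: "norm (0 :: ('a, 'b) hlip0) = 0"
    using least[of 0 0] nonneg[of 0] by (simp add: zero_hlip0.rep_eq)
  show "norm f = 0 \<longleftrightarrow> f = 0"
  proof
    assume "norm f = 0"
    then have "apply_hlip0 f x = apply_hlip0 f 0" if "norm x < 1" for x
      using bound[of x 0 f] that by simp
    moreover have "apply_hlip0 f 0 = 0" using apply_hlip0[of f] by auto
    ultimately show "f = 0"
      by (intro apply_hlip0_eqI) (simp add: zero_hlip0.rep_eq)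
  qed (simp add: norm0)
  show "norm (f + g) \<le> norm f + norm g"
  proof (rule least)
    show "0 \<le> norm f + norm g" using nonneg[of f] nonneg[of g] by simp
    fix x y :: 'a assume xy: "x \<in> ball 0 1" "y \<in> ball 0 1"
    have "norm (apply_hlip0 (f + g) x - apply_hlip0 (f + g) y)
        = norm ((apply_hlip0 f x - apply_hlip0 f y) + (apply_hlip0 g x - apply_hlip0 g y))"
      by (simp add: plus_hlip0.rep_eq add_diff_add)
    also have "\<dots> \<le> norm f * norm (x - y) + norm g * norm (x - y)"
      by (rule norm_triangle_mono[OF bound[OF xy] bound[OF xy]])
    finally show "norm (apply_hlip0 (f + g) x - apply_hlip0 (f + g) y)
        \<le> (norm f + norm g) * norm (x - y)"
      by (simp only: distrib_right)
  qed
  have le: "norm (c *\<^sub>C f) \<le> cmod c * norm f" for c and f :: "('a, 'b) hlip0"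
  proof (rule least)
    show "0 \<le> cmod c * norm f" using nonneg[of f] by simp
    fix x y :: 'a assume xy: "x \<in> ball 0 1" "y \<in> ball 0 1"
    have "norm (apply_hlip0 (c *\<^sub>C f) x - apply_hlip0 (c *\<^sub>C f) y)
        = cmod c * norm (apply_hlip0 f x - apply_hlip0 f y)"
      by (simp only: scaleC_hlip0.rep_eq norm_scaleC
          complex_vector.scale_right_diff_distrib[symmetric])
    also have "\<dots> \<le> cmod c * (norm f * norm (x - y))"
      by (rule mult_left_mono[OF bound[OF xy] norm_ge_zero])
    finally show "norm (apply_hlip0 (c *\<^sub>C f) x - apply_hlip0 (c *\<^sub>C f) y)
        \<le> cmod c * norm f * norm (x - y)"
      by (simp only: mult.assoc)
  qed
  show eq: "norm (c *\<^sub>C f) = cmod c * norm f" for c and f :: "('a, 'b) hlip0"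
  proof (cases "c = 0")
    case True
    then show ?thesis by (simp add: zero norm0)
  next
    case False
    have "(1 / c) *\<^sub>C (c *\<^sub>C f) = f"
      using False by transfer simp
    then have "norm f \<le> cmod (1 / c) * norm (c *\<^sub>C f)"
      using le[of "1 / c" "c *\<^sub>C f"] by simp
    then have "cmod c * norm f \<le> norm (c *\<^sub>C f)"
      using False by (simp add: norm_divide field_simps)
    with le[of c f] show ?thesis by simp
  qed
  show "norm (a *\<^sub>R f) = \<bar>a\<bar> * norm f"
    by (simp add: scaleR_hlip0_def eq)
qed

end


section \<open>The space of bounded holomorphic functions\<close>

typedef (overloaded) ('a::complex_normed_vector) hinf =
  "{f :: 'a \<Rightarrow> complex. holomorphic_map_on (ball 0 1) f \<and> bounded (f ` ball 0 1) \<and>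
      (\<forall>x. x \<notin> ball 0 1 \<longrightarrow> f x = 0)}"
  morphisms apply_hinf Abs_hinf
  by (rule exI[of _ "\<lambda>_. 0"]) (auto simp: holomorphic_map_on_const image_constant_conv)

setup_lifting type_definition_hinf

lemma apply_hinf_eqI:
  assumes "\<And>x. norm x < 1 \<Longrightarrow> apply_hinf f x = apply_hinf g x"
  shows "f = g"
proof -
  have "apply_hinf f x = apply_hinf g x" for x
    using assms[of x] apply_hinf[of f] apply_hinf[of g] by (cases "norm x < 1") auto
  then show ?thesis
    by (simp add: apply_hinf_inject[symmetric] fun_eq_iff)
qed

instantiation hinf :: (complex_normed_vector) complex_normed_vector
begin

lift_definition zero_hinf :: "'a hinf" is "\<lambda>_. 0"
  by (auto simp: holomorphic_map_on_const image_constant_conv)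

lift_definition plus_hinf :: "'a hinf \<Rightarrow> 'a hinf \<Rightarrow> 'a hinf" is "\<lambda>f g x. f x + g x"
  by (auto intro: holomorphic_map_on_add bounded_plus_comp)

lift_definition scaleC_hinf :: "complex \<Rightarrow> 'a hinf \<Rightarrow> 'a hinf" is "\<lambda>c f x. c * f x"
  using holomorphic_map_on_scaleC[where 'b = complex]
  by (auto simp: scaleC_complex_def image_image
      intro: bounded_linear_image[OF _ bounded_linear_mult_right, of "_ ` _", unfolded image_image])

definition uminus_hinf :: "'a hinf \<Rightarrow> 'a hinf" where
  "uminus_hinf f = (- 1) *\<^sub>C f"

definition minus_hinf :: "'a hinf \<Rightarrow> 'a hinf \<Rightarrow> 'a hinf" where
  "minus_hinf f g = f + (- g)"

definition scaleR_hinf :: "real \<Rightarrow> 'a hinf \<Rightarrow> 'a hinf" where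
  "scaleR_hinf r f = complex_of_real r *\<^sub>C f"

lift_definition norm_hinf :: "'a hinf \<Rightarrow> real" is "\<lambda>f. SUP x\<in>ball 0 1. cmod (f x)" .

definition dist_hinf :: "'a hinf \<Rightarrow> 'a hinf \<Rightarrow> real" where
  "dist_hinf f g = norm (f - g)"

definition sgn_hinf :: "'a hinf \<Rightarrow> 'a hinf" where
  "sgn_hinf f = inverse (norm f) *\<^sub>R f"

definition uniformity_hinf :: "('a hinf \<times> 'a hinf) filter" where
  "uniformity_hinf = (INF e\<in>{0 <..}. principal {(f, g). dist f g < e})"

definition open_hinf :: "'a hinf set \<Rightarrow> bool" where
  "open_hinf S = (\<forall>x\<in>S. \<forall>\<^sub>F (x', y) in uniformity. x' = x \<longrightarrow> y \<in> S)"

instance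
proof
  fix f g h :: "'a hinf" and a b :: real and c d :: complex
  have bound: "cmod (apply_hinf f x) \<le> norm f" if "x \<in> ball 0 1" for f :: "'a hinf" and x
  proof -
    have "bounded (apply_hinf f ` ball 0 1)" using apply_hinf[of f] by simp
    then have "bdd_above ((\<lambda>x. cmod (apply_hinf f x)) ` ball 0 1)"
      by (auto simp: bounded_iff intro: bdd_aboveI)
    with that show ?thesis
      unfolding norm_hinf.rep_eq by (intro cSUP_upper)
  qed
  have least: "norm f \<le> C" if "\<And>x. x \<in> ball 0 1 \<Longrightarrow> cmod (apply_hinf f x) \<le> C"
    for f :: "'a hinf" and C
    using that unfolding norm_hinf.rep_eq by (intro cSUP_least) auto
  have nonneg: "0 \<le> norm f" for f :: "'a hinf"
    using bound[of 0 f] norm_ge_zero[of "apply_hinf f 0"] by (simp del: norm_ge_zero)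
  show "f + g + h = f + (g + h)" by transfer (simp add: add.assoc)
  show "f + g = g + f" by transfer (simp add: add.commute)
  show "0 + f = f" by transfer simp
  show "- f + f = 0"
    unfolding uminus_hinf_def by transfer simp
  show "f - g = f + - g" by (rule minus_hinf_def)
  show 1: "c *\<^sub>C (f + g) = c *\<^sub>C f + c *\<^sub>C g" for c and f g :: "'a hinf"
    by transfer (simp add: algebra_simps)
  show 2: "(c + d) *\<^sub>C f = c *\<^sub>C f + d *\<^sub>C f" for c d and f :: "'a hinf"
    by transfer (simp add: algebra_simps)
  show 3: "c *\<^sub>C (d *\<^sub>C f) = (c * d) *\<^sub>C f" for c d and f :: "'a hinf"
    by transfer (simp add: algebra_simps)
  show "complex_of_real a *\<^sub>C f = a *\<^sub>R f" by (simp add: scaleR_hinf_def)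
  show "a *\<^sub>R (f + g) = a *\<^sub>R f + a *\<^sub>R g" by (simp add: scaleR_hinf_def 1)
  show "(a + b) *\<^sub>R f = a *\<^sub>R f + b *\<^sub>R f" by (simp add: scaleR_hinf_def 2)
  show "a *\<^sub>R b *\<^sub>R f = (a * b) *\<^sub>R f" by (simp add: scaleR_hinf_def 3)
  show "1 *\<^sub>R f = f" unfolding scaleR_hinf_def by transfer simp
  show "dist f g = norm (f - g)" by (rule dist_hinf_def)
  show "sgn f = inverse (norm f) *\<^sub>R f" by (rule sgn_hinf_def)
  show "uniformity = (INF e\<in>{0 <..}. principal {(f :: 'a hinf, g). dist f g < e})"
    by (rule uniformity_hinf_def)
  show "open S = (\<forall>x\<in>S. \<forall>\<^sub>F (x', y) in uniformity. x' = x \<longrightarrow> y \<in> S)" for S :: "'a hinf set"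
    by (rule open_hinf_def)
  have zero: "0 *\<^sub>C f = (0 :: 'a hinf)" for f :: "'a hinf" by transfer simp
  have norm0: "norm (0 :: 'a hinf) = 0"
    using least[of 0 0] nonneg[of 0] by (simp add: zero_hinf.rep_eq)
  show "norm f = 0 \<longleftrightarrow> f = 0"
  proof
    assume "norm f = 0"
    then show "f = 0"
      using bound[of _ f] by (intro apply_hinf_eqI) (simp add: zero_hinf.rep_eq)
  qed (simp add: norm0)
  show "norm (f + g) \<le> norm f + norm g"
  proof (rule least)
    fix x :: 'a assume "x \<in> ball 0 1"
    then show "cmod (apply_hinf (f + g) x) \<le> norm f + norm g"
      using bound[of x f] bound[of x g] norm_triangle_ineq[of "apply_hinf f x" "apply_hinf g x"]
      by (simp add: plus_hinf.rep_eq)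
  qed
  have le: "norm (c *\<^sub>C f) \<le> cmod c * norm f" for c and f :: "'a hinf"
  proof (rule least)
    fix x :: 'a assume "x \<in> ball 0 1"
    then show "cmod (apply_hinf (c *\<^sub>C f) x) \<le> cmod c * norm f"
      using bound[of x f] by (simp add: scaleC_hinf.rep_eq norm_mult mult_left_mono)
  qed
  show eq: "norm (c *\<^sub>C f) = cmod c * norm f" for c and f :: "'a hinf"
  proof (cases "c = 0")
    case True
    then show ?thesis by (simp add: zero norm0)
  next
    case False
    have "(1 / c) *\<^sub>C (c *\<^sub>C f) = f"
      using False by transfer (simp add: fun_eq_iff)
    then have "norm f \<le> cmod (1 / c) * norm (c *\<^sub>C f)"
      using le[of "1 / c" "c *\<^sub>C f"] by simp
    then have "cmod c * norm f \<le> norm (c *\<^sub>C f)"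
      using False by (simp add: norm_divide field_simps)
    with le[of c f] show ?thesis by simp
  qed
  show "norm (a *\<^sub>R f) = \<bar>a\<bar> * norm f"
    by (simp add: scaleR_hinf_def eq)
qed

end


section \<open>Extension to the closed ball and composition operators\<close>

text \<open>The extension is determined on \<^term>\<open>cball 0 1\<close> only (see the two lemmas below) and is
  used only there.\<close>

definition closed_ball_ext ::
    "('a::complex_normed_vector, 'b::complex_banach) hlip0 \<Rightarrow> 'a \<Rightarrow> 'b" where
  "closed_ball_ext f = (SOME g. (\<exists>C. C-lipschitz_on (cball 0 1) g) \<and>
     (\<forall>x\<in>ball 0 1. g x = apply_hlip0 f x))"

lemma closed_ball_ext:
  shows "\<exists>C. C-lipschitz_on (cball 0 1) (closed_ball_ext f)"
    and "x \<in> ball 0 1 \<Longrightarrow> closed_ball_ext f x = apply_hlip0 f x"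
proof -
  obtain C where "C-lipschitz_on (ball 0 1) (apply_hlip0 f)"
    using apply_hlip0[of f] by auto
  then obtain g where "C-lipschitz_on (closure (ball 0 1)) g" "\<forall>x\<in>ball 0 1. g x = apply_hlip0 f x"
    using lipschitz_extend_closure by blast
  then have "\<exists>g. (\<exists>C. C-lipschitz_on (cball 0 1) g) \<and> (\<forall>x\<in>ball 0 1. g x = apply_hlip0 f x)"
    by auto
  from someI_ex[OF this]
  show "\<exists>C. C-lipschitz_on (cball 0 1) (closed_ball_ext f)"
    and "x \<in> ball 0 1 \<Longrightarrow> closed_ball_ext f x = apply_hlip0 f x"
    unfolding closed_ball_ext_def by blast+
qed

lemma closed_ball_ext_unique:
  assumes "C-lipschitz_on (cball 0 1) g" "\<And>x. x \<in> ball 0 1 \<Longrightarrow> g x = apply_hlip0 f x"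
    and "x \<in> cball 0 1"
  shows "g x = closed_ball_ext f x"
proof -
  obtain D where D: "D-lipschitz_on (cball 0 1) (closed_ball_ext f)"
    using closed_ball_ext(1) by blast
  have "continuous_on (closure (ball 0 1)) (\<lambda>x. g x - closed_ball_ext f x)"
    using lipschitz_on_continuous_on[OF assms(1)] lipschitz_on_continuous_on[OF D]
    by (simp add: continuous_on_diff)
  then have "g x - closed_ball_ext f x = 0"
    by (rule continuous_constant_on_closure)
       (use assms(2,3) closed_ball_ext(2)[of _ f] in auto)
  then show ?thesis by simp
qed

text \<open>Composition with \<open>\<phi>\<close> makes sense only if \<open>\<phi>\<close> maps the open ball into the open ball;
  otherwise both operators are set to 0.\<close>

lift_definition comp_hlip0 ::
    "('y::complex_normed_vector, 'x::complex_normed_vector) hlip0 \<Rightarrow>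
     ('x, complex) hlip0 \<Rightarrow> ('y, complex) hlip0"
  is "\<lambda>\<phi> f y. if \<phi> ` ball 0 1 \<subseteq> ball 0 1 \<and> y \<in> ball 0 1 then f (\<phi> y) else 0"
proof -
  fix \<phi> :: "'y \<Rightarrow> 'x" and f :: "'x \<Rightarrow> complex"
  assume \<phi>: "holomorphic_map_on (ball 0 1) \<phi> \<and> (\<exists>C. C-lipschitz_on (ball 0 1) \<phi>) \<and>
      \<phi> 0 = 0 \<and> (\<forall>x. x \<notin> ball 0 1 \<longrightarrow> \<phi> x = 0)"
    and f: "holomorphic_map_on (ball 0 1) f \<and> (\<exists>C. C-lipschitz_on (ball 0 1) f) \<and>
      f 0 = 0 \<and> (\<forall>x. x \<notin> ball 0 1 \<longrightarrow> f x = 0)"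
  let ?h = "\<lambda>y. if \<phi> ` ball 0 1 \<subseteq> ball 0 1 \<and> y \<in> ball 0 1 then f (\<phi> y) else 0"
  show "holomorphic_map_on (ball 0 1) ?h \<and> (\<exists>C. C-lipschitz_on (ball 0 1) ?h) \<and>
      ?h 0 = 0 \<and> (\<forall>x. x \<notin> ball 0 1 \<longrightarrow> ?h x = 0)"
  proof (cases "\<phi> ` ball 0 1 \<subseteq> ball 0 1")
    case True
    obtain C D where CD: "C-lipschitz_on (ball 0 1) \<phi>" "D-lipschitz_on (ball 0 1) f"
      using \<phi> f by blast
    have "(D * C)-lipschitz_on (ball 0 1) (\<lambda>y. f (\<phi> y))"
      by (rule lipschitz_on_compose2[OF CD(1) lipschitz_on_subset[OF CD(2) True]])
    then have "(D * C)-lipschitz_on (ball 0 1) ?h"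
      by (rule lipschitz_on_transform) (use True in auto)
    moreover have "holomorphic_map_on (ball 0 1) ?h"
      by (rule holomorphic_map_on_cong[OF open_ball _ holomorphic_map_on_compose[OF _ _ True]])
         (use True \<phi> f in auto)
    moreover have "?h 0 = 0" "\<forall>x. x \<notin> ball 0 1 \<longrightarrow> ?h x = 0"
      using \<phi> f by simp_all
    ultimately show ?thesis by blast
  next
    case False
    then show ?thesis
      by (simp add: holomorphic_map_on_const ex_lipschitz_on_zero)
  qed
qed

lift_definition comp_hinf ::
    "('y::complex_normed_vector, 'x::complex_normed_vector) hlip0 \<Rightarrow> 'x hinf \<Rightarrow> 'y hinf"
  is "\<lambda>\<phi> f y. if \<phi> ` ball 0 1 \<subseteq> ball 0 1 \<and> y \<in> ball 0 1 then f (\<phi> y) else 0"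
proof -
  fix \<phi> :: "'y \<Rightarrow> 'x" and f :: "'x \<Rightarrow> complex"
  assume \<phi>: "holomorphic_map_on (ball 0 1) \<phi> \<and> (\<exists>C. C-lipschitz_on (ball 0 1) \<phi>) \<and>
      \<phi> 0 = 0 \<and> (\<forall>x. x \<notin> ball 0 1 \<longrightarrow> \<phi> x = 0)"
    and f: "holomorphic_map_on (ball 0 1) f \<and> bounded (f ` ball 0 1) \<and>
      (\<forall>x. x \<notin> ball 0 1 \<longrightarrow> f x = 0)"
  let ?h = "\<lambda>y. if \<phi> ` ball 0 1 \<subseteq> ball 0 1 \<and> y \<in> ball 0 1 then f (\<phi> y) else 0"
  show "holomorphic_map_on (ball 0 1) ?h \<and> bounded (?h ` ball 0 1) \<and>
      (\<forall>x. x \<notin> ball 0 1 \<longrightarrow> ?h x = 0)"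
  proof (cases "\<phi> ` ball 0 1 \<subseteq> ball 0 1")
    case True
    have "?h ` ball 0 1 \<subseteq> f ` ball 0 1" using True by force
    moreover have "bounded (f ` ball 0 1)" using f by simp
    ultimately have "bounded (?h ` ball 0 1)" by (rule bounded_subset[rotated])
    moreover have "holomorphic_map_on (ball 0 1) ?h"
      by (rule holomorphic_map_on_cong[OF open_ball _ holomorphic_map_on_compose[OF _ _ True]])
         (use True \<phi> f in auto)
    ultimately show ?thesis by simp
  next
    case False
    then show ?thesis
      by (simp add: holomorphic_map_on_const image_constant_conv)
  qed
qed

lemma clinear_comp_hlip0: "clinear (comp_hlip0 \<phi>)"
  by (rule clinearI; transfer; force)

lemma clinear_comp_hinf: "clinear (comp_hinf \<phi>)"
  by (rule clinearI; transfer; force)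

end

theory Submission
  imports Defs "HOL-Complex_Analysis.Conformal_Mappings"
begin

text \<open>
  The core is the implication from \<open>S2\<close> to \<open>S3\<close>, proved by contraposition. Suppose that
  \<open>\<phi>\<close> does not decrease the norm at some \<open>y \<noteq> 0\<close> of the closed ball. A functional \<open>\<Lambda>\<close> norming
  \<open>\<phi> y\<close> (Hahn-Banach, \<open>exists_norming_functional\<close>) and the complex line through \<open>y\<close>, with unit
  vector \<open>u\<close>, give a holomorphic map \<open>h z = \<Lambda> (\<phi> (z u))\<close> of the disc into itself with \<open>h 0 = 0\<close>
  and \<open>h t \<longlongrightarrow> 1\<close> as \<open>t\<close> increases to \<open>1\<close>: by continuity if \<open>y\<close> lies on the sphere, and
  otherwise because equality in the Schwarz lemma forces \<open>h z = z\<close>. The Schwarz lemma also keeps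
  \<open>\<bar>1 - h t\<bar>\<close> at least as large as \<open>1 - t\<close>, so \<open>h\<close> cannot be flat near \<open>1\<close>: there are points with
  \<open>\<bar>h'\<bar> \<ge> 1/2\<close> whose values accumulate at \<open>1\<close> (\<open>closure_steep_values\<close>).

  A subset of the disc that accumulates at \<open>1\<close> contains a sequence on which bounded sequences
  can be interpolated, up to constants, by bounded holomorphic functions \<open>E a\<close> depending linearly
  on \<open>a\<close> (\<open>bounded_sequence_interpolation\<close>). If \<open>g\<close> is the primitive of \<open>E a\<close> with \<open>g 0 = 0\<close>, then
  \<open>a \<mapsto> g \<circ> \<Lambda>\<close> embeds \<open>\<ell>\<^sub>\<infinity>\<close> into the Lipschitz functions, and composition with \<open>\<phi>\<close> is bounded
  below on this copy, because along the line the derivative of \<open>g \<circ> \<Lambda> \<circ> \<phi>\<close> is \<open>E a (h z) h' z\<close>.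

  The other implications compare finite nets. A compact operator cannot be bounded below on the
  unit vectors of \<open>\<ell>\<^sub>\<infinity>\<close>, and a net for the functions \<open>\<Lambda> \<circ> \<phi>\<close> yields one for the range of
  \<open>\<phi>\<close>, since functionals determine distances. From \<open>S3\<close> with finite-dimensional domain
  the range of \<open>\<phi>\<close> lies in a ball of radius \<open>\<rho> < 1\<close>, where bounded holomorphic functions are
  equi-Lipschitz by Cauchy's estimate; an argument of Arzela-Ascoli type then gives \<open>S4\<close>. From
  \<open>S4\<close> to \<open>S1\<close>, the Lipschitz constant of \<open>f \<circ> \<phi>\<close> is governed by the derivative of \<open>f\<close> on the
  range of \<open>\<phi>\<close>, hence by finitely many directional derivatives, which are bounded holomorphic
  functions. Nets decide compactness because both function spaces are complete, and this in turn
  holds because uniform limits of scalar holomorphic functions are holomorphic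
  (\<open>holomorphic_map_on_uniform_limit\<close>).
\<close>

section \<open>Norming functionals\<close>

definition sublinear :: "('a::real_vector \<Rightarrow> real) \<Rightarrow> bool" where
  "sublinear p \<longleftrightarrow> (\<forall>x y. p (x + y) \<le> p x + p y) \<and> (\<forall>c\<ge>0. \<forall>x. p (c *\<^sub>R x) = c * p x)"

lemma sublinear_lower_bound:
  assumes "sublinear p"
  shows "- p (- x) \<le> p x"
proof -
  have "p (x + - x) \<le> p x + p (- x)" "p (0 *\<^sub>R x) = 0 * p x"
    using assms unfolding sublinear_def by blast+
  then show ?thesis by simp
qed

text \<open>
  Taking the infimum along the ray spanned by \<open>z\<close> lowers \<open>p\<close> as far as is needed for oddness
  in the direction \<open>z\<close>. The bound \<open>- p (- x)\<close> keeps the infimum finite.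
\<close>

lemma sublinear_decrease:
  fixes p :: "'a::real_vector \<Rightarrow> real"
  assumes p: "sublinear p"
  obtains q where "sublinear q" "\<And>x. q x \<le> p x" "q (- z) \<le> - p z"
proof
  define q where "q x = (INF t\<in>{0..}. p (x + t *\<^sub>R z) - t * p z)" for x
  have add: "p (x + y) \<le> p x + p y" and scale: "0 \<le> c \<Longrightarrow> p (c *\<^sub>R x) = c * p x" for x y c
    using p unfolding sublinear_def by blast+
  have lower: "- p (- x) \<le> p (x + t *\<^sub>R z) - t * p z" if "0 \<le> t" for x t
    using add[of "x + t *\<^sub>R z" "- x"] scale[of t z] that by simp
  have le: "q x \<le> p (x + t *\<^sub>R z) - t * p z" if "0 \<le> t" for x t
    unfolding q_def using that lower by (intro cINF_lower bdd_belowI2[of _ "- p (- x)"]) auto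
  have ge: "m \<le> q x" if "\<And>t. 0 \<le> t \<Longrightarrow> m \<le> p (x + t *\<^sub>R z) - t * p z" for m x
    unfolding q_def using that by (intro cINF_greatest) auto
  show "q x \<le> p x" for x using le[of 0 x] by simp
  show "q (- z) \<le> - p z" using le[of 1 "- z"] scale[of 0 0] by simp
  have q_add: "q (x + y) \<le> q x + q y" for x y
  proof -
    have "q (x + y) - (p (x + s *\<^sub>R z) - s * p z) \<le> q y" if s: "0 \<le> s" for s
    proof (rule ge)
      fix t :: real assume t: "0 \<le> t"
      show "q (x + y) - (p (x + s *\<^sub>R z) - s * p z) \<le> p (y + t *\<^sub>R z) - t * p z"
        using le[of "s + t" "x + y"] add[of "x + s *\<^sub>R z" "y + t *\<^sub>R z"] s t
        by (simp add: algebra_simps)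
    qed
    then have "q (x + y) - q y \<le> q x" by (intro ge) (simp add: algebra_simps)
    then show ?thesis by simp
  qed
  have q0: "q 0 = 0"
    by (rule antisym) (use le[of 0 0] scale[of 0 0] in simp, rule ge, use scale[of _ z] in simp)
  have q_le: "q (c *\<^sub>R x) \<le> c * q x" if c: "0 < c" for c x
  proof -
    have "q (c *\<^sub>R x) / c \<le> q x"
    proof (rule ge)
      fix t :: real assume t: "0 \<le> t"
      show "q (c *\<^sub>R x) / c \<le> p (x + t *\<^sub>R z) - t * p z"
        using le[of "c * t" "c *\<^sub>R x"] scale[of c "x + t *\<^sub>R z"] c t
        by (simp add: field_simps scaleR_right_distrib)
    qed
    then show ?thesis using c by (simp add: field_simps)
  qed
  have "q (c *\<^sub>R x) = c * q x" if "0 \<le> c" for c x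
  proof (cases "c = 0")
    case False
    then have "q x \<le> inverse c * q (c *\<^sub>R x)"
      using q_le[of "inverse c" "c *\<^sub>R x"] that by simp
    then show ?thesis using q_le[of c x] False that by (simp add: field_simps)
  qed (simp add: q0)
  with q_add show "sublinear q" unfolding sublinear_def by blast
qed

text \<open>
  Zorn's lemma for the sublinear minorants of \<open>p\<close>, ordered downwards. All of them are at least
  \<open>- p (- x)\<close> at \<open>x\<close>, so the pointwise infimum over a chain is finite; it is subadditive because
  any two members of the chain are comparable.
\<close>

lemma sublinear_minimal:
  fixes p :: "'a::real_vector \<Rightarrow> real"
  assumes p: "sublinear p"
  obtains q where "sublinear q" "\<And>x. q x \<le> p x"
    "\<And>r. sublinear r \<Longrightarrow> (\<And>x. r x \<le> q x) \<Longrightarrow> r = q"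
proof -
  let ?A = "{q. sublinear q \<and> (\<forall>x. q x \<le> p x)}"
  let ?P = "\<lambda>q r :: 'a \<Rightarrow> real. \<forall>x. r x \<le> q x"
  have "\<exists>m\<in>?A. \<forall>a\<in>?A. ?P m a \<longrightarrow> a = m"
  proof (rule predicate_Zorn)
    show "partial_order_on ?A (relation_of ?P ?A)"
    proof (rule partial_order_on_relation_ofI)
      show "?P q r" if "?P q s" "?P s r" for q r s :: "'a \<Rightarrow> real"
        using that order_trans by blast
      show "q = r" if "?P q r" "?P r q" for q r :: "'a \<Rightarrow> real"
        using that by (intro ext antisym) auto
    qed simp
    fix C assume "C \<in> Chains (relation_of ?P ?A)"
    then have C: "C \<subseteq> ?A" "\<And>q r. q \<in> C \<Longrightarrow> r \<in> C \<Longrightarrow> ?P q r \<or> ?P r q"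
      unfolding Chains_def relation_of_def by auto
    show "\<exists>u\<in>?A. \<forall>q\<in>C. ?P q u"
    proof (cases "C = {}")
      case True
      then show ?thesis using p by auto
    next
      case False
      define u where "u x = (INF q\<in>C. q x)" for x
      have lower: "- p (- x) \<le> q x" if "q \<in> C" for q x
      proof -
        have "q (- x) \<le> p (- x)" "sublinear q" using C(1) that by auto
        then show ?thesis using sublinear_lower_bound[of q x] by simp
      qed
      have le: "u x \<le> q x" if "q \<in> C" for q x
        unfolding u_def using that lower by (intro cINF_lower bdd_belowI2[of _ "- p (- x)"]) auto
      have ge: "m \<le> u x" if "\<And>q. q \<in> C \<Longrightarrow> m \<le> q x" for m x
        unfolding u_def using that False by (intro cINF_greatest) auto
      have add: "q (x + y) \<le> q x + q y" and scale: "0 \<le> c \<Longrightarrow> q (c *\<^sub>R x) = c * q x"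
        if "q \<in> C" for q x y c
        using that C(1) unfolding sublinear_def by blast+
      have u_add: "u (x + y) \<le> u x + u y" for x y
      proof -
        have "u (x + y) - q x \<le> u y" if q: "q \<in> C" for q
        proof (rule ge)
          fix r assume r: "r \<in> C"
          from C(2)[OF q r] show "u (x + y) - q x \<le> r y"
          proof
            assume "?P q r"
            then have "r x \<le> q x" by blast
            then show ?thesis using le[OF r, of "x + y"] add[OF r, of x y] by linarith
          next
            assume "?P r q"
            then have "q y \<le> r y" by blast
            then show ?thesis using le[OF q, of "x + y"] add[OF q, of x y] by linarith
          qed
        qed
        then have "u (x + y) - u y \<le> u x" by (intro ge) (simp add: algebra_simps)
        then show ?thesis by simp
      qed
      have u_scale: "u (c *\<^sub>R x) = c * u x" if c: "0 \<le> c" for c x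
      proof (cases "c = 0")
        case True
        have "(INF q\<in>C. q 0) = (INF q\<in>C. 0)"
          using scale[of _ 0 0] by (intro INF_cong) auto
        then have "u 0 = 0"
          using \<open>C \<noteq> {}\<close> by (simp add: u_def)
        with True show ?thesis by simp
      next
        case False
        with c have "0 < c" by simp
        have "u (c *\<^sub>R x) / c \<le> u x"
        proof (rule ge)
          fix q assume "q \<in> C"
          then show "u (c *\<^sub>R x) / c \<le> q x"
            using le[of q "c *\<^sub>R x"] scale[of q c x] \<open>0 < c\<close> by (simp add: field_simps)
        qed
        moreover have "c * u x \<le> u (c *\<^sub>R x)"
        proof (rule ge)
          fix q assume "q \<in> C"
          then show "c * u x \<le> q (c *\<^sub>R x)"
            using le[of q x] scale[of q c x] \<open>0 < c\<close> by simp
        qed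
        ultimately show ?thesis using \<open>0 < c\<close> by (simp add: field_simps)
      qed
      obtain q0 where "q0 \<in> C" using False by blast
      then have "\<And>x. u x \<le> p x" using C(1) le order_trans by blast
      with u_add u_scale le show ?thesis unfolding sublinear_def by blast
    qed
  qed
  then obtain q where q: "sublinear q" "\<forall>x. q x \<le> p x"
    and min: "\<And>r. sublinear r \<Longrightarrow> \<forall>x. r x \<le> p x \<Longrightarrow> \<forall>x. r x \<le> q x \<Longrightarrow> r = q"
    by auto
  show thesis
  proof
    show "r = q" if "sublinear r" "\<And>x. r x \<le> q x" for r
    proof (rule min[OF that(1)])
      show "\<forall>x. r x \<le> p x" using q(2) that(2) order_trans by blast
    qed (use that(2) in blast)
  qed (use q in blast)+
qed

text \<open>
  Hahn-Banach. A minimal sublinear functional cannot be lowered along any ray, so it is odd, and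
  an odd sublinear functional is linear. Lowering \<open>p\<close> along the ray of \<open>z\<close> before minimising
  fixes the value at \<open>z\<close>.
\<close>

lemma exists_dominated_functional:
  fixes p :: "'a::real_vector \<Rightarrow> real"
  assumes "sublinear p"
  obtains f where "linear f" "\<And>x. f x \<le> p x" "f z = p z"
proof -
  obtain p' where p': "sublinear p'" "\<And>x. p' x \<le> p x" "p' (- z) \<le> - p z"
    using sublinear_decrease[OF assms, where z = z] by blast
  obtain f where f: "sublinear f" "\<And>x. f x \<le> p' x"
    "\<And>r. sublinear r \<Longrightarrow> (\<And>x. r x \<le> f x) \<Longrightarrow> r = f"
    using sublinear_minimal[OF p'(1)] by blast
  have odd: "f (- x) = - f x" for x
  proof -
    obtain r where "sublinear r" "\<And>y. r y \<le> f y" "r (- x) \<le> - f x"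
      using sublinear_decrease[OF f(1), where z = x] by blast
    then show ?thesis using f(3)[of r] sublinear_lower_bound[OF f(1), of x] by simp
  qed
  have add: "f (x + y) \<le> f x + f y" and scale: "0 \<le> c \<Longrightarrow> f (c *\<^sub>R x) = c * f x" for x y c
    using f(1) unfolding sublinear_def by blast+
  show thesis
  proof
    show "linear f"
    proof (rule linearI)
      show "f (x + y) = f x + f y" for x y
        using add[of x y] add[of "- x" "- y"] odd[of "x + y"] odd[of x] odd[of y] by simp
      show "f (c *\<^sub>R x) = c *\<^sub>R f x" for c x
        using scale[of c x] scale[of "- c" x] odd[of "c *\<^sub>R x"] by (cases "0 \<le> c") auto
    qed
    show "f x \<le> p x" for x using f(2) p'(2) order_trans by blast
    show "f z = p z"
      using f(2)[of z] p'(2)[of z] f(2)[of "- z"] p'(3) odd[of z] by simp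
  qed
qed

text \<open>
  The real functional \<open>f\<close> from Hahn-Banach is complexified as \<open>x \<mapsto> f x - \<i> f (\<i> x)\<close>; rotating
  the argument until the value is real reduces the bound on the modulus to the bound on \<open>f\<close>.
\<close>

lemma exists_norming_functional:
  fixes z :: "'a::complex_normed_vector"
  obtains \<Lambda> :: "'a \<Rightarrow> complex"
  where "clinear \<Lambda>" "\<And>x. cmod (\<Lambda> x) \<le> norm x" "\<Lambda> z = complex_of_real (norm z)"
proof -
  have "sublinear (norm :: 'a \<Rightarrow> real)"
    by (simp add: sublinear_def norm_triangle_ineq)
  then obtain f :: "'a \<Rightarrow> real" where f: "linear f" "\<And>x. f x \<le> norm x" "f z = norm z"
    using exists_dominated_functional[where z = z] by blast
  define \<Lambda> where "\<Lambda> x = Complex (f x) (- f (\<i> *\<^sub>C x))" for x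
  have decomp: "c *\<^sub>C x = Re c *\<^sub>R x + Im c *\<^sub>R (\<i> *\<^sub>C x)" for c and x :: 'a
    by (subst complex_eq[of c])
       (simp add: scaleC_add_left scaleC_scaleC mult.commute flip: scaleC_of_real)
  have i_i: "\<i> *\<^sub>C (\<i> *\<^sub>C x) = - x" for x :: 'a
    by (simp add: scaleC_scaleC)
  have clin: "clinear \<Lambda>"
  proof (rule clinearI)
    show "\<Lambda> (x + y) = \<Lambda> x + \<Lambda> y" for x y
      by (simp add: \<Lambda>_def complex_eq_iff scaleC_add_right linear_add[OF f(1)])
    show "\<Lambda> (c *\<^sub>C x) = c *\<^sub>C \<Lambda> x" for c x
    proof -
      have "\<i> *\<^sub>C (c *\<^sub>C x) = Re c *\<^sub>R (\<i> *\<^sub>C x) - Im c *\<^sub>R x"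
      proof -
        have "\<i> *\<^sub>C (c *\<^sub>C x) = c *\<^sub>C (\<i> *\<^sub>C x)"
          by (simp only: scaleC_scaleC mult.commute)
        then show ?thesis
          using decomp[of c "\<i> *\<^sub>C x"] i_i[of x] by (simp only: scaleR_minus_right add_uminus_conv_diff)
      qed
      then have "f (\<i> *\<^sub>C (c *\<^sub>C x)) = Re c * f (\<i> *\<^sub>C x) - Im c * f x"
        by (simp only: linear_diff[OF f(1)] linear_scale[OF f(1)] real_scaleR_def)
      moreover have "f (c *\<^sub>C x) = Re c * f x + Im c * f (\<i> *\<^sub>C x)"
        by (simp only: decomp[of c x] linear_add[OF f(1)] linear_scale[OF f(1)] real_scaleR_def)
      ultimately show ?thesis
        by (simp add: \<Lambda>_def complex_eq_iff scaleC_complex_def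
            del: complex_vector.scale_scale)
    qed
  qed
  have bound: "cmod (\<Lambda> x) \<le> norm x" for x
  proof (cases "\<Lambda> x = 0")
    case False
    define \<theta> where "\<theta> = cnj (\<Lambda> x) / cmod (\<Lambda> x)"
    have \<theta>: "cmod \<theta> = 1" using False by (simp add: \<theta>_def norm_divide)
    have "\<Lambda> (\<theta> *\<^sub>C x) = complex_of_real (cmod (\<Lambda> x))"
    proof -
      have "\<Lambda> (\<theta> *\<^sub>C x) = \<theta> * \<Lambda> x"
        using clin unfolding clinear_iff by (simp add: scaleC_complex_def)
      also have "\<dots> = complex_of_real (cmod (\<Lambda> x))"
        using False complex_norm_square[of "\<Lambda> x"]
        by (simp add: \<theta>_def field_simps power2_eq_square)
      finally show ?thesis .
    qed
    then have "f (\<theta> *\<^sub>C x) = cmod (\<Lambda> x)"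
      by (simp add: \<Lambda>_def complex_eq_iff)
    then show ?thesis using f(2)[of "\<theta> *\<^sub>C x"] by (simp add: norm_scaleC \<theta>)
  qed simp
  have "\<Lambda> z = complex_of_real (norm z)"
  proof -
    have Re: "Re (\<Lambda> z) = norm z" using f(3) by (simp add: \<Lambda>_def)
    moreover have "(cmod (\<Lambda> z))\<^sup>2 \<le> (norm z)\<^sup>2"
      using bound[of z] by (intro power_mono) auto
    ultimately have "Im (\<Lambda> z) = 0"
      by (simp add: cmod_power2)
    with Re show ?thesis by (simp add: complex_eq_iff)
  qed
  with clin bound show thesis using that by blast
qed


section \<open>Scalar holomorphic functions on a normed space\<close>

lemma clinear_imp_mult:
  fixes D :: "'a::complex_normed_vector \<Rightarrow> complex"
  assumes "clinear D"
  shows "D (c *\<^sub>C x) = c * D x"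
  using assms unfolding clinear_iff by (simp add: scaleC_complex_def)

lemma clinear_diff:
  assumes "clinear f"
  shows "f (x - y) = f x - f y"
proof -
  have "f (x - y + y) = f (x - y) + f y"
    using assms unfolding clinear_iff by blast
  then show ?thesis by simp
qed

lemma bounded_linear_scaleC_left:
  "bounded_linear (\<lambda>c. c *\<^sub>C h)" for h :: "'a::complex_normed_vector"
proof (rule bounded_linear_intro)
  show "(c + d) *\<^sub>C h = c *\<^sub>C h + d *\<^sub>C h" for c d
    by (rule scaleC_add_left)
  show "(r *\<^sub>R c) *\<^sub>C h = r *\<^sub>R (c *\<^sub>C h)" for r c
    by (simp add: scaleR_conv_of_real flip: scaleC_of_real)
  show "norm (c *\<^sub>C h) \<le> norm c * norm h" for c
    by (simp add: norm_scaleC)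
qed

lemma has_field_derivative_along_line:
  fixes f :: "'a::complex_normed_vector \<Rightarrow> complex"
  assumes "(f has_derivative D) (at (x + c *\<^sub>C h))" "clinear D"
  shows "((\<lambda>c. f (x + c *\<^sub>C h)) has_field_derivative D h) (at c)"
proof -
  have "((\<lambda>c. x + c *\<^sub>C h) has_derivative (\<lambda>c. c *\<^sub>C h)) (at c)"
    using has_derivative_add[OF has_derivative_const bounded_linear_imp_has_derivative
        [OF bounded_linear_scaleC_left[of h]]] by simp
  from has_derivative_compose[OF this assms(1)] show ?thesis
    by (simp add: has_field_derivative_def clinear_imp_mult[OF assms(2)] mult.commute[of _ "D h"])
qed

lemma holomorphic_map_on_along_line:
  fixes f :: "'a::complex_normed_vector \<Rightarrow> complex"
  assumes "holomorphic_map_on U f" "\<And>c. c \<in> V \<Longrightarrow> x + c *\<^sub>C h \<in> U"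
  shows "(\<lambda>c. f (x + c *\<^sub>C h)) holomorphic_on V"
proof (rule holomorphic_onI)
  fix c assume "c \<in> V"
  then obtain D where "clinear D" "(f has_derivative D) (at (x + c *\<^sub>C h))"
    using assms by (meson holomorphic_map_onE)
  then have "((\<lambda>c. f (x + c *\<^sub>C h)) has_field_derivative D h) (at c)"
    by (rule has_field_derivative_along_line[rotated])
  then show "(\<lambda>c. f (x + c *\<^sub>C h)) field_differentiable at c within V"
    using field_differentiable_at_within field_differentiable_def by blast
qed

text \<open>
  Cauchy's inequality in one variable, applied on a complex line through \<open>x\<close>. The factor \<open>2\<close>
  comes from halving the radius so that the closed disc stays inside the open ball.
\<close>

lemma Cauchy_estimate:
  fixes f :: "'a::complex_normed_vector \<Rightarrow> complex"
  assumes f: "holomorphic_map_on (ball x r) f" and r: "0 < r"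
    and M: "\<And>y. y \<in> ball x r \<Longrightarrow> cmod (f y) \<le> M"
    and D: "(f has_derivative D) (at x)" "clinear D"
  shows "cmod (D h) \<le> 2 * M / r * norm h"
proof (cases "h = 0")
  case True
  then show ?thesis using clinear_imp_mult[OF D(2), of 0 0] by simp
next
  case False
  define s where "s = r / (2 * norm h)"
  have s: "0 < s" using r False by (simp add: s_def)
  have mem: "x + c *\<^sub>C h \<in> ball x r" if "c \<in> cball 0 s" for c
  proof -
    have "norm (c *\<^sub>C h) \<le> s * norm h"
      using that by (simp add: norm_scaleC mult_right_mono)
    also have "s * norm h < r" using r False by (simp add: s_def)
    finally show ?thesis by (simp add: dist_norm)
  qed
  have "norm ((deriv ^^ 1) (\<lambda>c. f (x + c *\<^sub>C h)) 0) \<le> fact 1 * M / s ^ 1"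
  proof (rule Cauchy_inequality)
    show "(\<lambda>c. f (x + c *\<^sub>C h)) holomorphic_on ball 0 s"
      using mem by (intro holomorphic_map_on_along_line[OF f]) auto
    show "continuous_on (cball 0 s) (\<lambda>c. f (x + c *\<^sub>C h))"
      using mem
      by (intro holomorphic_on_imp_continuous_on holomorphic_map_on_along_line[OF f]) auto
    show "norm (f (x + c *\<^sub>C h)) \<le> M" if "norm (0 - c) = s" for c
      using that by (intro M mem) simp
  qed (rule s)
  moreover have "deriv (\<lambda>c. f (x + c *\<^sub>C h)) 0 = D h"
    by (rule DERIV_imp_deriv, rule has_field_derivative_along_line) (use D in auto)
  ultimately show ?thesis
    by (simp add: s_def mult_ac)
qed

text \<open>
  By the Cauchy estimate, uniform convergence of the functions forces uniform convergence of
  their derivatives on smaller balls, so the sequence may be differentiated term by term.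
\<close>

lemma holomorphic_map_on_uniform_limit:
  fixes f :: "nat \<Rightarrow> 'a::complex_normed_vector \<Rightarrow> complex"
  assumes U: "open U" and f: "\<And>n. holomorphic_map_on U (f n)"
    and lim: "uniform_limit U f g sequentially"
  shows "holomorphic_map_on U g"
  unfolding holomorphic_map_on_def
proof
  fix x assume "x \<in> U"
  then obtain r where r: "0 < r" "ball x (2 * r) \<subseteq> U"
    using U openE[of U x] by (metis field_sum_of_halves half_gt_zero mult_2)
  have sub: "ball y r \<subseteq> U" if "y \<in> ball x r" for y
  proof
    fix z assume "z \<in> ball y r"
    then have "dist x z < 2 * r" using that dist_triangle[of x z y] by simp
    then show "z \<in> U" using r(2) by auto
  qed
  have "\<exists>D. clinear D \<and> (f n has_derivative D) (at y)" if "y \<in> ball x r" for n y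
    using f[of n] sub[OF that] r(1) unfolding holomorphic_map_on_def
    by (meson centre_in_ball subsetD)
  then have "\<forall>n y. \<exists>D. y \<in> ball x r \<longrightarrow> clinear D \<and> (f n has_derivative D) (at y)"
    by blast
  then obtain D where D: "\<And>n y. y \<in> ball x r \<Longrightarrow> clinear (D n y)"
    "\<And>n y. y \<in> ball x r \<Longrightarrow> (f n has_derivative D n y) (at y)"
    unfolding choice_iff by blast
  have close: "\<exists>N. \<forall>m\<ge>N. \<forall>n\<ge>N. \<forall>y\<in>ball x r. \<forall>h. cmod (D m y h - D n y h) \<le> e * norm h"
    if e: "0 < e" for e
  proof -
    have "\<forall>\<^sub>F n in sequentially. \<forall>y\<in>U. dist (f n y) (g y) < e * r / 4"
      using e r(1) by (intro uniform_limitD[OF lim]) simp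
    then obtain N where N: "\<And>n y. N \<le> n \<Longrightarrow> y \<in> U \<Longrightarrow> dist (f n y) (g y) < e * r / 4"
      unfolding eventually_sequentially by blast
    have "cmod (D m y h - D n y h) \<le> e * norm h"
      if mn: "N \<le> m" "N \<le> n" and y: "y \<in> ball x r" for m n y h
    proof -
      have "holomorphic_map_on (ball y r) (\<lambda>z. f m z - f n z)"
      proof -
        have "holomorphic_map_on U (\<lambda>z. f m z + (- 1) *\<^sub>C f n z)"
          by (intro holomorphic_map_on_add holomorphic_map_on_scaleC f)
        then show ?thesis
          using sub[OF y] unfolding holomorphic_map_on_def
          by (auto simp: scaleC_complex_def)
      qed
      moreover have "cmod (f m z - f n z) \<le> e * r / 2" if "z \<in> ball y r" for z
        using N[OF mn(1), of z] N[OF mn(2), of z] sub[OF y] that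
          dist_triangle2[of "f m z" "f n z" "g z"] by (auto simp: dist_norm)
      moreover have "((\<lambda>z. f m z - f n z) has_derivative (\<lambda>h. D m y h - D n y h)) (at y)"
        by (intro has_derivative_diff D y)
      moreover have "clinear (\<lambda>h. D m y h - D n y h)"
        using D(1)[OF y, of m] D(1)[OF y, of n]
        unfolding clinear_iff by (auto simp: scaleC_complex_def algebra_simps)
      ultimately have "cmod (D m y h - D n y h) \<le> 2 * (e * r / 2) / r * norm h"
        using Cauchy_estimate[OF _ r(1)] by blast
      then show ?thesis using r(1) by simp
    qed
    then show ?thesis by blast
  qed
  define D' where "D' y h = lim (\<lambda>n. D n y h)" for y h
  have D': "(\<lambda>n. D n y h) \<longlonglongrightarrow> D' y h" if y: "y \<in> ball x r" for y h
  proof -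
    have "Cauchy (\<lambda>n. D n y h)"
    proof (rule CauchyI)
      fix e :: real assume e: "0 < e"
      have "0 < e / (2 * (1 + norm h))"
        using e by (simp add: add_pos_nonneg)
      from close[OF this] obtain N where
        N: "\<And>m n. N \<le> m \<Longrightarrow> N \<le> n \<Longrightarrow> cmod (D m y h - D n y h) \<le> e / (2 * (1 + norm h)) * norm h"
        using y by blast
      have "e / (2 * (1 + norm h)) * norm h \<le> e / 2"
        using e by (simp add: field_simps add_pos_nonneg)
      also have "e / 2 < e" using e by simp
      finally show "\<exists>N. \<forall>m\<ge>N. \<forall>n\<ge>N. norm (D m y h - D n y h) < e"
        using N le_less_trans by blast
    qed
    then show ?thesis
      unfolding D'_def by (simp add: Cauchy_convergent_iff convergent_LIMSEQ_iff)
  qed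
  have "\<exists>k. \<forall>y\<in>ball x r. (\<lambda>n. f n y) \<longlonglongrightarrow> k y \<and> (k has_derivative D' y) (at y within ball x r)"
  proof (rule has_derivative_sequence)
    show "(f n has_derivative D n y) (at y within ball x r)" if "y \<in> ball x r" for n y
      using D(2)[OF that] has_derivative_at_withinI by blast
    show "\<forall>\<^sub>F n in sequentially. \<forall>y\<in>ball x r. \<forall>h. norm (D n y h - D' y h) \<le> e * norm h"
      if e: "0 < e" for e
    proof -
      obtain N where N: "\<And>m n y h. N \<le> m \<Longrightarrow> N \<le> n \<Longrightarrow> y \<in> ball x r \<Longrightarrow>
          cmod (D m y h - D n y h) \<le> e * norm h"
        using close[OF e] by blast
      have "norm (D n y h - D' y h) \<le> e * norm h" if "N \<le> n" "y \<in> ball x r" for n y h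
      proof (rule tendsto_upperbound)
        show "(\<lambda>m. norm (D n y h - D m y h)) \<longlonglongrightarrow> norm (D n y h - D' y h)"
          by (intro tendsto_intros D' that)
        show "\<forall>\<^sub>F m in sequentially. norm (D n y h - D m y h) \<le> e * norm h"
          using N that unfolding eventually_sequentially by blast
      qed simp
      then show ?thesis unfolding eventually_sequentially by blast
    qed
    show "(\<lambda>n. f n x) \<longlonglongrightarrow> g x"
      using tendsto_uniform_limitI[OF lim \<open>x \<in> U\<close>] .
  qed (use r(1) in auto)
  then obtain k where k: "\<And>y. y \<in> ball x r \<Longrightarrow> (\<lambda>n. f n y) \<longlonglongrightarrow> k y"
    "(k has_derivative D' x) (at x within ball x r)"
    using r(1) centre_in_ball by blast
  have kg: "k y = g y" if "y \<in> ball x r" for y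
  proof -
    have "y \<in> U" using sub[OF that] r(1) by auto
    then show ?thesis
      using k(1)[OF that] tendsto_uniform_limitI[OF lim] LIMSEQ_unique by blast
  qed
  have x: "x \<in> ball x r" using r(1) by simp
  have "(k has_derivative D' x) (at x)"
    using k(2) at_within_open[OF x open_ball] by simp
  then have "(g has_derivative D' x) (at x)"
    by (rule has_derivative_transform_within_open[OF _ open_ball x]) (rule kg)
  moreover have "clinear (D' x)"
  proof (rule clinearI)
    fix h h' :: 'a and c :: complex
    have "(\<lambda>n. D n x (h + h')) \<longlonglongrightarrow> D' x h + D' x h'"
      using D(1)[OF x] tendsto_add[OF D'[OF x, of h] D'[OF x, of h']]
      by (simp add: clinear_iff)
    then show "D' x (h + h') = D' x h + D' x h'"
      using D'[OF x] LIMSEQ_unique by blast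
    have "(\<lambda>n. D n x (c *\<^sub>C h)) \<longlonglongrightarrow> c * D' x h"
      using tendsto_mult_left[OF D'[OF x, of h], of c]
      by (simp add: clinear_imp_mult[OF D(1)[OF x]])
    then show "D' x (c *\<^sub>C h) = c *\<^sub>C D' x h"
      using D'[OF x] LIMSEQ_unique by (auto simp: scaleC_complex_def)
  qed
  ultimately show "\<exists>D. clinear D \<and> (g has_derivative D) (at x)" by blast
qed

text \<open>
  First-order Taylor expansion with Cauchy's bound on the second derivative. The constant depends
  on \<open>M\<close> and \<open>r\<close> only; this gives the uniformity in the base point required below.
\<close>

lemma difference_quotient_bound:
  assumes g: "g holomorphic_on ball 0 r" and r: "0 < r"
    and M: "\<And>z. z \<in> ball 0 r \<Longrightarrow> cmod (g z) \<le> M"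
    and t: "t \<noteq> 0" "cmod t \<le> r / 4"
  shows "cmod ((g t - g 0) / t - deriv g 0) \<le> 8 * M / r\<^sup>2 * cmod t"
proof -
  let ?S = "cball 0 (r / 4) :: complex set"
  have sub: "cball z (r / 2) \<subseteq> ball 0 r" if "z \<in> ?S" for z
  proof
    fix w assume "w \<in> cball z (r / 2)"
    then have "cmod w \<le> r / 4 + r / 2"
      using that norm_triangle_ineq2[of w z] by (simp add: dist_norm norm_minus_commute)
    then show "w \<in> ball 0 r" using r by simp
  qed
  have "cmod ((deriv ^^ 0) g t - (\<Sum>i\<le>1. (deriv ^^ i) g 0 * (t - 0) ^ i / fact i))
      \<le> 8 * M / r\<^sup>2 * cmod (t - 0) ^ Suc 1 / fact 1"
  proof (rule complex_Taylor[where S = ?S])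
    fix i z assume z: "z \<in> ?S"
    then have "z \<in> ball 0 r" using r by auto
    then show "((deriv ^^ i) g has_field_derivative (deriv ^^ Suc i) g z) (at z within ?S)"
      using holomorphic_derivI[OF holomorphic_higher_deriv[OF g open_ball] open_ball]
      by simp
    have "cmod ((deriv ^^ 2) g z) \<le> fact 2 * M / (r / 2) ^ 2"
    proof (rule Cauchy_inequality)
      show "g holomorphic_on ball z (r / 2)"
        using g sub[OF z] ball_subset_cball holomorphic_on_subset by blast
      show "continuous_on (cball z (r / 2)) g"
        using g sub[OF z] holomorphic_on_imp_continuous_on continuous_on_subset by blast
      show "cmod (g w) \<le> M" if "cmod (z - w) = r / 2" for w
        using that sub[OF z] by (intro M) (auto simp: dist_norm)
    qed (use r in simp)
    then show "cmod ((deriv ^^ Suc 1) g z) \<le> 8 * M / r\<^sup>2"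
      by (simp add: power_divide numeral_2_eq_2)
  qed (use t r in auto)
  then have "cmod (g t - g 0 - deriv g 0 * t) \<le> 8 * M / r\<^sup>2 * cmod t ^ 2"
    by (simp add: algebra_simps numeral_2_eq_2)
  moreover have "(g t - g 0) / t - deriv g 0 = (g t - g 0 - deriv g 0 * t) / t"
    using t(1) by (simp add: field_simps)
  ultimately show ?thesis
    using t(1) by (simp add: norm_divide divide_le_eq power2_eq_square mult_ac)
qed

text \<open>
  On each ball of radius \<open>s < 1\<close> the difference quotients in the direction \<open>e\<close> are holomorphic
  and converge uniformly, so their limit is holomorphic.
\<close>

lemma holomorphic_map_on_directional_derivative:
  fixes f :: "'a::complex_normed_vector \<Rightarrow> complex"
  assumes f: "holomorphic_map_on (ball 0 1) f"
    and M: "\<And>x. x \<in> ball 0 1 \<Longrightarrow> cmod (f x) \<le> M"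
    and D: "\<And>x. x \<in> ball 0 1 \<Longrightarrow> (f has_derivative D x) (at x)"
      "\<And>x. x \<in> ball 0 1 \<Longrightarrow> clinear (D x)"
  shows "holomorphic_map_on (ball 0 1) (\<lambda>x. D x e)"
proof -
  have "holomorphic_map_on (ball 0 s) (\<lambda>x. D x e)" if s: "0 < s" "s < 1" for s
  proof (rule holomorphic_map_on_uniform_limit[OF open_ball])
    define r where "r = (1 - s) / (1 + norm e)"
    have r: "0 < r" using s by (simp add: r_def add_pos_nonneg)
    have mem: "x + c *\<^sub>C e \<in> ball 0 1" if x: "x \<in> ball 0 s" and c: "c \<in> ball 0 r" for x c
    proof -
      have "norm (c *\<^sub>C e) \<le> r * norm e"
        using c by (simp add: norm_scaleC mult_right_mono)
      also have "\<dots> \<le> r * (1 + norm e)" using r by simp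
      also have "\<dots> = 1 - s" by (simp add: r_def add_pos_nonneg less_imp_neq[symmetric])
      finally show ?thesis using x norm_triangle_ineq[of x "c *\<^sub>C e"] by simp
    qed
    define t where "t n = complex_of_real (r / 4 / Suc n)" for n
    have t: "t n \<noteq> 0" "cmod (t n) \<le> r / 4" "t n \<in> ball 0 r" for n
    proof -
      have *: "cmod (t n) = r / 4 / Suc n"
        using r by (simp only: t_def norm_of_real abs_of_nonneg zero_le_divide_iff) simp
      also have "\<dots> \<le> r / 4" using r by (simp add: field_simps)
      finally show "cmod (t n) \<le> r / 4" .
      with r show "t n \<in> ball 0 r" by simp
      show "t n \<noteq> 0" using r by (simp add: t_def del: of_nat_Suc)
    qed
    let ?q = "\<lambda>n x. (f (x + t n *\<^sub>C e) - f x) / t n"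
    show "holomorphic_map_on (ball 0 s) (?q n)" for n
    proof -
      have "holomorphic_map_on (ball 0 s) (\<lambda>x. x + t n *\<^sub>C e)"
        unfolding holomorphic_map_on_def
        by (intro ballI exI[of _ "\<lambda>h. h"] conjI) (auto simp: clinear_iff intro!: derivative_eq_intros)
      then have "holomorphic_map_on (ball 0 s) (\<lambda>x. f (x + t n *\<^sub>C e))"
        by (rule holomorphic_map_on_compose[OF _ f]) (use mem t(3) in blast)
      moreover have "holomorphic_map_on (ball 0 s) f"
        using f s unfolding holomorphic_map_on_def by auto
      ultimately have "holomorphic_map_on (ball 0 s)
          (\<lambda>x. (1 / t n) *\<^sub>C (f (x + t n *\<^sub>C e) + (- 1) *\<^sub>C f x))"
        by (intro holomorphic_map_on_add holomorphic_map_on_scaleC)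
      then show ?thesis by (simp add: scaleC_complex_def)
    qed
    have est: "dist (?q n x) (D x e) \<le> 8 * M / r\<^sup>2 * cmod (t n)" if x: "x \<in> ball 0 s" for n x
    proof -
      have x': "x \<in> ball 0 1" using x s by simp
      have "deriv (\<lambda>c. f (x + c *\<^sub>C e)) 0 = D x e"
        by (rule DERIV_imp_deriv, rule has_field_derivative_along_line) (use D x' in auto)
      moreover have "(\<lambda>c. f (x + c *\<^sub>C e)) holomorphic_on ball 0 r"
        by (rule holomorphic_map_on_along_line[OF f mem[OF x]])
      moreover have "cmod (f (x + c *\<^sub>C e)) \<le> M" if "c \<in> ball 0 r" for c
        by (intro M mem x that)
      ultimately show ?thesis
        using difference_quotient_bound[of "\<lambda>c. f (x + c *\<^sub>C e)" r M "t n"] r t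
        by (simp add: dist_norm)
    qed
    have "t \<longlonglongrightarrow> 0"
    proof -
      have "(\<lambda>n. r / 4 / Suc n) \<longlonglongrightarrow> 0"
        by (rule LIMSEQ_Suc[OF lim_const_over_n])
      from tendsto_of_real[OF this, where 'a = complex] show ?thesis
        unfolding t_def by simp
    qed
    then have lim0: "(\<lambda>n. 8 * M / r\<^sup>2 * cmod (t n)) \<longlonglongrightarrow> 0"
      by (intro tendsto_mult_right_zero tendsto_norm_zero)
    show "uniform_limit (ball 0 s) ?q (\<lambda>x. D x e) sequentially"
    proof (rule uniform_limitI)
      fix \<epsilon> :: real assume "0 < \<epsilon>"
      with lim0 have "\<forall>\<^sub>F n in sequentially. 8 * M / r\<^sup>2 * cmod (t n) < \<epsilon>"
        by (rule order_tendstoD)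
      then show "\<forall>\<^sub>F n in sequentially. \<forall>x\<in>ball 0 s. dist (?q n x) (D x e) < \<epsilon>"
        by eventually_elim (use est le_less_trans in blast)
    qed
  qed
  moreover have "\<exists>s>0. s < 1 \<and> x \<in> ball 0 s" if "x \<in> ball 0 1" for x :: 'a
  proof -
    obtain s where "norm x < s" "s < 1" using \<open>x \<in> ball 0 1\<close> dense[of "norm x" 1] by auto
    moreover from this(1) have "0 < s" by (rule le_less_trans[OF norm_ge_zero])
    ultimately show ?thesis by auto
  qed
  ultimately show ?thesis unfolding holomorphic_map_on_def by meson
qed


section \<open>The norms and their completeness\<close>

lemma apply_hinf_diff: "apply_hinf (f - g) x = apply_hinf f x - apply_hinf g x"
  by (simp only: minus_hinf_def uminus_hinf_def plus_hinf.rep_eq scaleC_hinf.rep_eq) simp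

lemma apply_hlip0_diff: "apply_hlip0 (f - g) x = apply_hlip0 f x - apply_hlip0 g x"
  by (simp only: minus_hlip0_def uminus_hlip0_def plus_hlip0.rep_eq scaleC_hlip0.rep_eq) simp

lemma apply_hlip0_0 [simp]: "apply_hlip0 f 0 = 0"
  using apply_hlip0[of f] by simp

lemma holomorphic_apply_hlip0: "holomorphic_map_on (ball 0 1) (apply_hlip0 f)"
  using apply_hlip0[of f] by simp

lemma holomorphic_apply_hinf: "holomorphic_map_on (ball 0 1) (apply_hinf f)"
  using apply_hinf[of f] by simp

lemma norm_apply_hinf_le:
  assumes "x \<in> ball 0 1"
  shows "cmod (apply_hinf f x) \<le> norm f"
proof -
  have "bounded (apply_hinf f ` ball 0 1)" using apply_hinf[of f] by simp
  then have "bdd_above ((\<lambda>x. cmod (apply_hinf f x)) ` ball 0 1)"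
    by (auto simp: bounded_iff intro: bdd_aboveI)
  with assms show ?thesis
    unfolding norm_hinf.rep_eq by (intro cSUP_upper)
qed

lemma norm_hinf_le:
  fixes f :: "'a::complex_normed_vector hinf"
  assumes "\<And>x. x \<in> ball 0 1 \<Longrightarrow> cmod (apply_hinf f x) \<le> C"
  shows "norm f \<le> C"
  using assms unfolding norm_hinf.rep_eq by (intro cSUP_least) auto

lemma norm_apply_hlip0_diff_le:
  assumes "x \<in> ball 0 1" "y \<in> ball 0 1"
  shows "norm (apply_hlip0 f x - apply_hlip0 f y) \<le> norm f * norm (x - y)"
proof -
  obtain C where "C-lipschitz_on (ball 0 1) (apply_hlip0 f)"
    using apply_hlip0[of f] by auto
  then show ?thesis
    unfolding norm_hlip0.rep_eq using assms by (rule lipschitz_const_bound)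
qed

lemma norm_apply_hlip0_le:
  assumes "x \<in> ball 0 1"
  shows "norm (apply_hlip0 f x) \<le> norm f * norm x"
  using norm_apply_hlip0_diff_le[OF assms, of 0 f] by simp

lemma norm_hlip0_le:
  fixes f :: "('a::complex_normed_vector, 'b::complex_normed_vector) hlip0"
  assumes "0 \<le> C" "\<And>x y. x \<in> ball 0 1 \<Longrightarrow> y \<in> ball 0 1 \<Longrightarrow>
    norm (apply_hlip0 f x - apply_hlip0 f y) \<le> C * norm (x - y)"
  shows "norm f \<le> C"
  using assms unfolding norm_hlip0.rep_eq by (intro lipschitz_const_least) auto

lemma norm_derivative_le_lipschitz:
  fixes f :: "'a::real_normed_vector \<Rightarrow> 'b::real_normed_vector"
  assumes D: "(f has_derivative D) (at x)" and U: "open U" "x \<in> U"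
    and L: "\<And>y. y \<in> U \<Longrightarrow> norm (f y - f x) \<le> L * norm (y - x)"
  shows "norm (D h) \<le> L * norm h"
proof -
  interpret D: bounded_linear D using D by (rule has_derivative_bounded_linear)
  have line: "((\<lambda>t. x + t *\<^sub>R h) has_derivative (\<lambda>t. t *\<^sub>R h)) (at 0)"
    by (auto intro!: derivative_eq_intros)
  have "((\<lambda>t. f (x + t *\<^sub>R h)) has_derivative (\<lambda>t. D (t *\<^sub>R h))) (at 0)"
    using has_derivative_compose[OF line, of f D] D by simp
  then have "((\<lambda>t. f (x + t *\<^sub>R h)) has_vector_derivative D h) (at 0)"
    by (simp add: has_vector_derivative_def D.scaleR)
  then have "((\<lambda>t. (f (x + t *\<^sub>R h) - f x - t *\<^sub>R D h) /\<^sub>R \<bar>t\<bar>) \<longlongrightarrow> 0) (at 0)"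
    by (simp add: has_vector_derivative_def has_derivative_at_within)
  then have "((\<lambda>t. norm ((f (x + t *\<^sub>R h) - f x - t *\<^sub>R D h) /\<^sub>R \<bar>t\<bar>)) \<longlongrightarrow> 0) (at 0)"
    by (rule tendsto_norm_zero)
  moreover have "\<forall>\<^sub>F t in at 0. norm ((f (x + t *\<^sub>R h) - f x - t *\<^sub>R D h) /\<^sub>R \<bar>t\<bar>)
      = norm ((f (x + t *\<^sub>R h) - f x) /\<^sub>R t - D h)"
    using eventually_neq_at_within[of "0::real"]
  proof eventually_elim
    case (elim t)
    then have "(f (x + t *\<^sub>R h) - f x) /\<^sub>R t - D h = (f (x + t *\<^sub>R h) - f x - t *\<^sub>R D h) /\<^sub>R t"
      by (simp add: scaleR_diff_right)
    then show ?case by simp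
  qed
  ultimately have "((\<lambda>t. norm ((f (x + t *\<^sub>R h) - f x) /\<^sub>R t - D h)) \<longlongrightarrow> 0) (at 0)"
    by (rule Lim_transform_eventually)
  then have "((\<lambda>t. (f (x + t *\<^sub>R h) - f x) /\<^sub>R t) \<longlongrightarrow> D h) (at 0)"
    by (simp add: LIM_zero_iff tendsto_norm_zero_iff)
  then have lim: "((\<lambda>t. norm ((f (x + t *\<^sub>R h) - f x) /\<^sub>R t)) \<longlongrightarrow> norm (D h)) (at 0)"
    by (rule tendsto_norm)
  have "((\<lambda>t. x + t *\<^sub>R h) \<longlongrightarrow> x + 0 *\<^sub>R h) (at 0)"
    by (intro tendsto_intros)
  then have "\<forall>\<^sub>F t in at 0. x + t *\<^sub>R h \<in> U"
    using U by (intro topological_tendstoD) auto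
  moreover have "\<forall>\<^sub>F t in at 0. t \<noteq> (0::real)"
    by (rule eventually_neq_at_within)
  ultimately have "\<forall>\<^sub>F t in at 0. norm ((f (x + t *\<^sub>R h) - f x) /\<^sub>R t) \<le> L * norm h"
  proof eventually_elim
    case (elim t)
    have "norm ((f (x + t *\<^sub>R h) - f x) /\<^sub>R t) = norm (f (x + t *\<^sub>R h) - f x) / \<bar>t\<bar>"
      by (simp add: divide_inverse mult.commute)
    with elim show ?case
      using L[of "x + t *\<^sub>R h"] by (simp add: divide_le_eq mult.commute mult.left_commute)
  qed
  with lim show ?thesis by (rule tendsto_upperbound) simp
qed

text \<open>
  With \<open>norm_derivative_le_lipschitz\<close>: on the convex ball, the Lipschitz constant is the supremum
  of the operator norms of the derivative.
\<close>

lemma norm_hlip0_le_derivative: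
  fixes f :: "('a::complex_normed_vector, 'b::complex_normed_vector) hlip0"
  assumes D: "\<And>x. x \<in> ball 0 1 \<Longrightarrow> (apply_hlip0 f has_derivative D x) (at x)"
    and C: "0 \<le> C" "\<And>x h. x \<in> ball 0 1 \<Longrightarrow> norm (D x h) \<le> C * norm h"
  shows "norm f \<le> C"
proof (rule norm_hlip0_le[OF C(1)])
  fix x y :: 'a assume xy: "x \<in> ball 0 1" "y \<in> ball 0 1"
  show "norm (apply_hlip0 f x - apply_hlip0 f y) \<le> C * norm (x - y)"
  proof (rule differentiable_bound[OF convex_ball _ _ xy])
    show "(apply_hlip0 f has_derivative D z) (at z within ball 0 1)" if "z \<in> ball 0 1" for z
      using D[OF that] by (rule has_derivative_at_withinI)
    show "onorm (D z) \<le> C" if "z \<in> ball 0 1" for z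
      by (intro onorm_bound C that)
  qed
qed

lemma holomorphic_limit_of_uniformly_Cauchy:
  fixes f :: "nat \<Rightarrow> 'a::complex_normed_vector \<Rightarrow> complex"
  assumes "open U" "\<And>n. holomorphic_map_on U (f n)" "uniformly_Cauchy_on U f"
  obtains g where "holomorphic_map_on U g" "uniform_limit U f g sequentially"
    "\<And>x. x \<notin> U \<Longrightarrow> g x = 0"
proof -
  obtain g where g: "uniform_limit U f g sequentially"
    using Cauchy_uniformly_convergent[OF assms(3)] unfolding uniformly_convergent_on_def ..
  have "holomorphic_map_on U g"
    using assms(1,2) g by (rule holomorphic_map_on_uniform_limit)
  then have "holomorphic_map_on U (\<lambda>x. if x \<in> U then g x else 0)"
    by (rule holomorphic_map_on_cong[OF assms(1), rotated]) simp
  moreover have "uniform_limit U f (\<lambda>x. if x \<in> U then g x else 0) sequentially"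
    using g by (simp add: uniform_limit_iff)
  ultimately show thesis by (rule that) simp
qed

lemma complete_hinf: "complete (UNIV :: 'a::complex_normed_vector hinf set)"
proof (rule completeI)
  fix F :: "nat \<Rightarrow> 'a hinf" assume F: "Cauchy F"
  have "uniformly_Cauchy_on (ball 0 1) (\<lambda>n. apply_hinf (F n))"
  proof (rule uniformly_Cauchy_onI)
    fix e :: real assume "0 < e"
    with F obtain N where N: "\<And>m n. N \<le> m \<Longrightarrow> N \<le> n \<Longrightarrow> norm (F m - F n) < e"
      unfolding Cauchy_iff by blast
    have "dist (apply_hinf (F m) x) (apply_hinf (F n) x) < e"
      if "N \<le> m" "N \<le> n" "x \<in> ball 0 1" for m n x
      using N[OF that(1,2)] norm_apply_hinf_le[OF that(3), of "F m - F n"]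
      by (simp add: dist_norm apply_hinf_diff)
    then show "\<exists>N. \<forall>x\<in>ball 0 1. \<forall>m\<ge>N. \<forall>n\<ge>N. dist (apply_hinf (F m) x) (apply_hinf (F n) x) < e"
      by blast
  qed
  then obtain g where g: "holomorphic_map_on (ball 0 1) g"
    "uniform_limit (ball 0 1) (\<lambda>n. apply_hinf (F n)) g sequentially"
    "\<And>x. x \<notin> ball 0 1 \<Longrightarrow> g x = 0"
    using holomorphic_limit_of_uniformly_Cauchy[OF open_ball holomorphic_apply_hinf] by blast
  have close: "\<exists>N. \<forall>n\<ge>N. \<forall>x\<in>ball 0 1. cmod (apply_hinf (F n) x - g x) < e" if "0 < e" for e
    using uniform_limitD[OF g(2) that] by (simp add: eventually_sequentially dist_norm)
  have "bounded (g ` ball 0 1)"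
  proof -
    obtain N where N: "\<And>x. x \<in> ball 0 1 \<Longrightarrow> cmod (apply_hinf (F N) x - g x) < 1"
      using close[OF zero_less_one] by blast
    have "cmod (g x) \<le> norm (F N) + 1" if "x \<in> ball 0 1" for x
      using N[OF that] norm_apply_hinf_le[OF that, of "F N"]
        norm_triangle_ineq3[of "apply_hinf (F N) x" "g x"] by linarith
    then show ?thesis unfolding bounded_iff by blast
  qed
  with g have "apply_hinf (Abs_hinf g) = g" by (intro Abs_hinf_inverse) blast
  then obtain G where G: "apply_hinf G = g" by blast
  have "F \<longlonglongrightarrow> G"
  proof (rule LIMSEQ_I)
    fix e :: real assume e: "0 < e"
    then obtain N where N: "\<And>n x. N \<le> n \<Longrightarrow> x \<in> ball 0 1 \<Longrightarrow> cmod (apply_hinf (F n) x - g x) < e / 2"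
      using close[of "e / 2"] half_gt_zero by blast
    have "norm (F n - G) \<le> e / 2" if "N \<le> n" for n
      using N[OF that] by (intro norm_hinf_le) (simp add: apply_hinf_diff G less_imp_le)
    then show "\<exists>N. \<forall>n\<ge>N. norm (F n - G) < e"
      using e by (intro exI[of _ N]) (smt (verit) field_sum_of_halves)
  qed
  then show "\<exists>G\<in>UNIV. F \<longlonglongrightarrow> G" by blast
qed

text \<open>
  The functions vanish at \<open>0\<close>, so a Cauchy sequence for the Lipschitz constants is uniformly
  Cauchy on the ball. Convergence to the limit in norm follows by letting one index tend to
  infinity in the Lipschitz estimates.
\<close>

lemma complete_hlip0: "complete (UNIV :: ('a::complex_normed_vector, complex) hlip0 set)"
proof (rule completeI)
  fix F :: "nat \<Rightarrow> ('a, complex) hlip0" assume F: "Cauchy F"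
  have "uniformly_Cauchy_on (ball 0 1) (\<lambda>n. apply_hlip0 (F n))"
  proof (rule uniformly_Cauchy_onI)
    fix e :: real assume "0 < e"
    with F obtain N where N: "\<And>m n. N \<le> m \<Longrightarrow> N \<le> n \<Longrightarrow> norm (F m - F n) < e"
      unfolding Cauchy_iff by blast
    have "dist (apply_hlip0 (F m) x) (apply_hlip0 (F n) x) < e"
      if "N \<le> m" "N \<le> n" "x \<in> ball 0 1" for m n x
    proof -
      have "norm (F m - F n) * norm x \<le> norm (F m - F n) * 1"
        using that(3) by (intro mult_left_mono) auto
      then show ?thesis
        using N[OF that(1,2)] norm_apply_hlip0_le[OF that(3), of "F m - F n"]
        by (simp add: dist_norm apply_hlip0_diff)
    qed
    then show "\<exists>N. \<forall>x\<in>ball 0 1. \<forall>m\<ge>N. \<forall>n\<ge>N. dist (apply_hlip0 (F m) x) (apply_hlip0 (F n) x) < e"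
      by blast
  qed
  then obtain g where g: "holomorphic_map_on (ball 0 1) g"
    "uniform_limit (ball 0 1) (\<lambda>n. apply_hlip0 (F n)) g sequentially"
    "\<And>x. x \<notin> ball 0 1 \<Longrightarrow> g x = 0"
    using holomorphic_limit_of_uniformly_Cauchy[OF open_ball holomorphic_apply_hlip0] by blast
  have lim: "(\<lambda>n. apply_hlip0 (F n) x) \<longlonglongrightarrow> g x" if "x \<in> ball 0 1" for x
    using tendsto_uniform_limitI[OF g(2) that] .
  have close: "\<exists>N. \<forall>n\<ge>N. \<forall>x\<in>ball 0 1. \<forall>y\<in>ball 0 1.
      cmod ((apply_hlip0 (F n) x - g x) - (apply_hlip0 (F n) y - g y)) \<le> e * norm (x - y)"
    if e: "0 < e" for e
  proof -
    from F e obtain N where N: "\<And>m n. N \<le> m \<Longrightarrow> N \<le> n \<Longrightarrow> norm (F m - F n) < e"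
      unfolding Cauchy_iff by blast
    have "cmod ((apply_hlip0 (F n) x - g x) - (apply_hlip0 (F n) y - g y)) \<le> e * norm (x - y)"
      if n: "N \<le> n" and xy: "x \<in> ball 0 1" "y \<in> ball 0 1" for n x y
    proof (rule tendsto_upperbound)
      show "(\<lambda>m. cmod ((apply_hlip0 (F n) x - apply_hlip0 (F m) x)
          - (apply_hlip0 (F n) y - apply_hlip0 (F m) y)))
        \<longlonglongrightarrow> cmod ((apply_hlip0 (F n) x - g x) - (apply_hlip0 (F n) y - g y))"
        by (intro tendsto_intros lim xy)
      have "cmod ((apply_hlip0 (F n) x - apply_hlip0 (F m) x)
          - (apply_hlip0 (F n) y - apply_hlip0 (F m) y)) \<le> e * norm (x - y)" if "N \<le> m" for m
      proof -
        have "norm (F n - F m) * norm (x - y) \<le> e * norm (x - y)"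
          using N[OF n that] by (intro mult_right_mono) auto
        then show ?thesis
          using norm_apply_hlip0_diff_le[OF xy, of "F n - F m"] by (simp add: apply_hlip0_diff)
      qed
      then show "\<forall>\<^sub>F m in sequentially. cmod ((apply_hlip0 (F n) x - apply_hlip0 (F m) x)
          - (apply_hlip0 (F n) y - apply_hlip0 (F m) y)) \<le> e * norm (x - y)"
        unfolding eventually_sequentially by blast
    qed simp
    then show ?thesis by blast
  qed
  have "\<exists>C. C-lipschitz_on (ball 0 1) g"
  proof -
    obtain N where N: "\<And>x y. x \<in> ball 0 1 \<Longrightarrow> y \<in> ball 0 1 \<Longrightarrow>
        cmod ((apply_hlip0 (F N) x - g x) - (apply_hlip0 (F N) y - g y)) \<le> 1 * norm (x - y)"
      using close[OF zero_less_one] by blast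
    have "cmod (g x - g y) \<le> (norm (F N) + 1) * norm (x - y)"
      if "x \<in> ball 0 1" "y \<in> ball 0 1" for x y
      using N[OF that] norm_apply_hlip0_diff_le[OF that, of "F N"]
        norm_triangle_ineq4[of "apply_hlip0 (F N) x - apply_hlip0 (F N) y"
          "(apply_hlip0 (F N) x - g x) - (apply_hlip0 (F N) y - g y)"]
      by (simp add: algebra_simps)
    then have "(norm (F N) + 1)-lipschitz_on (ball 0 1) g"
      by (intro lipschitz_onI) (auto simp: dist_norm)
    then show ?thesis ..
  qed
  moreover have "g 0 = 0"
    using lim[of 0] by (simp add: LIMSEQ_const_iff)
  ultimately have "apply_hlip0 (Abs_hlip0 g) = g"
    using g(1,3) by (intro Abs_hlip0_inverse) blast
  then obtain G where G: "apply_hlip0 G = g" by blast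
  have "F \<longlonglongrightarrow> G"
  proof (rule LIMSEQ_I)
    fix e :: real assume e: "0 < e"
    then obtain N where N: "\<And>n x y. N \<le> n \<Longrightarrow> x \<in> ball 0 1 \<Longrightarrow> y \<in> ball 0 1 \<Longrightarrow>
        cmod ((apply_hlip0 (F n) x - g x) - (apply_hlip0 (F n) y - g y)) \<le> e / 2 * norm (x - y)"
      using close[of "e / 2"] half_gt_zero by blast
    have "norm (F n - G) \<le> e / 2" if "N \<le> n" for n
      using N[OF that] e by (intro norm_hlip0_le) (simp_all add: apply_hlip0_diff G)
    then show "\<exists>N. \<forall>n\<ge>N. norm (F n - G) < e"
      using e by (intro exI[of _ N]) (smt (verit) field_sum_of_halves)
  qed
  then show "\<exists>G\<in>UNIV. F \<longlonglongrightarrow> G" by blast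
qed


section \<open>Relative compactness through finite nets\<close>

lemma compact_closure_imp_finite_net:
  fixes S :: "'a::metric_space set"
  assumes "compact (closure S)" "0 < e"
  obtains F where "finite F" "F \<subseteq> S" "\<And>x. x \<in> S \<Longrightarrow> \<exists>y\<in>F. dist x y < e"
proof -
  have "closure S \<subseteq> (\<Union>y\<in>S. ball y e)"
    using assms(2) by (auto simp: closure_approachable dist_commute)
  then obtain F where F: "F \<subseteq> S" "finite F" "closure S \<subseteq> (\<Union>y\<in>F. ball y e)"
    using compactE_image[OF assms(1), of S "\<lambda>y. ball y e"] by auto
  show thesis
  proof (rule that[OF F(2,1)])
    fix x assume "x \<in> S"
    then have "x \<in> (\<Union>y\<in>F. ball y e)" using F(3) closure_subset by blast
    then show "\<exists>y\<in>F. dist x y < e" by (auto simp: dist_commute)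
  qed
qed

lemma compact_closure_if_finite_nets:
  fixes S :: "'a::metric_space set"
  assumes "complete (UNIV :: 'a set)"
    and net: "\<And>e. 0 < e \<Longrightarrow> \<exists>F. finite F \<and> (\<forall>x\<in>S. \<exists>y\<in>F. dist x y < e)"
  shows "compact (closure S)"
  unfolding compact_eq_totally_bounded
proof (intro conjI allI impI)
  show "complete (closure S)"
    using complete_closed_subset[OF closed_closure _ assms(1)] by simp
  fix e :: real assume e: "0 < e"
  then obtain F where F: "finite F" "\<forall>x\<in>S. \<exists>y\<in>F. dist x y < e / 2"
    using net[of "e / 2"] by auto
  then have "S \<subseteq> (\<Union>y\<in>F. cball y (e / 2))"
    by (force simp: dist_commute)
  then have "closure S \<subseteq> (\<Union>y\<in>F. cball y (e / 2))"
    using F(1) by (intro closure_minimal) (auto intro: closed_UN)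
  also have "\<dots> \<subseteq> (\<Union>y\<in>F. ball y e)" using e by auto
  finally show "\<exists>k. finite k \<and> closure S \<subseteq> (\<Union>x\<in>k. ball x e)" using F(1) by blast
qed

text \<open>
  A point \<open>a\<close> is coded by choosing, for every \<open>b \<in> B\<close>, a nearby center in a finite net of the
  \<open>b\<close>-th image. There are finitely many codes, and one representative of each suffices. This
  replaces diagonal sequences in the compactness arguments below.
\<close>

lemma finite_common_net:
  fixes d :: "'b \<Rightarrow> 'a \<Rightarrow> 'c::metric_space"
  assumes B: "finite B" and d: "\<And>b. b \<in> B \<Longrightarrow> compact (closure (d b ` A))" and e: "0 < e"
  obtains F where "finite F" "F \<subseteq> A"
    "\<And>a. a \<in> A \<Longrightarrow> \<exists>a'\<in>F. \<forall>b\<in>B. dist (d b a) (d b a') < e"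
proof -
  have "\<forall>b\<in>B. \<exists>K. finite K \<and> (\<forall>a\<in>A. \<exists>x\<in>K. dist (d b a) x < e / 2)"
  proof
    fix b assume "b \<in> B"
    then obtain K where "finite K" "\<And>x. x \<in> d b ` A \<Longrightarrow> \<exists>y\<in>K. dist x y < e / 2"
      using compact_closure_imp_finite_net[OF d] e by (metis half_gt_zero)
    then show "\<exists>K. finite K \<and> (\<forall>a\<in>A. \<exists>x\<in>K. dist (d b a) x < e / 2)" by blast
  qed
  then obtain K where K: "\<And>b. b \<in> B \<Longrightarrow> finite (K b)"
    "\<And>b a. b \<in> B \<Longrightarrow> a \<in> A \<Longrightarrow> \<exists>x\<in>K b. dist (d b a) x < e / 2"
    by metis
  \<comment> \<open>the code of \<open>a\<close>\<close>
  define c where "c a = (\<lambda>b\<in>B. SOME x. x \<in> K b \<and> dist (d b a) x < e / 2)" for a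
  have c: "c a b \<in> K b" "dist (d b a) (c a b) < e / 2" if "a \<in> A" "b \<in> B" for a b
    using someI_ex[of "\<lambda>x. x \<in> K b \<and> dist (d b a) x < e / 2"] K(2)[OF that(2,1)] that(2)
    by (auto simp: c_def)
  have "c ` A \<subseteq> PiE B K"
    using c by (auto simp: c_def PiE_iff)
  then have fin: "finite (c ` A)"
    using finite_PiE[OF B] K(1) finite_subset by blast
  show thesis
  proof
    show "finite (inv_into A c ` c ` A)" using fin by simp
    show "inv_into A c ` c ` A \<subseteq> A" by (auto intro: inv_into_into)
    fix a assume a: "a \<in> A"
    define a' where "a' = inv_into A c (c a)"
    have a': "a' \<in> A" "c a' = c a"
      using a by (auto simp: a'_def inv_into_into f_inv_into_f)
    have "dist (d b a) (d b a') < e" if "b \<in> B" for b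
      using c(2)[OF a that] c(2)[OF a'(1) that] a'(2) dist_triangle2[of "d b a" "d b a'" "c a b"]
      by simp
    with a show "\<exists>a'\<in>inv_into A c ` c ` A. \<forall>b\<in>B. dist (d b a) (d b a') < e"
      unfolding a'_def by blast
  qed
qed

lemma compact_closure_bounded_range:
  fixes g :: "'a \<Rightarrow> complex"
  assumes "\<And>a. a \<in> A \<Longrightarrow> cmod (g a) \<le> M"
  shows "compact (closure (g ` A))"
proof -
  have "bounded (g ` A)" unfolding bounded_iff using assms by blast
  then show ?thesis by (simp add: compact_eq_bounded_closed bounded_closure)
qed


section \<open>Finite-dimensional normed spaces\<close>

lemma compact_bounded_combinations:
  fixes B :: "'a::complex_normed_vector set"
  assumes "finite B"
  shows "compact {\<Sum>b\<in>B. c b *\<^sub>C b | c. \<forall>b\<in>B. cmod (c b) \<le> M}"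
  using assms
proof (induction B rule: finite_induct)
  case empty
  then show ?case by simp
next
  case (insert v B)
  let ?K = "{\<Sum>b\<in>B. c b *\<^sub>C b | c. \<forall>b\<in>B. cmod (c b) \<le> M}"
  let ?g = "\<lambda>(k, w). k *\<^sub>C v + w"
  have "compact (?g ` (cball 0 M \<times> ?K))"
    using insert.IH unfolding case_prod_unfold
    by (intro compact_continuous_image compact_Times continuous_intros
        bounded_linear.continuous_on[OF bounded_linear_scaleC_left]) auto
  also have "?g ` (cball 0 M \<times> ?K) = {\<Sum>b\<in>insert v B. c b *\<^sub>C b | c. \<forall>b\<in>insert v B. cmod (c b) \<le> M}"
  proof (intro equalityI subsetI)
    fix x assume "x \<in> ?g ` (cball 0 M \<times> ?K)"
    then obtain k c where kc: "cmod k \<le> M" "\<forall>b\<in>B. cmod (c b) \<le> M"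
      "x = k *\<^sub>C v + (\<Sum>b\<in>B. c b *\<^sub>C b)" by auto
    have "(\<Sum>b\<in>B. (c(v := k)) b *\<^sub>C b) = (\<Sum>b\<in>B. c b *\<^sub>C b)"
      using insert.hyps by (intro sum.cong) auto
    then have "x = (\<Sum>b\<in>insert v B. (c(v := k)) b *\<^sub>C b)" "\<forall>b\<in>insert v B. cmod ((c(v := k)) b) \<le> M"
      using kc insert.hyps by auto
    then show "x \<in> {\<Sum>b\<in>insert v B. c b *\<^sub>C b | c. \<forall>b\<in>insert v B. cmod (c b) \<le> M}"
      by blast
  next
    fix x assume "x \<in> {\<Sum>b\<in>insert v B. c b *\<^sub>C b | c. \<forall>b\<in>insert v B. cmod (c b) \<le> M}"
    then obtain c where "x = ?g (c v, \<Sum>b\<in>B. c b *\<^sub>C b)" "\<forall>b\<in>insert v B. cmod (c b) \<le> M"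
      using insert.hyps by auto
    then show "x \<in> ?g ` (cball 0 M \<times> ?K)"
      by (intro image_eqI[of _ _ "(c v, \<Sum>b\<in>B. c b *\<^sub>C b)"]) auto
  qed
  finally show ?case .
qed

text \<open>
  Induction on \<open>B\<close>. By the induction hypothesis bounded subsets of the span of \<open>B\<close> consist of
  bounded combinations, so the span is closed; a vector \<open>v\<close> outside has a positive distance \<open>d\<close>
  from it, which bounds the coefficient of \<open>v\<close> by \<open>norm x / d\<close>. Coefficients are only claimed to
  exist, since \<open>B\<close> may be linearly dependent.
\<close>

lemma finite_span_bounded_coefficients:
  fixes B :: "'a::complex_normed_vector set"
  assumes "finite B"
  shows "\<exists>C\<ge>0. \<forall>x\<in>complex_vector.span B. \<exists>c. x = (\<Sum>b\<in>B. c b *\<^sub>C b) \<and> (\<forall>b\<in>B. cmod (c b) \<le> C * norm x)"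
  using assms
proof (induction B rule: finite_induct)
  case empty
  then show ?case by auto
next
  case (insert v B)
  let ?V = "complex_vector.span B"
  obtain C where C: "0 \<le> C"
    "\<And>x. x \<in> ?V \<Longrightarrow> \<exists>c. x = (\<Sum>b\<in>B. c b *\<^sub>C b) \<and> (\<forall>b\<in>B. cmod (c b) \<le> C * norm x)"
    using insert.IH by blast
  have sum_in: "(\<Sum>b\<in>B. c b *\<^sub>C b) \<in> ?V" for c
    by (intro complex_vector.span_sum complex_vector.span_scale complex_vector.span_base)
  have closed: "closed ?V"
    unfolding closed_sequential_limits
  proof (intro allI impI, elim conjE)
    fix w l assume w: "\<forall>n. w n \<in> ?V" "w \<longlonglongrightarrow> l"
    obtain R where R: "\<And>n. norm (w n) \<le> R"
      using convergent_imp_Bseq[OF convergentI[OF w(2)]] unfolding Bseq_def by blast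
    let ?K = "{\<Sum>b\<in>B. c b *\<^sub>C b | c. \<forall>b\<in>B. cmod (c b) \<le> C * R}"
    have "w n \<in> ?K" for n
    proof -
      obtain c where "w n = (\<Sum>b\<in>B. c b *\<^sub>C b)" "\<forall>b\<in>B. cmod (c b) \<le> C * norm (w n)"
        using C(2) w(1) by blast
      moreover have "C * norm (w n) \<le> C * R" using R C(1) by (rule mult_left_mono)
      ultimately show ?thesis using order_trans by blast
    qed
    then have "l \<in> ?K"
      using closed_sequentially compact_imp_closed[OF compact_bounded_combinations[OF insert.hyps(1)]] w(2)
      by blast
    then show "l \<in> ?V" using sum_in by blast
  qed
  show ?case
  proof (cases "v \<in> ?V")
    case True
    have "\<exists>c. x = (\<Sum>b\<in>insert v B. c b *\<^sub>C b) \<and> (\<forall>b\<in>insert v B. cmod (c b) \<le> C * norm x)"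
      if "x \<in> complex_vector.span (insert v B)" for x
    proof -
      have "x \<in> ?V" using that True complex_vector.span_redundant by blast
      then obtain c where c: "x = (\<Sum>b\<in>B. c b *\<^sub>C b)" "\<forall>b\<in>B. cmod (c b) \<le> C * norm x"
        using C(2) by blast
      have "(\<Sum>b\<in>B. (c(v := 0)) b *\<^sub>C b) = (\<Sum>b\<in>B. c b *\<^sub>C b)"
        using insert.hyps by (intro sum.cong) auto
      then show ?thesis
        using c C(1) insert.hyps by (intro exI[of _ "c(v := 0)"]) auto
    qed
    with C(1) show ?thesis by blast
  next
    case False
    then have "open (- ?V)" "v \<in> - ?V" using closed by auto
    then obtain d where "0 < d" "ball v d \<subseteq> - ?V"
      by (rule openE)
    then have d: "0 < d" "\<And>w. w \<in> ?V \<Longrightarrow> d \<le> dist v w"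
      by (auto simp: not_less[symmetric])
    define C' where "C' = max (1 / d) (C * (1 + norm v / d))"
    have C': "0 \<le> C'" using d(1) by (simp add: C'_def le_max_iff_disj)
    have "\<exists>c. x = (\<Sum>b\<in>insert v B. c b *\<^sub>C b) \<and> (\<forall>b\<in>insert v B. cmod (c b) \<le> C' * norm x)"
      if "x \<in> complex_vector.span (insert v B)" for x
    proof -
      obtain k where k: "x - k *\<^sub>C v \<in> ?V"
        using \<open>x \<in> complex_vector.span (insert v B)\<close>
        unfolding complex_vector.span_insert by blast
      have k_le: "cmod k \<le> norm x / d"
      proof (cases "k = 0")
        case False
        have "(- (1 / k)) *\<^sub>C (x - k *\<^sub>C v) \<in> ?V"
          by (rule complex_vector.span_scale[OF k])
        then have "d \<le> dist v ((- (1 / k)) *\<^sub>C (x - k *\<^sub>C v))" by (rule d(2))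
        also have "v - (- (1 / k)) *\<^sub>C (x - k *\<^sub>C v) = (1 / k) *\<^sub>C x"
          using False by (simp add: complex_vector.scale_right_diff_distrib)
        then have "dist v ((- (1 / k)) *\<^sub>C (x - k *\<^sub>C v)) = norm x / cmod k"
          by (simp add: dist_norm norm_scaleC norm_divide)
        finally show ?thesis using False d(1) by (simp add: field_simps)
      qed (use d(1) in simp)
      obtain c where c: "x - k *\<^sub>C v = (\<Sum>b\<in>B. c b *\<^sub>C b)"
        "\<forall>b\<in>B. cmod (c b) \<le> C * norm (x - k *\<^sub>C v)"
        using C(2)[OF k] by blast
      have "norm (x - k *\<^sub>C v) \<le> norm x + cmod k * norm v"
        using norm_triangle_ineq4[of x "k *\<^sub>C v"] by (simp add: norm_scaleC)
      also have "\<dots> \<le> norm x + norm x / d * norm v"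
        using k_le by (intro add_left_mono mult_right_mono) auto
      also have "\<dots> = (1 + norm v / d) * norm x" by (simp add: algebra_simps)
      finally have "C * norm (x - k *\<^sub>C v) \<le> C * (1 + norm v / d) * norm x"
        using C(1) by (simp add: mult_left_mono mult.assoc)
      also have "\<dots> \<le> C' * norm x"
        by (intro mult_right_mono) (auto simp: C'_def)
      finally have le: "C * norm (x - k *\<^sub>C v) \<le> C' * norm x" .
      have "norm x / d \<le> C' * norm x"
        using mult_right_mono[of "1 / d" C' "norm x"] by (simp add: C'_def)
      then have kC': "cmod k \<le> C' * norm x" using k_le by simp
      have "(\<Sum>b\<in>B. (c(v := k)) b *\<^sub>C b) = (\<Sum>b\<in>B. c b *\<^sub>C b)"
        using insert.hyps by (intro sum.cong) auto
      then have "x = (\<Sum>b\<in>insert v B. (c(v := k)) b *\<^sub>C b)"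
        using insert.hyps c(1) by (simp add: algebra_simps)
      moreover have "\<forall>b\<in>insert v B. cmod ((c(v := k)) b) \<le> C' * norm x"
        using c(2) le kC' by force
      ultimately show ?thesis by blast
    qed
    with C' show ?thesis by blast
  qed
qed

lemma finite_dimensional_coefficients:
  assumes "finite_dimensional (UNIV :: 'a::complex_normed_vector set)"
  obtains B :: "'a::complex_normed_vector set" and C where "finite B" "0 \<le> C"
    "\<And>x. \<exists>c. x = (\<Sum>b\<in>B. c b *\<^sub>C b) \<and> (\<forall>b\<in>B. cmod (c b) \<le> C * norm x)"
proof -
  obtain B :: "'a set" where B: "finite B" "complex_vector.span B = UNIV"
    using assms unfolding finite_dimensional_def by blast
  from finite_span_bounded_coefficients[OF B(1)] show thesis
    unfolding B(2) using that[OF B(1)] by blast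
qed

lemma compact_cball_finite_dimensional:
  assumes "finite_dimensional (UNIV :: 'a::complex_normed_vector set)"
  shows "compact (cball (0::'a::complex_normed_vector) r)"
proof -
  obtain B :: "'a set" and C where B: "finite B" "0 \<le> C"
    "\<And>x. \<exists>c. x = (\<Sum>b\<in>B. c b *\<^sub>C b) \<and> (\<forall>b\<in>B. cmod (c b) \<le> C * norm x)"
    using finite_dimensional_coefficients[OF assms] by blast
  let ?K = "{\<Sum>b\<in>B. c b *\<^sub>C b | c. \<forall>b\<in>B. cmod (c b) \<le> C * r}"
  have "x \<in> ?K" if "x \<in> cball 0 r" for x
  proof -
    obtain c where "x = (\<Sum>b\<in>B. c b *\<^sub>C b)" "\<forall>b\<in>B. cmod (c b) \<le> C * norm x"
      using B(3) by blast
    moreover have "C * norm x \<le> C * r" using that B(2) by (simp add: mult_left_mono)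
    ultimately show ?thesis using order_trans by blast
  qed
  then have "cball 0 r = ?K \<inter> cball 0 r" by blast
  moreover have "compact (?K \<inter> cball 0 r)"
    by (intro compact_Int_closed compact_bounded_combinations B(1) closed_cball)
  ultimately show ?thesis by (rule ssubst)
qed


section \<open>Interpolation of bounded sequences by bounded holomorphic functions\<close>

text \<open>
  With \<open>u = 1 - z\<close> this is \<open>s u / (u + s)\<^sup>2\<close>: of order \<open>1\<close> where \<open>\<bar>u\<bar>\<close> is comparable to \<open>s\<close>, and
  decaying in both directions away from this scale.
\<close>

definition bump :: "real \<Rightarrow> complex \<Rightarrow> complex" where
  "bump s z = of_real s * (1 - z) / (1 - z + of_real s)\<^sup>2"

lemma disc_ne_one:
  assumes "z \<in> ball 0 1" shows "0 < cmod (1 - z)"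
  using assms by auto

text \<open>
  Since \<open>1 - z\<close> has positive real part, \<open>\<bar>1 - z + s\<bar>\<^sup>2 \<ge> \<bar>1 - z\<bar>\<^sup>2 + s\<^sup>2\<close>. In terms of the ratio
  \<open>x = s / \<bar>1 - z\<bar>\<close> the bound is \<open>x / (1 + x\<^sup>2)\<close>, small unless \<open>\<bar>1 - z\<bar>\<close> is comparable to \<open>s\<close>.
\<close>

lemma norm_bump_le:
  assumes "0 < s" "z \<in> ball 0 1"
  shows "cmod (bump s z) \<le> (s / cmod (1 - z)) / (1 + (s / cmod (1 - z))\<^sup>2)"
    and "1 - z + of_real s \<noteq> 0"
proof -
  let ?w = "1 - z"
  have "Re z < 1" using assms(2) complex_Re_le_cmod[of z] by simp
  then have w: "0 < Re ?w" by simp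
  have u: "0 < cmod ?w" using assms(2) by (rule disc_ne_one)
  have "(cmod (?w + of_real s))\<^sup>2 = (cmod ?w)\<^sup>2 + s\<^sup>2 + 2 * s * Re ?w"
    unfolding cmod_power2 by (simp add: power2_eq_square algebra_simps)
  then have ge: "(cmod ?w)\<^sup>2 + s\<^sup>2 \<le> (cmod (?w + of_real s))\<^sup>2"
    using w assms(1) by simp
  have pos: "0 < (cmod ?w)\<^sup>2 + s\<^sup>2" using u by (simp add: add_pos_nonneg)
  then have "0 < (cmod (?w + of_real s))\<^sup>2" using ge by (rule less_le_trans)
  then show "1 - z + of_real s \<noteq> 0" by (metis norm_zero zero_power2 less_irrefl)
  have "cmod (bump s z) = s * cmod ?w / (cmod (?w + of_real s))\<^sup>2"
    using assms(1) by (simp add: bump_def norm_divide norm_mult norm_power)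
  also have "\<dots> \<le> s * cmod ?w / ((cmod ?w)\<^sup>2 + s\<^sup>2)"
    using ge pos assms(1) by (intro divide_left_mono) (auto intro: mult_pos_pos order_less_le_trans)
  also have "\<dots> = (s / cmod ?w) / (1 + (s / cmod ?w)\<^sup>2)"
    using u pos by (simp add: field_simps power2_eq_square)
  finally show "cmod (bump s z) \<le> (s / cmod (1 - z)) / (1 + (s / cmod (1 - z))\<^sup>2)" .
qed

lemma norm_bump_le_ratio:
  assumes "0 < s" "z \<in> ball 0 1"
  shows "cmod (bump s z) \<le> s / cmod (1 - z)" "cmod (bump s z) \<le> cmod (1 - z) / s"
proof -
  let ?x = "s / cmod (1 - z)"
  have x: "0 < ?x" using assms disc_ne_one by simp
  have "?x / (1 + ?x\<^sup>2) \<le> ?x / 1"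
    using x add_pos_nonneg[OF zero_less_one zero_le_power2[of ?x]]
    by (intro divide_left_mono) auto
  then show "cmod (bump s z) \<le> ?x" using norm_bump_le(1)[OF assms] by simp
  have "?x / (1 + ?x\<^sup>2) \<le> ?x / ?x\<^sup>2"
  proof (rule divide_left_mono)
    show "0 < (1 + ?x\<^sup>2) * ?x\<^sup>2"
      by (intro mult_pos_pos add_pos_nonneg zero_less_power x) auto
  qed (use x in auto)
  also have "\<dots> = 1 / ?x" by (simp add: power2_eq_square)
  finally show "cmod (bump s z) \<le> cmod (1 - z) / s"
    using norm_bump_le(1)[OF assms] by simp
qed

lemma norm_bump_at_peak:
  assumes "z \<in> ball 0 1"
  shows "1 / 4 \<le> cmod (bump (cmod (1 - z)) z)"
proof -
  let ?s = "cmod (1 - z)"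
  have s: "0 < ?s" using assms by (rule disc_ne_one)
  have "cmod (1 - z + of_real ?s) \<le> 2 * ?s"
    using norm_triangle_ineq[of "1 - z" "of_real ?s"] by simp
  then have "(cmod (1 - z + of_real ?s))\<^sup>2 \<le> (2 * ?s)\<^sup>2"
    by (intro power_mono) auto
  moreover have "0 < (cmod (1 - z + of_real ?s))\<^sup>2"
    using norm_bump_le(2)[OF s assms] by simp
  ultimately have "?s * ?s / (2 * ?s)\<^sup>2 \<le> ?s * ?s / (cmod (1 - z + of_real ?s))\<^sup>2"
    using s by (intro divide_left_mono) auto
  moreover have "?s * ?s / (2 * ?s)\<^sup>2 = 1 / 4"
    using s by (simp add: power2_eq_square)
  ultimately show ?thesis
    by (simp add: bump_def norm_divide norm_mult norm_power)
qed

text \<open>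
  As \<open>x / (1 + x\<^sup>2)\<close> is \<open>x\<close> times the derivative of \<open>arctan\<close>, its values along a geometrically
  decreasing sequence are dominated by increments of \<open>arctan\<close>, whose sum telescopes.
\<close>

lemma arctan_increment:
  fixes x y q :: real
  assumes "0 < x" "0 \<le> y" "y \<le> q * x" "q < 1"
  shows "(1 - q) * (x / (1 + x\<^sup>2)) \<le> arctan x - arctan y"
proof -
  have yx: "y < x"
    using assms mult_strict_right_mono[of q 1 x] by linarith
  obtain z where z: "y < z" "z < x" "arctan x - arctan y = (x - y) * inverse (1 + z\<^sup>2)"
    using MVT2[OF yx, of arctan "\<lambda>z. inverse (1 + z\<^sup>2)"] DERIV_arctan by blast
  have "z\<^sup>2 \<le> x\<^sup>2" using z assms by (intro power_mono) auto
  then have "inverse (1 + x\<^sup>2) \<le> inverse (1 + z\<^sup>2)"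
    by (intro le_imp_inverse_le) (auto intro: add_pos_nonneg)
  moreover have "(1 - q) * x \<le> x - y" using assms by (simp add: algebra_simps)
  ultimately have "(1 - q) * x * inverse (1 + x\<^sup>2) \<le> (x - y) * inverse (1 + z\<^sup>2)"
    using assms yx by (intro mult_mono) auto
  then show ?thesis using z(3) by (simp add: divide_inverse mult.assoc)
qed

text \<open>
  The ratio \<open>17\<close> is chosen so that at each scale the other bumps add up to at most \<open>1 / 8\<close>, half of
  the value that \<open>norm_bump_at_peak\<close> guarantees for the bump of that scale.
\<close>

locale lacunary =
  fixes s :: "nat \<Rightarrow> real"
  assumes pos: "0 < s k" and decay: "17 * s (Suc k) \<le> s k"
begin

lemma sum_tail_le:
  assumes "N \<le> m"
  shows "(\<Sum>k=N..<m. s k) \<le> 17 / 16 * (s N - s m)"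
  using assms
proof (induction m rule: dec_induct)
  case (step m)
  then show ?case using decay[of m] by simp
qed simp

lemma sum_head_inverse_le: "(\<Sum>k<N. 1 / s k) \<le> 1 / (16 * s N)"
proof (induction N)
  case 0
  then show ?case using pos[of 0] by simp
next
  case (Suc N)
  have "17 / (16 * s N) \<le> 1 / (16 * s (Suc N))"
    using decay[of N] pos[of N] pos[of "Suc N"] by (simp add: field_simps)
  moreover have "1 / (16 * s N) + 1 / s N = 17 / (16 * s N)"
    using pos[of N] by (simp add: field_simps)
  ultimately show ?case using Suc by simp
qed

lemma summable_scales: "summable s"
proof (rule summableI_nonneg_bounded[where x = "17 / 16 * s 0"])
  show "0 \<le> s n" for n using pos[of n] by simp
  show "(\<Sum>k<n. s k) \<le> 17 / 16 * s 0" for n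
    using sum_tail_le[of 0 n] pos[of n] by (simp add: lessThan_atLeast0)
qed

lemma sum_norm_bump_le:
  assumes z: "z \<in> ball 0 1"
  shows "(\<Sum>k<m. cmod (bump (s k) z)) \<le> 17 / 32 * pi"
proof -
  define x where "x k = s k / cmod (1 - z)" for k
  have u: "0 < cmod (1 - z)" using z by (rule disc_ne_one)
  have x: "0 < x k" "x (Suc k) \<le> 1 / 17 * x k" for k
    using u pos[of k] decay[of k] by (simp_all add: x_def field_simps)
  have "cmod (bump (s k) z) \<le> 17 / 16 * (arctan (x k) - arctan (x (Suc k)))" for k
  proof -
    have "(1 - 1 / 17) * (x k / (1 + (x k)\<^sup>2)) \<le> arctan (x k) - arctan (x (Suc k))"
      by (rule arctan_increment) (use x[of k] x(1)[of "Suc k"] in auto)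
    moreover have "cmod (bump (s k) z) \<le> x k / (1 + (x k)\<^sup>2)"
      using norm_bump_le(1)[OF pos z, of k] unfolding x_def .
    ultimately show ?thesis by argo
  qed
  then have "(\<Sum>k<m. cmod (bump (s k) z)) \<le> (\<Sum>k<m. 17 / 16 * (arctan (x k) - arctan (x (Suc k))))"
    by (rule sum_mono)
  also have "\<dots> = 17 / 16 * (arctan (x 0) - arctan (x m))"
    by (simp only: sum_distrib_left[symmetric] sum_lessThan_telescope'[of "\<lambda>k. arctan (x k)"])
  also have "\<dots> \<le> 17 / 16 * (pi / 2)"
    using arctan_ubound[of "x 0"] x(1)[of m] zero_less_arctan_iff[of "x m"]
    by (intro mult_left_mono) linarith+
  finally show ?thesis by simp
qed

text \<open>
  The coarser and the finer scales contribute at most \<open>1 / 16\<close> each, by geometric summation.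
\<close>

lemma sum_norm_bump_off_peak_le:
  assumes z: "z \<in> ball 0 1" "cmod (1 - z) = s n" and nm: "n < m"
  shows "(\<Sum>k\<in>{..<m} - {n}. cmod (bump (s k) z)) \<le> 1 / 8"
proof -
  have "{..<m} - {n} = {..<n} \<union> {Suc n..<m}" using nm by auto
  moreover have "{..<n} \<inter> {Suc n..<m} = {}" by auto
  ultimately have "(\<Sum>k\<in>{..<m} - {n}. cmod (bump (s k) z))
      = (\<Sum>k<n. cmod (bump (s k) z)) + (\<Sum>k=Suc n..<m. cmod (bump (s k) z))"
    by (simp add: sum.union_disjoint)
  also have "\<dots> \<le> (\<Sum>k<n. s n * (1 / s k)) + (\<Sum>k=Suc n..<m. s k / s n)"
    using norm_bump_le_ratio[OF pos z(1)] z(2) by (intro add_mono sum_mono) auto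
  also have "\<dots> = s n * (\<Sum>k<n. 1 / s k) + (\<Sum>k=Suc n..<m. s k) / s n"
    by (simp add: sum_distrib_left sum_divide_distrib)
  also have "\<dots> \<le> s n * (1 / (16 * s n)) + (s n / 16) / s n"
  proof (intro add_mono mult_left_mono divide_right_mono)
    show "(\<Sum>k=Suc n..<m. s k) \<le> s n / 16"
      using sum_tail_le[of "Suc n" m] nm decay[of n] pos[of m] by simp
  qed (use pos[of n] sum_head_inverse_le in auto)
  also have "\<dots> = 1 / 8" using pos[of n] by simp
  finally show ?thesis .
qed

definition interpolant :: "linfty \<Rightarrow> complex \<Rightarrow> complex" where
  "interpolant a z = (\<Sum>k. apply_bcontfun a k * bump (s k) z)"

lemma norm_term_le: "cmod (apply_bcontfun a k * bump (s k) z) \<le> norm a * cmod (bump (s k) z)"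
  by (simp add: norm_mult mult_right_mono norm_bounded)

lemma summable_norm_bump:
  assumes "z \<in> ball 0 1" shows "summable (\<lambda>k. cmod (bump (s k) z))"
  by (rule summableI_nonneg_bounded[where x = "17 / 32 * pi"])
     (use sum_norm_bump_le[OF assms] in auto)

lemma summable_interpolant:
  assumes "z \<in> ball 0 1" shows "summable (\<lambda>k. apply_bcontfun a k * bump (s k) z)"
  by (rule summable_comparison_test'[OF summable_mult[OF summable_norm_bump[OF assms]]])
     (rule norm_term_le)

lemma interpolant_add:
  assumes "z \<in> ball 0 1"
  shows "interpolant (a + b) z = interpolant a z + interpolant b z"
  unfolding interpolant_def
  by (subst suminf_add[OF summable_interpolant summable_interpolant])
     (use assms in \<open>simp_all add: algebra_simps\<close>)

lemma interpolant_scaleC: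
  assumes "z \<in> ball 0 1"
  shows "interpolant (c *\<^sub>C a) z = c * interpolant a z"
  unfolding interpolant_def
  by (subst suminf_mult[OF summable_interpolant, symmetric])
     (use assms in \<open>simp_all add: apply_bcontfun_scaleC scaleC_complex_def mult.assoc\<close>)

lemma norm_interpolant_le:
  assumes z: "z \<in> ball 0 1"
  shows "cmod (interpolant a z) \<le> 17 / 32 * pi * norm a"
proof -
  have sum_le: "(\<Sum>k<m. norm a * cmod (bump (s k) z)) \<le> 17 / 32 * pi * norm a" for m
    using mult_left_mono[OF sum_norm_bump_le[OF z, of m], of "norm a"]
    by (simp add: sum_distrib_left mult.commute)
  have "cmod (\<Sum>k. apply_bcontfun a k * bump (s k) z) \<le> (\<Sum>k. norm a * cmod (bump (s k) z))"
    by (rule norm_suminf_le[OF norm_term_le summable_mult[OF summable_norm_bump[OF z]]])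
  also have "\<dots> \<le> 17 / 32 * pi * norm a"
    by (rule suminf_le_const[OF summable_mult[OF summable_norm_bump[OF z]] sum_le])
  finally show ?thesis unfolding interpolant_def .
qed

lemma holomorphic_interpolant: "interpolant a holomorphic_on ball 0 1"
proof (rule holomorphic_uniform_sequence[OF open_ball])
  show "(\<lambda>z. \<Sum>k<n. apply_bcontfun a k * bump (s k) z) holomorphic_on ball 0 1" for n
    unfolding bump_def using norm_bump_le(2)[OF pos]
    by (intro holomorphic_intros) auto
  fix z :: complex assume z: "z \<in> ball 0 1"
  define d where "d = (1 - cmod z) / 2"
  have d: "0 < d" "cmod z + d = 1 - d" using z by (auto simp: d_def field_simps)
  have w: "w \<in> ball 0 1" "d \<le> cmod (1 - w)" if "w \<in> cball z d" for w
  proof -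
    have "cmod w \<le> cmod z + d"
      using that norm_triangle_ineq2[of w z] by (simp add: dist_norm norm_minus_commute)
    then show "w \<in> ball 0 1" "d \<le> cmod (1 - w)"
      using d norm_triangle_ineq2[of 1 w] by auto
  qed
  have "uniform_limit (cball z d) (\<lambda>n w. \<Sum>k<n. apply_bcontfun a k * bump (s k) w)
      (interpolant a) sequentially"
    unfolding interpolant_def
  proof (rule Weierstrass_m_test)
    fix k w assume "w \<in> cball z d"
    note w = w[OF this]
    have "cmod (bump (s k) w) \<le> s k / cmod (1 - w)"
      by (rule norm_bump_le_ratio(1)[OF pos w(1)])
    also have "\<dots> \<le> s k / d"
      using w(2) d(1) pos[of k] by (intro divide_left_mono mult_pos_pos) auto
    finally have "norm a * cmod (bump (s k) w) \<le> norm a * (s k / d)"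
      by (rule mult_left_mono) simp
    then show "cmod (apply_bcontfun a k * bump (s k) w) \<le> norm a * (s k / d)"
      using norm_term_le order_trans by blast
  next
    show "summable (\<lambda>k. norm a * (s k / d))"
      by (intro summable_mult summable_divide summable_scales)
  qed
  moreover have "cball z d \<subseteq> ball 0 1" using w(1) by blast
  ultimately show "\<exists>d>0. cball z d \<subseteq> ball 0 1 \<and> uniform_limit (cball z d)
      (\<lambda>n w. \<Sum>k<n. apply_bcontfun a k * bump (s k) w) (interpolant a) sequentially"
    using d(1) by blast
qed

text \<open>
  At distance \<open>s n\<close> from \<open>1\<close> the \<open>n\<close>-th term has modulus at least \<open>\<bar>a n\<bar> / 4\<close>, and all others
  together at most \<open>norm a / 8\<close>.
\<close>

lemma norm_interpolant_ge:
  assumes z: "z \<in> ball 0 1" "cmod (1 - z) = s n"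
  shows "cmod (apply_bcontfun a n) / 4 - norm a / 8 \<le> cmod (interpolant a z)"
proof -
  let ?f = "\<lambda>k. apply_bcontfun a k * bump (s k) z"
  have "cmod (interpolant a z - ?f n) \<le> norm a / 8"
  proof (rule tendsto_upperbound)
    show "(\<lambda>m. cmod ((\<Sum>k<m. ?f k) - ?f n)) \<longlonglongrightarrow> cmod (interpolant a z - ?f n)"
      unfolding interpolant_def
      by (intro tendsto_intros summable_LIMSEQ summable_interpolant z)
    have "cmod ((\<Sum>k<m. ?f k) - ?f n) \<le> norm a / 8" if m: "Suc n \<le> m" for m
    proof -
      have "(\<Sum>k<m. ?f k) - ?f n = (\<Sum>k\<in>{..<m} - {n}. ?f k)"
        using m by (subst sum.remove[of _ n]) auto
      also have "cmod \<dots> \<le> (\<Sum>k\<in>{..<m} - {n}. norm a * cmod (bump (s k) z))"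
        by (rule sum_norm_le) (rule norm_term_le)
      also have "\<dots> \<le> norm a * (1 / 8)"
        using sum_norm_bump_off_peak_le[OF z, of m] m
        by (simp only: sum_distrib_left[symmetric]) (intro mult_left_mono, auto)
      finally show ?thesis by simp
    qed
    then show "\<forall>\<^sub>F m in sequentially. cmod ((\<Sum>k<m. ?f k) - ?f n) \<le> norm a / 8"
      unfolding eventually_sequentially by blast
  qed simp
  moreover have "cmod (apply_bcontfun a n) * (1 / 4) \<le> cmod (?f n)"
    using norm_bump_at_peak[OF z(1)] z(2) by (simp only: norm_mult) (intro mult_left_mono, auto)
  ultimately show ?thesis
    using norm_triangle_ineq3[of "interpolant a z" "?f n"] by simp
qed

end

text \<open>
  The scales are the distances to \<open>1\<close> of points of \<open>W\<close> that approach \<open>1\<close> fast enough. For the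
  lower bound, evaluate at the point belonging to an index \<open>n\<close> with \<open>\<bar>a n\<bar> \<ge> 3/4 norm a\<close>.
\<close>

lemma bounded_sequence_interpolation:
  assumes W: "W \<subseteq> ball 0 1" "1 \<in> closure W"
  obtains E :: "linfty \<Rightarrow> complex \<Rightarrow> complex" and C
  where "0 \<le> C"
    "\<And>a b z. z \<in> ball 0 1 \<Longrightarrow> E (a + b) z = E a z + E b z"
    "\<And>c a z. z \<in> ball 0 1 \<Longrightarrow> E (c *\<^sub>C a) z = c * E a z"
    "\<And>a z. z \<in> ball 0 1 \<Longrightarrow> cmod (E a z) \<le> C * norm a"
    "\<And>a. E a holomorphic_on ball 0 1"
    "\<And>a. \<exists>w\<in>W. norm a / 16 \<le> cmod (E a w)"
proof -
  have near: "\<exists>w\<in>W. cmod (1 - w) < e" if "0 < e" for e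
    using W(2) that unfolding closure_approachable by (simp add: dist_norm norm_minus_commute)
  have "\<exists>w. \<forall>n. w n \<in> W \<and> 17 * cmod (1 - w (Suc n)) \<le> cmod (1 - w n)"
  proof (rule dependent_nat_choice)
    show "\<exists>w. w \<in> W" using near[of 1] by auto
    fix w and n :: nat assume "w \<in> W"
    then have "0 < cmod (1 - w) / 17" using W(1) disc_ne_one by auto
    from near[OF this] show "\<exists>w'. w' \<in> W \<and> 17 * cmod (1 - w') \<le> cmod (1 - w)"
      by auto
  qed
  then obtain w where w: "\<And>n. w n \<in> W" "\<And>n. 17 * cmod (1 - w (Suc n)) \<le> cmod (1 - w n)"
    by blast
  have w_ball: "w n \<in> ball 0 1" for n using w(1) W(1) by blast
  interpret lacunary "\<lambda>n. cmod (1 - w n)"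
    by standard (use w_ball disc_ne_one w(2) in auto)
  show thesis
  proof (rule that[of "17 / 32 * pi" interpolant])
    show "\<exists>w\<in>W. norm a / 16 \<le> cmod (interpolant a w)" for a
    proof (cases "a = 0")
      case True
      then show ?thesis using w(1) by auto
    next
      case False
      obtain n where n: "3 / 4 * norm a \<le> cmod (apply_bcontfun a n)"
      proof (rule ccontr)
        assume "\<not> thesis"
        then have "\<And>n. cmod (apply_bcontfun a n) \<le> 3 / 4 * norm a"
          using that by (meson linear)
        then have "norm a \<le> 3 / 4 * norm a" by (rule norm_bound)
        then show False using False by simp
      qed
      have "norm a / 16 \<le> cmod (apply_bcontfun a n) / 4 - norm a / 8" using n by simp
      also have "\<dots> \<le> cmod (interpolant a (w n))"
        by (rule norm_interpolant_ge[OF w_ball refl])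
      finally show ?thesis using w(1) by blast
    qed
  qed (simp, (rule interpolant_add interpolant_scaleC norm_interpolant_le holomorphic_interpolant
        | assumption)+)
qed


section \<open>Copies of bounded sequences fixed by a composition operator\<close>

lemma subspace_range_clinear:
  assumes "clinear f"
  shows "complex_vector.subspace (range f)"
  unfolding complex_vector.subspace_def
proof (intro conjI ballI allI)
  show "0 \<in> range f" using clinear_diff[OF assms, of 0 0] by (intro range_eqI[of _ _ 0]) simp
  show "x + y \<in> range f" if "x \<in> range f" "y \<in> range f" for x y
    using that assms unfolding clinear_iff by (metis (mono_tags) rangeE rangeI)
  show "c *\<^sub>C x \<in> range f" if "x \<in> range f" for c x
    using that assms unfolding clinear_iff by (metis (mono_tags) rangeE rangeI)
qed

text \<open>
  Being bounded below, \<open>T \<circ> J\<close> has a Lipschitz inverse; as \<open>T\<close> is bounded, so have \<open>J\<close> and the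
  restriction of \<open>T\<close> to the range of \<open>J\<close>.
\<close>

lemma fixes_copy_of_linftyI:
  fixes T :: "'a::complex_normed_vector \<Rightarrow> 'b::complex_normed_vector" and J :: "linfty \<Rightarrow> 'a"
  assumes T: "clinear T" "\<And>x. norm (T x) \<le> K * norm x" "0 < K"
    and J: "clinear J" "\<And>a. norm (J a) \<le> C * norm a" "0 \<le> C"
    and below: "\<And>a. c * norm a \<le> norm (T (J a))" "0 < c"
  shows "fixes_copy_of_linfty T"
proof -
  have J_diff: "J (a - b) = J a - J b" for a b
    using J(1) by (rule clinear_diff)
  have T_diff: "T (x - y) = T x - T y" for x y
    using T(1) by (rule clinear_diff)
  have TJ_below: "dist a b \<le> 1 / c * dist (T (J a)) (T (J b))" for a b
    using below(1)[of "a - b"] below(2) by (simp add: J_diff T_diff dist_norm field_simps)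
  have T_le: "dist (T x) (T y) \<le> K * dist x y" for x y
    using T(2)[of "x - y"] by (simp add: T_diff dist_norm)
  have J_below: "dist a b \<le> K / c * dist (J a) (J b)" for a b
  proof -
    have "1 / c * dist (T (J a)) (T (J b)) \<le> 1 / c * (K * dist (J a) (J b))"
      using T_le below(2) by (intro mult_left_mono) auto
    then show ?thesis using TJ_below[of a b] by simp
  qed
  have inv_J: "inv J (J a) = a" for a
  proof -
    have "x = y" if "J x = J y" for x y
      using J_below[of x y] that by simp
    then have "inj J" by (rule injI)
    then show ?thesis by simp
  qed
  have inv_TJ: "inv (\<lambda>a. T (J a)) (T (J a)) = a" for a
  proof -
    have "x = y" if "T (J x) = T (J y)" for x y
      using TJ_below[of x y] that by simp
    then have "inj (\<lambda>a. T (J a))" by (rule injI)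
    then show ?thesis by (rule inv_f_f)
  qed
  have J_lip: "C-lipschitz_on UNIV J"
    using J(2)[of "_ - _"] J(3) by (intro lipschitz_onI) (simp_all add: J_diff dist_norm)
  have inv_J_lip: "(K / c)-lipschitz_on (range J) (inv J)"
    using J_below T(3) below(2) by (intro lipschitz_onI) (auto simp: inv_J)
  have T_lip: "K-lipschitz_on (range J) T"
    using T_le T(3) by (intro lipschitz_onI) auto
  let ?S = "\<lambda>z. J (inv (\<lambda>a. T (J a)) z)"
  have S_lip: "(C * (1 / c))-lipschitz_on (T ` range J) ?S"
  proof (rule lipschitz_on_compose2[where f = "inv (\<lambda>a. T (J a))" and g = J])
    show "(1 / c)-lipschitz_on (T ` range J) (inv (\<lambda>a. T (J a)))"
      using TJ_below below(2) by (intro lipschitz_onI) (auto simp: inv_TJ)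
  qed (rule lipschitz_on_subset[OF J_lip subset_UNIV])
  have "homeomorphism UNIV (range J) J (inv J)"
    using lipschitz_on_continuous_on[OF J_lip] lipschitz_on_continuous_on[OF inv_J_lip]
    by (intro homeomorphismI) (auto simp: inv_J)
  moreover have "homeomorphism (range J) (T ` range J) T ?S"
    using lipschitz_on_continuous_on[OF T_lip] lipschitz_on_continuous_on[OF S_lip]
    by (intro homeomorphismI) (auto simp: inv_TJ)
  moreover have "complex_vector.subspace (range J)"
    using J(1) by (rule subspace_range_clinear)
  ultimately show ?thesis
    unfolding fixes_copy_of_linfty_def using J(1)
    by blast
qed

lemma apply_comp_hlip0:
  assumes "apply_hlip0 \<phi> ` ball 0 1 \<subseteq> ball 0 1" "y \<in> ball 0 1"
  shows "apply_hlip0 (comp_hlip0 \<phi> f) y = apply_hlip0 f (apply_hlip0 \<phi> y)"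
  using assms by (simp add: comp_hlip0.rep_eq)

lemma apply_comp_hinf:
  assumes "apply_hlip0 \<phi> ` ball 0 1 \<subseteq> ball 0 1" "y \<in> ball 0 1"
  shows "apply_hinf (comp_hinf \<phi> f) y = apply_hinf f (apply_hlip0 \<phi> y)"
  using assms by (simp add: comp_hinf.rep_eq)

lemma norm_comp_hlip0_le:
  fixes \<phi> :: "('y::complex_normed_vector, 'x::complex_normed_vector) hlip0"
  assumes \<phi>: "apply_hlip0 \<phi> ` ball 0 1 \<subseteq> ball 0 1"
  shows "norm (comp_hlip0 \<phi> f) \<le> norm \<phi> * norm f"
proof (rule norm_hlip0_le)
  fix x y :: 'y assume xy: "x \<in> ball 0 1" "y \<in> ball 0 1"
  then have "apply_hlip0 \<phi> x \<in> ball 0 1" "apply_hlip0 \<phi> y \<in> ball 0 1" using \<phi> by blast+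
  then have "norm (apply_hlip0 f (apply_hlip0 \<phi> x) - apply_hlip0 f (apply_hlip0 \<phi> y))
      \<le> norm f * norm (apply_hlip0 \<phi> x - apply_hlip0 \<phi> y)"
    by (rule norm_apply_hlip0_diff_le)
  also have "\<dots> \<le> norm f * (norm \<phi> * norm (x - y))"
    by (intro mult_left_mono norm_apply_hlip0_diff_le xy) simp
  finally show "norm (apply_hlip0 (comp_hlip0 \<phi> f) x - apply_hlip0 (comp_hlip0 \<phi> f) y)
      \<le> norm \<phi> * norm f * norm (x - y)"
    by (simp add: apply_comp_hlip0[OF \<phi> xy(1)] apply_comp_hlip0[OF \<phi> xy(2)] mult_ac)
qed simp

text \<open>
  The primitive is written as an integral from \<open>0\<close> so that it depends linearly on \<open>f\<close> and vanishes
  at \<open>0\<close>.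
\<close>

lemma disc_primitive:
  assumes "f holomorphic_on ball 0 1" "z \<in> ball 0 1"
  shows "((\<lambda>z. contour_integral (linepath 0 z) f) has_field_derivative f z) (at z)"
proof -
  obtain g where g: "\<And>z. z \<in> ball 0 1 \<Longrightarrow> (g has_field_derivative f z) (at z)"
    using holomorphic_convex_primitive'[OF convex_ball open_ball assms(1)]
    by (metis at_within_open open_ball)
  have eq: "g w - g 0 = contour_integral (linepath 0 w) f" if "w \<in> ball 0 1" for w
  proof -
    have "(f has_contour_integral (g (pathfinish (linepath 0 w)) - g (pathstart (linepath 0 w))))
        (linepath 0 w)"
    proof (rule contour_integral_primitive)
      show "(g has_field_derivative f z) (at z within ball 0 1)" if "z \<in> ball 0 1" for z
        using g[OF that] by (rule has_field_derivative_at_within)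
      show "path_image (linepath 0 w) \<subseteq> ball 0 1"
        using that closed_segment_subset[of 0 "ball 0 1" w] by simp
    qed (rule valid_path_linepath)
    then show ?thesis by (simp add: contour_integral_unique)
  qed
  have "((\<lambda>w. g w - g 0) has_field_derivative f z) (at z)"
    using g[OF assms(2)] by (auto intro!: derivative_eq_intros)
  then show ?thesis
    by (rule has_field_derivative_transform_within_open[OF _ open_ball assms(2)]) (rule eq)
qed

lemma contour_integrable_in_disc:
  assumes "f holomorphic_on ball 0 1" "z \<in> ball 0 1"
  shows "f contour_integrable_on linepath 0 z"
proof (rule contour_integrable_holomorphic_simple[OF assms(1) open_ball])
  show "path_image (linepath 0 z) \<subseteq> ball 0 1"
    using assms(2) closed_segment_subset[of 0 "ball 0 1" z] by simp
qed simp

lemma contour_integral_cong_disc: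
  assumes "z \<in> ball 0 1" "\<And>w. w \<in> ball 0 1 \<Longrightarrow> f w = g w"
  shows "contour_integral (linepath 0 z) f = contour_integral (linepath 0 z) g"
proof (rule contour_integral_eq)
  show "f w = g w" if "w \<in> path_image (linepath 0 z)" for w
    using that assms closed_segment_subset[of 0 "ball 0 1" z] by auto
qed

lemma hlip0_of_functional:
  fixes \<Lambda> :: "'a::complex_normed_vector \<Rightarrow> complex"
  assumes \<Lambda>: "clinear \<Lambda>" "\<And>x. cmod (\<Lambda> x) \<le> norm x"
    and g: "\<And>z. z \<in> ball 0 1 \<Longrightarrow> (g has_field_derivative g' z) (at z)" "g 0 = 0"
    and K: "\<And>z. z \<in> ball 0 1 \<Longrightarrow> cmod (g' z) \<le> K"
  shows "\<exists>F :: ('a, complex) hlip0. (\<forall>x\<in>ball 0 1. apply_hlip0 F x = g (\<Lambda> x)) \<and> norm F \<le> K"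
proof -
  let ?F = "\<lambda>x. if x \<in> ball 0 1 then g (\<Lambda> x) else 0"
  have mem: "\<Lambda> x \<in> ball 0 1" if "x \<in> ball 0 1" for x
    using that \<Lambda>(2)[of x] by simp
  have K0: "0 \<le> K" using K[of 0] norm_ge_zero[of "g' 0"] by (simp del: norm_ge_zero)
  have lip: "cmod (?F x - ?F y) \<le> K * norm (x - y)" if xy: "x \<in> ball 0 1" "y \<in> ball 0 1" for x y
  proof -
    have "cmod (g (\<Lambda> x) - g (\<Lambda> y)) \<le> K * cmod (\<Lambda> x - \<Lambda> y)"
      using g(1) K mem xy
      by (intro field_differentiable_bound[OF convex_ball[of 0 1]])
         (auto intro: has_field_derivative_at_within)
    also have "cmod (\<Lambda> x - \<Lambda> y) \<le> norm (x - y)"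
      using \<Lambda>(2)[of "x - y"] clinear_diff[OF \<Lambda>(1), of x y] by simp
    finally show ?thesis using xy K0 by (simp add: mult_left_mono)
  qed
  have "holomorphic_map_on (ball 0 1) (\<lambda>x. g (\<Lambda> x))"
    unfolding holomorphic_map_on_def
  proof
    fix x :: 'a assume x: "x \<in> ball 0 1"
    have "bounded_linear \<Lambda>"
    proof (rule bounded_linear_intro)
      show "\<Lambda> (x + y) = \<Lambda> x + \<Lambda> y" for x y using \<Lambda>(1) by (simp add: clinear_iff)
      show "\<Lambda> (r *\<^sub>R x) = r *\<^sub>R \<Lambda> x" for r x
        using clinear_imp_mult[OF \<Lambda>(1), of "of_real r" x]
        by (simp add: scaleC_of_real scaleR_conv_of_real)
      show "norm (\<Lambda> x) \<le> norm x * 1" for x using \<Lambda>(2) by simp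
    qed
    then have "(\<Lambda> has_derivative \<Lambda>) (at x)" by (rule bounded_linear_imp_has_derivative)
    moreover have "(g has_derivative (*) (g' (\<Lambda> x))) (at (\<Lambda> x))"
      using g(1)[OF mem[OF x]] by (simp add: has_field_derivative_def)
    ultimately have "((\<lambda>x. g (\<Lambda> x)) has_derivative (\<lambda>h. g' (\<Lambda> x) * \<Lambda> h)) (at x)"
      by (rule has_derivative_compose)
    moreover have "clinear (\<lambda>h. g' (\<Lambda> x) * \<Lambda> h)"
      using clinear_scaleC[OF \<Lambda>(1)] by (simp add: scaleC_complex_def)
    ultimately show "\<exists>D. clinear D \<and> ((\<lambda>x. g (\<Lambda> x)) has_derivative D) (at x)" by blast
  qed
  then have "holomorphic_map_on (ball 0 1) ?F"
    by (rule holomorphic_map_on_cong[OF open_ball, rotated]) simp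
  moreover have "K-lipschitz_on (ball 0 1) ?F"
    using lip K0 by (intro lipschitz_onI) (simp_all only: dist_norm)
  moreover have "\<Lambda> 0 = 0" using \<Lambda>(2)[of 0] by simp
  ultimately have F: "apply_hlip0 (Abs_hlip0 ?F) = ?F"
    using g(2) by (intro Abs_hlip0_inverse) auto
  show ?thesis
  proof (intro exI conjI ballI)
    show "apply_hlip0 (Abs_hlip0 ?F) x = g (\<Lambda> x)" if "x \<in> ball 0 1" for x
      using that unfolding F by simp
    show "norm (Abs_hlip0 ?F) \<le> K"
      by (rule norm_hlip0_le[OF K0]) (use lip in \<open>simp only: F\<close>)
  qed
qed

text \<open>
  If \<open>\<bar>h'\<bar> < 1/2\<close> on \<open>[t0, 1)\<close>, the mean value inequality and \<open>h t \<longlongrightarrow> 1\<close> would give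
  \<open>\<bar>1 - h t0\<bar> \<le> (1 - t0) / 2\<close>, whereas \<open>\<bar>h t0\<bar> \<le> t0\<close> by the Schwarz lemma.
\<close>

lemma closure_steep_values:
  assumes h: "h holomorphic_on ball 0 1" "h 0 = 0" "\<And>z. z \<in> ball 0 1 \<Longrightarrow> cmod (h z) < 1"
    and lim: "((\<lambda>t. h (of_real t)) \<longlongrightarrow> 1) (at_left 1)"
  shows "1 \<in> closure (h ` {z \<in> ball 0 1. 1 / 2 \<le> cmod (deriv h z)})"
  unfolding closure_approachable
proof (intro allI impI)
  fix e :: real assume e: "0 < e"
  have "\<forall>\<^sub>F t in at_left 1. dist (h (of_real t)) 1 < e"
    using tendstoD[OF lim e] .
  then obtain b where b: "b < 1" "\<And>t. b < t \<Longrightarrow> t < 1 \<Longrightarrow> dist (h (of_real t)) 1 < e"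
    unfolding eventually_at_left_field by blast
  define t0 where "t0 = (max 0 b + 1) / 2"
  have t0: "0 < t0" "b < t0" "t0 < 1" using b(1) by (auto simp: t0_def max_def)
  have "\<exists>t. t0 \<le> t \<and> t < 1 \<and> 1 / 2 \<le> cmod (deriv h (of_real t))"
  proof (rule ccontr)
    assume "\<not> ?thesis"
    then have flat: "cmod (deriv h (of_real t)) \<le> 1 / 2" if "t0 \<le> t" "t < 1" for t
      using that by force
    have "cmod (h (of_real s) - h (of_real t0)) \<le> (1 - t0) / 2" if s: "t0 < s" "s < 1" for s
    proof -
      let ?S = "closed_segment (complex_of_real t0) (of_real s)"
      have "\<exists>t. z = of_real t \<and> t0 \<le> t \<and> t < 1" if "z \<in> ?S" for z
      proof -
        have "z \<in> of_real ` closed_segment t0 s"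
          using that by (simp add: closed_segment_of_real)
        then show ?thesis using s by (auto simp: closed_segment_eq_real_ivl)
      qed
      then have "cmod (h (of_real s) - h (of_real t0)) \<le> 1 / 2 * cmod (of_real s - of_real t0)"
      proof (intro field_differentiable_bound[where S = ?S and f' = "deriv h"])
        fix z assume "z \<in> ?S"
        then obtain t where t: "z = of_real t" "t0 \<le> t" "t < 1"
          using \<open>\<And>z. z \<in> ?S \<Longrightarrow> \<exists>t. z = of_real t \<and> t0 \<le> t \<and> t < 1\<close> by blast
        then have "z \<in> ball 0 1" using t0 by simp
        then show "(h has_field_derivative deriv h z) (at z within ?S)"
          using holomorphic_derivI[OF h(1) open_ball] has_field_derivative_at_within by blast
        show "cmod (deriv h z) \<le> 1 / 2" using flat t by simp
      qed auto
      also have "cmod (of_real s - of_real t0) = s - t0"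
        using s by (simp flip: of_real_diff)
      finally show ?thesis using s by simp
    qed
    moreover have "\<forall>\<^sub>F s in at_left 1. t0 < s \<and> s < (1::real)"
      using t0(3) by (auto simp: eventually_at_left_field)
    ultimately have "\<forall>\<^sub>F s in at_left 1. cmod (h (of_real s) - h (of_real t0)) \<le> (1 - t0) / 2"
      by (auto elim: eventually_mono)
    then have "cmod (1 - h (of_real t0)) \<le> (1 - t0) / 2"
      by (rule tendsto_upperbound[OF tendsto_norm[OF tendsto_diff[OF lim tendsto_const]]]) simp
    moreover have "cmod (h (of_real t0)) \<le> t0"
      using Schwarz_Lemma(1)[OF h(1,2), of "of_real t0"] h(3) t0 by simp
    ultimately show False
      using norm_triangle_ineq2[of 1 "h (of_real t0)"] t0 by simp
  qed
  then obtain t where t: "t0 \<le> t" "t < 1" "1 / 2 \<le> cmod (deriv h (of_real t))" by blast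
  then have "dist (h (of_real t)) 1 < e" using b(2) t0 by simp
  moreover have "complex_of_real t \<in> ball 0 1" using t t0 by simp
  ultimately show "\<exists>w\<in>h ` {z \<in> ball 0 1. 1 / 2 \<le> cmod (deriv h z)}. dist w 1 < e"
    using t(3) by blast
qed

text \<open>
  The restriction of \<open>\<Lambda> \<circ> \<phi>\<close> to a complex line satisfies the hypotheses of the Schwarz lemma.
\<close>

lemma functional_along_line:
  fixes \<phi> :: "('y::complex_normed_vector, 'x::complex_normed_vector) hlip0"
  assumes \<phi>: "apply_hlip0 \<phi> ` ball 0 1 \<subseteq> ball 0 1" and u: "norm u = 1"
    and \<Lambda>: "clinear \<Lambda>" "\<And>x. cmod (\<Lambda> x) \<le> norm x"
  shows "(\<lambda>z. \<Lambda> (apply_hlip0 \<phi> (z *\<^sub>C u))) holomorphic_on ball 0 1"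
    and "\<Lambda> (apply_hlip0 \<phi> (0 *\<^sub>C u)) = 0"
    and "\<And>z. z \<in> ball 0 1 \<Longrightarrow> cmod (\<Lambda> (apply_hlip0 \<phi> (z *\<^sub>C u))) < 1"
proof -
  have u_ball: "z *\<^sub>C u \<in> ball 0 1" if "z \<in> ball 0 1" for z
    using that u by (simp add: norm_scaleC)
  have \<phi>_ball: "apply_hlip0 \<phi> (z *\<^sub>C u) \<in> ball 0 1" if "z \<in> ball 0 1" for z
    using \<phi> u_ball[OF that] by blast
  have "\<exists>L :: ('x, complex) hlip0. (\<forall>x\<in>ball 0 1. apply_hlip0 L x = \<Lambda> x) \<and> norm L \<le> 1"
    using hlip0_of_functional[OF \<Lambda>, of "\<lambda>z. z" "\<lambda>_. 1" 1] by simp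
  then obtain L :: "('x, complex) hlip0" where L: "\<And>x. x \<in> ball 0 1 \<Longrightarrow> apply_hlip0 L x = \<Lambda> x"
    by blast
  have "holomorphic_map_on (ball 0 1) (\<lambda>y. apply_hlip0 L (apply_hlip0 \<phi> y))"
    by (rule holomorphic_map_on_compose[OF holomorphic_apply_hlip0 holomorphic_apply_hlip0 \<phi>])
  then have "(\<lambda>z. apply_hlip0 L (apply_hlip0 \<phi> (0 + z *\<^sub>C u))) holomorphic_on ball 0 1"
    by (rule holomorphic_map_on_along_line) (use u_ball in simp)
  then show "(\<lambda>z. \<Lambda> (apply_hlip0 \<phi> (z *\<^sub>C u))) holomorphic_on ball 0 1"
    by (rule holomorphic_transform) (use L \<phi>_ball in simp)
  show "\<Lambda> (apply_hlip0 \<phi> (0 *\<^sub>C u)) = 0" using \<Lambda>(2)[of 0] by simp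
  show "cmod (\<Lambda> (apply_hlip0 \<phi> (z *\<^sub>C u))) < 1" if "z \<in> ball 0 1" for z
    using \<Lambda>(2)[of "apply_hlip0 \<phi> (z *\<^sub>C u)"] \<phi>_ball[OF that] by simp
qed

text \<open>
  The copy of \<open>\<ell>\<^sub>\<infinity>\<close> consists of the functions \<open>P a \<circ> \<Lambda>\<close>, where \<open>P a\<close> is the primitive of an
  interpolating function \<open>E a\<close>. The interpolation takes place at values of \<open>h\<close> attained with
  \<open>\<bar>h'\<bar> \<ge> 1/2\<close>, so the derivative of \<open>P a \<circ> \<Lambda> \<circ> \<phi>\<close> in the direction \<open>y0\<close> has modulus at least
  \<open>norm a / 32\<close> somewhere, and the Lipschitz constant dominates it.
\<close>

lemma fixes_copy_if_functional_peaks: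
  fixes \<phi> :: "('y::complex_normed_vector, 'x::complex_normed_vector) hlip0"
  assumes \<phi>: "apply_hlip0 \<phi> ` ball 0 1 \<subseteq> ball 0 1"
    and y0: "norm y0 = 1"
    and \<Lambda>: "clinear \<Lambda>" "\<And>x. cmod (\<Lambda> x) \<le> norm x"
    and lim: "((\<lambda>t. \<Lambda> (apply_hlip0 \<phi> (of_real t *\<^sub>C y0))) \<longlongrightarrow> 1) (at_left 1)"
  shows "fixes_copy_of_linfty (comp_hlip0 \<phi>)"
proof -
  define h where "h z = \<Lambda> (apply_hlip0 \<phi> (z *\<^sub>C y0))" for z
  have y_ball: "z *\<^sub>C y0 \<in> ball 0 1" if "z \<in> ball 0 1" for z
    using that y0 by (simp add: norm_scaleC)
  have \<phi>_ball: "apply_hlip0 \<phi> (z *\<^sub>C y0) \<in> ball 0 1" if "z \<in> ball 0 1" for z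
    using y_ball[OF that] \<phi> by blast
  have h_hol: "h holomorphic_on ball 0 1" and h0: "h 0 = 0"
    and h_lt: "\<And>z. z \<in> ball 0 1 \<Longrightarrow> cmod (h z) < 1"
    using functional_along_line[OF \<phi> y0 \<Lambda>] unfolding h_def by blast+
  define Z where "Z = {z \<in> ball 0 1. 1 / 2 \<le> cmod (deriv h z)}"
  have peak: "1 \<in> closure (h ` Z)"
    unfolding Z_def using h_hol h0 h_lt
    by (rule closure_steep_values) (use lim in \<open>simp_all add: h_def\<close>)
  have "h ` Z \<subseteq> ball 0 1" using h_lt by (auto simp: Z_def)
  then obtain E :: "linfty \<Rightarrow> complex \<Rightarrow> complex" and C where E: "0 \<le> C"
    "\<And>a b z. z \<in> ball 0 1 \<Longrightarrow> E (a + b) z = E a z + E b z"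
    "\<And>c a z. z \<in> ball 0 1 \<Longrightarrow> E (c *\<^sub>C a) z = c * E a z"
    "\<And>a z. z \<in> ball 0 1 \<Longrightarrow> cmod (E a z) \<le> C * norm a"
    "\<And>a. E a holomorphic_on ball 0 1"
    "\<And>a. \<exists>w\<in>h ` Z. norm a / 16 \<le> cmod (E a w)"
    by (rule bounded_sequence_interpolation[OF _ peak]) blast
  define P where "P a z = contour_integral (linepath 0 z) (E a)" for a z
  have P_deriv: "(P a has_field_derivative E a z) (at z)" if "z \<in> ball 0 1" for a z
    unfolding P_def using disc_primitive[OF E(5) that] .
  have "\<exists>F :: ('x, complex) hlip0. (\<forall>x\<in>ball 0 1. apply_hlip0 F x = P a (\<Lambda> x)) \<and> norm F \<le> C * norm a" for a
  proof -
    have "P a 0 = 0" by (simp add: P_def)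
    show ?thesis
      by (rule hlip0_of_functional[OF \<Lambda> P_deriv[of _ a] \<open>P a 0 = 0\<close> E(4)[of _ a]])
  qed
  then obtain J :: "linfty \<Rightarrow> ('x, complex) hlip0"
    where J: "\<And>a x. x \<in> ball 0 1 \<Longrightarrow> apply_hlip0 (J a) x = P a (\<Lambda> x)" "\<And>a. norm (J a) \<le> C * norm a"
    by metis
  have \<Lambda>_ball: "\<Lambda> x \<in> ball 0 1" if "norm x < 1" for x
    using that \<Lambda>(2)[of x] by simp
  have P_add: "P (a + b) z = P a z + P b z" if "z \<in> ball 0 1" for a b z
  proof -
    have "P (a + b) z = contour_integral (linepath 0 z) (\<lambda>w. E a w + E b w)"
      unfolding P_def using that E(2) by (rule contour_integral_cong_disc)
    also have "\<dots> = P a z + P b z"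
      unfolding P_def by (intro contour_integral_add contour_integrable_in_disc E(5) that)
    finally show ?thesis .
  qed
  have P_scale: "P (c *\<^sub>C a) z = c * P a z" if "z \<in> ball 0 1" for c a z
  proof -
    have "P (c *\<^sub>C a) z = contour_integral (linepath 0 z) (\<lambda>w. c * E a w)"
      unfolding P_def using that E(3) by (rule contour_integral_cong_disc)
    also have "\<dots> = c * P a z"
      unfolding P_def by (intro contour_integral_lmul contour_integrable_in_disc E(5) that)
    finally show ?thesis .
  qed
  have J_lin: "clinear J"
  proof (rule clinearI)
    show "J (a + b) = J a + J b" for a b
    proof (rule apply_hlip0_eqI)
      fix x :: 'x assume "norm x < 1"
      then have "x \<in> ball 0 1" "\<Lambda> x \<in> ball 0 1" using \<Lambda>_ball by simp_all
      then show "apply_hlip0 (J (a + b)) x = apply_hlip0 (J a + J b) x"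
        by (simp only: plus_hlip0.rep_eq J(1) P_add)
    qed
    show "J (c *\<^sub>C a) = c *\<^sub>C J a" for c a
    proof (rule apply_hlip0_eqI)
      fix x :: 'x assume "norm x < 1"
      then have "x \<in> ball 0 1" "\<Lambda> x \<in> ball 0 1" using \<Lambda>_ball by simp_all
      then show "apply_hlip0 (J (c *\<^sub>C a)) x = apply_hlip0 (c *\<^sub>C J a) x"
        by (simp only: scaleC_hlip0.rep_eq scaleC_complex_def J(1) P_scale)
    qed
  qed
  have below: "1 / 32 * norm a \<le> norm (comp_hlip0 \<phi> (J a))" for a
  proof -
    let ?f = "comp_hlip0 \<phi> (J a)"
    obtain z where z: "z \<in> ball 0 1" "1 / 2 \<le> cmod (deriv h z)" "norm a / 16 \<le> cmod (E a (h z))"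
      using E(6)[of a] by (auto simp: Z_def)
    have y: "z *\<^sub>C y0 \<in> ball 0 1" using y_ball[OF z(1)] .
    obtain D where D: "clinear D" "(apply_hlip0 ?f has_derivative D) (at (0 + z *\<^sub>C y0))"
      using holomorphic_map_onE[OF holomorphic_apply_hlip0[of ?f] y] by auto
    have "((\<lambda>z. apply_hlip0 ?f (0 + z *\<^sub>C y0)) has_field_derivative D y0) (at z)"
      by (rule has_field_derivative_along_line[OF D(2,1)])
    moreover have "((\<lambda>z. apply_hlip0 ?f (0 + z *\<^sub>C y0)) has_field_derivative E a (h z) * deriv h z) (at z)"
    proof (rule has_field_derivative_transform_within_open[OF _ open_ball z(1)])
      have "h z \<in> ball 0 1" using h_lt[OF z(1)] by simp
      then show "((\<lambda>z. P a (h z)) has_field_derivative E a (h z) * deriv h z) (at z)"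
        using DERIV_chain2[OF P_deriv holomorphic_derivI[OF h_hol open_ball z(1)]] by simp
      show "P a (h w) = apply_hlip0 ?f (0 + w *\<^sub>C y0)" if "w \<in> ball 0 1" for w
        using apply_comp_hlip0[OF \<phi> y_ball[OF that], of "J a"] J(1)[OF \<phi>_ball[OF that], of a]
        by (simp add: h_def)
    qed
    ultimately have "D y0 = E a (h z) * deriv h z" by (rule DERIV_unique)
    moreover have "norm (D y0) \<le> norm ?f * norm y0"
      using D(2) by (intro norm_derivative_le_lipschitz[OF _ open_ball y])
        (use norm_apply_hlip0_diff_le[OF _ y] in auto)
    moreover have "norm a / 16 * (1 / 2) \<le> cmod (E a (h z)) * cmod (deriv h z)"
      using z by (intro mult_mono) auto
    ultimately show ?thesis using y0 by (simp add: norm_mult)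
  qed
  show ?thesis
  proof (rule fixes_copy_of_linftyI[OF clinear_comp_hlip0 _ _ J_lin J(2) E(1) below])
    show "norm (comp_hlip0 \<phi> f) \<le> (norm \<phi> + 1) * norm f" for f
      using norm_comp_hlip0_le[OF \<phi>, of f] by (simp add: distrib_right add_increasing2)
  qed (auto intro: add_nonneg_pos)
qed


section \<open>Consequences of compactness on Lipschitz functions\<close>

text \<open>
  On a fixed copy, the images of suitably scaled unit vectors of \<open>\<ell>\<^sub>\<infinity>\<close> would stay uniformly
  separated inside a relatively compact set.
\<close>

lemma compact_operator_not_fixes_linfty:
  fixes T :: "'a::complex_normed_vector \<Rightarrow> 'b::complex_normed_vector"
  assumes "compact_operator T"
  shows "\<not> fixes_copy_of_linfty T"
proof
  assume "fixes_copy_of_linfty T"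
  then obtain G J J' S where J: "clinear J" "homeomorphism (UNIV :: linfty set) G J J'"
    and S: "homeomorphism G (T ` G) T S"
    unfolding fixes_copy_of_linfty_def by blast
  have T: "clinear T" "compact (closure (T ` ball 0 1))"
    using assms by (simp_all add: compact_operator_def)
  have JG: "J a \<in> G" and J'J: "J' (J a) = a" for a
    using J(2) by (auto simp: homeomorphism_def)
  have ST: "S (T x) = x" if "x \<in> G" for x
    using S that by (auto simp: homeomorphism_def)
  have J0: "J 0 = 0" and T0: "T 0 = 0"
    using clinear_diff[OF J(1), of 0 0] clinear_diff[OF T(1), of 0 0] by simp_all
  have "continuous_on (T ` G) (\<lambda>z. J' (S z))"
  proof (rule continuous_on_compose2[where g = J'])
    show "continuous_on G J'" using J(2) by (simp add: homeomorphism_def)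
    show "continuous_on (T ` G) S" "S ` T ` G \<subseteq> G" using S by (simp_all add: homeomorphism_def)
  qed
  moreover have "T (J 0) \<in> T ` G" using JG by blast
  ultimately obtain \<delta> where \<delta>: "0 < \<delta>" "\<And>z. z \<in> T ` G \<Longrightarrow> dist z (T (J 0)) < \<delta> \<Longrightarrow>
      dist (J' (S z)) (J' (S (T (J 0)))) < 1"
    unfolding continuous_on_iff by (meson zero_less_one)
  have lower: "\<delta> \<le> norm (T (J a))" if "1 \<le> norm a" for a
  proof (rule ccontr)
    assume "\<not> \<delta> \<le> norm (T (J a))"
    then have "dist (T (J a)) (T (J 0)) < \<delta>" by (simp add: J0 T0)
    then have "dist (J' (S (T (J a)))) (J' (S (T (J 0)))) < 1"
      using JG by (intro \<delta>(2)) auto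
    then have "dist a 0 < 1" by (simp only: ST[OF JG] J'J)
    with that show False by simp
  qed
  have "continuous_on UNIV J" using J(2) by (simp add: homeomorphism_def)
  then obtain \<eta> where "0 < \<eta>" "\<And>a. dist a 0 < \<eta> \<Longrightarrow> dist (J a) (J 0) < 1"
    unfolding continuous_on_iff by (metis UNIV_I zero_less_one)
  then have \<eta>: "0 < \<eta>" "\<And>a. norm a < \<eta> \<Longrightarrow> norm (J a) < 1" by (simp_all add: J0)
  define e :: "nat \<Rightarrow> linfty" where "e n = Bcontfun (\<lambda>k. if k = n then 1 else 0)" for n
  have e: "apply_bcontfun (e n) k = (if k = n then 1 else 0)" for n k
  proof -
    have "(\<lambda>k. if k = n then 1 else 0 :: complex) \<in> bcontfun"
      by (auto simp: bcontfun_def bounded_iff intro!: exI[of _ 1])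
    then show ?thesis by (simp add: e_def Bcontfun_inverse)
  qed
  have norm_e: "norm (e n) \<le> 1" for n
    by (rule norm_bound) (simp add: e)
  have e_sep: "1 \<le> norm (e m - e n)" if "m \<noteq> n" for m n
    using norm_bounded[of "e m - e n" m] that by (simp add: e)
  define c where "c = complex_of_real (\<eta> / 2)"
  have c: "cmod c = \<eta> / 2" using \<eta>(1) by (simp add: c_def)
  define x where "x n = T (J (c *\<^sub>C e n))" for n
  have "x n \<in> closure (T ` ball 0 1)" for n
  proof -
    have "\<eta> / 2 * norm (e n) \<le> \<eta> / 2 * 1"
      using norm_e[of n] \<eta>(1) by (intro mult_left_mono) auto
    then have "norm (J (c *\<^sub>C e n)) < 1"
      using \<eta>(1) by (intro \<eta>(2)) (simp add: norm_scaleC c)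
    then show ?thesis unfolding x_def using closure_subset by fastforce
  qed
  then obtain l r where r: "strict_mono r" "(x \<circ> r) \<longlonglongrightarrow> l"
    using T(2) unfolding compact_def by metis
  have sep: "\<delta> * \<eta> / 2 \<le> dist (x m) (x n)" if "m \<noteq> n" for m n
  proof -
    have "x m - x n = c *\<^sub>C T (J (e m - e n))"
      using J(1) T(1) clinear_diff[OF J(1)] clinear_diff[OF T(1)]
      by (simp add: x_def clinear_iff complex_vector.scale_right_diff_distrib)
    then show ?thesis
      using lower[OF e_sep[OF that]] \<eta>(1) by (simp add: dist_norm norm_scaleC c field_simps)
  qed
  have "Cauchy (x \<circ> r)" using r(2) by (rule LIMSEQ_imp_Cauchy)
  moreover have "0 < \<delta> * \<eta> / 2" using \<delta>(1) \<eta>(1) by simp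
  ultimately obtain N where "\<And>m n. N \<le> m \<Longrightarrow> N \<le> n \<Longrightarrow> dist (x (r m)) (x (r n)) < \<delta> * \<eta> / 2"
    unfolding Cauchy_def by (metis comp_apply)
  then have "dist (x (r N)) (x (r (Suc N))) < \<delta> * \<eta> / 2" by simp
  moreover have "r N \<noteq> r (Suc N)" using strict_mono_eq[OF r(1)] by simp
  ultimately show False using sep by (meson not_less)
qed

lemma norm_apply_hlip0_le_norm:
  assumes "x \<in> ball 0 1"
  shows "norm (apply_hlip0 f x) \<le> norm f"
proof -
  have "norm f * norm x \<le> norm f * 1" using assms by (intro mult_left_mono) auto
  then show ?thesis using norm_apply_hlip0_le[OF assms, of f] by simp
qed

text \<open>
  The distance of \<open>\<phi> y\<close> and \<open>\<phi> y'\<close> is attained by some functional \<open>\<Lambda>\<close> of norm at most one.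
  All functions \<open>\<Lambda> \<circ> \<phi> / 2\<close> lie in the image of the open unit ball, hence near one of finitely
  many functions; points on which these finitely many functions almost agree are close.
\<close>

lemma compact_comp_hlip0_imp_compact_range:
  fixes \<phi> :: "('y::complex_normed_vector, 'x::complex_banach) hlip0"
  assumes \<phi>: "apply_hlip0 \<phi> ` ball 0 1 \<subseteq> ball 0 1"
    and C: "compact_operator (comp_hlip0 \<phi>)"
  shows "compact (closure (apply_hlip0 \<phi> ` ball 0 1))"
proof (rule compact_closure_if_finite_nets[OF complete_UNIV])
  fix e :: real assume e: "0 < e"
  have "compact (closure (comp_hlip0 \<phi> ` ball 0 1))"
    using C by (simp add: compact_operator_def)
  from compact_closure_imp_finite_net[OF this, of "e / 8"] e
  obtain F where F: "finite F" "\<And>f. f \<in> comp_hlip0 \<phi> ` ball 0 1 \<Longrightarrow> \<exists>g\<in>F. dist f g < e / 8"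
    by (metis zero_less_divide_iff zero_less_numeral)
  have "compact (closure (apply_hlip0 g ` ball 0 1))" for g :: "('y, complex) hlip0"
    by (rule compact_closure_bounded_range) (rule norm_apply_hlip0_le_norm)
  then obtain Y where Y: "finite Y" "Y \<subseteq> ball 0 1"
    "\<And>y. y \<in> ball 0 1 \<Longrightarrow> \<exists>y'\<in>Y. \<forall>g\<in>F. dist (apply_hlip0 g y) (apply_hlip0 g y') < e / 8"
    using finite_common_net[OF F(1), where d = apply_hlip0 and A = "ball 0 1" and e = "e / 8"] e
    by auto
  have "\<exists>y'\<in>Y. dist (apply_hlip0 \<phi> y) (apply_hlip0 \<phi> y') < e" if y: "y \<in> ball 0 1" for y
  proof -
    obtain y' where y': "y' \<in> Y" "\<And>g. g \<in> F \<Longrightarrow> dist (apply_hlip0 g y) (apply_hlip0 g y') < e / 8"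
      using Y(3)[OF y] by blast
    have y'_ball: "y' \<in> ball 0 1" using y'(1) Y(2) by blast
    obtain \<Lambda> :: "'x \<Rightarrow> complex" where \<Lambda>: "clinear \<Lambda>" "\<And>x. cmod (\<Lambda> x) \<le> norm x"
      "\<Lambda> (apply_hlip0 \<phi> y - apply_hlip0 \<phi> y') = of_real (norm (apply_hlip0 \<phi> y - apply_hlip0 \<phi> y'))"
      using exists_norming_functional by blast
    \<comment> \<open>halving \<open>\<Lambda>\<close> places it in the open unit ball\<close>
    have "\<exists>L :: ('x, complex) hlip0. (\<forall>x\<in>ball 0 1. apply_hlip0 L x = \<Lambda> x / 2) \<and> norm L \<le> 1 / 2"
      by (rule hlip0_of_functional[OF \<Lambda>(1,2), of "\<lambda>z. z / 2" "\<lambda>_. 1 / 2"])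
         (auto intro!: derivative_eq_intros)
    then obtain L :: "('x, complex) hlip0"
      where L: "\<And>x. x \<in> ball 0 1 \<Longrightarrow> apply_hlip0 L x = \<Lambda> x / 2" "norm L \<le> 1 / 2" by blast
    let ?f = "comp_hlip0 \<phi> L"
    have f: "apply_hlip0 ?f z = \<Lambda> (apply_hlip0 \<phi> z) / 2" if z: "z \<in> ball 0 1" for z
    proof -
      have "apply_hlip0 \<phi> z \<in> ball 0 1" using \<phi> z by blast
      then show ?thesis using L(1) apply_comp_hlip0[OF \<phi> z] by simp
    qed
    have "?f \<in> comp_hlip0 \<phi> ` ball 0 1" using L(2) by simp
    then obtain g where g: "g \<in> F" "dist ?f g < e / 8" using F(2) by blast
    have close: "dist (apply_hlip0 ?f z) (apply_hlip0 g z) < e / 8" if z: "z \<in> ball 0 1" for z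
      using norm_apply_hlip0_le_norm[OF z, of "?f - g"] g(2)
      by (simp add: dist_norm apply_hlip0_diff)
    have "dist (apply_hlip0 ?f y) (apply_hlip0 ?f y') < 3 * (e / 8)"
      using close[OF y] close[OF y'_ball] y'(2)[OF g(1)]
        dist_triangle[of "apply_hlip0 ?f y" "apply_hlip0 ?f y'" "apply_hlip0 g y"]
        dist_triangle[of "apply_hlip0 g y" "apply_hlip0 ?f y'" "apply_hlip0 g y'"]
        dist_commute[of "apply_hlip0 ?f y'" "apply_hlip0 g y'"]
      by linarith
    moreover have "dist (apply_hlip0 ?f y) (apply_hlip0 ?f y')
        = dist (apply_hlip0 \<phi> y) (apply_hlip0 \<phi> y') / 2"
    proof -
      have "apply_hlip0 ?f y - apply_hlip0 ?f y' = of_real (norm (apply_hlip0 \<phi> y - apply_hlip0 \<phi> y')) / 2"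
        using \<Lambda>(3) clinear_diff[OF \<Lambda>(1)] f[OF y] f[OF y'_ball]
        by (metis diff_divide_distrib)
      then have "cmod (apply_hlip0 ?f y - apply_hlip0 ?f y')
          = cmod (of_real (norm (apply_hlip0 \<phi> y - apply_hlip0 \<phi> y')) / 2)" by (rule arg_cong)
      also have "\<dots> = norm (apply_hlip0 \<phi> y - apply_hlip0 \<phi> y') / 2" by (simp add: norm_divide)
      finally show ?thesis by (simp only: dist_norm)
    qed
    ultimately show ?thesis using y'(1) e by (intro bexI[of _ y']) auto
  qed
  then show "\<exists>K. finite K \<and> (\<forall>x\<in>apply_hlip0 \<phi> ` ball 0 1. \<exists>x'\<in>K. dist x x' < e)"
    using Y(1) by (intro exI[of _ "apply_hlip0 \<phi> ` Y"]) auto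
qed


section \<open>Norm decrease when no copy is fixed\<close>

text \<open>
  Along the line through \<open>y\<close> the function \<open>\<Lambda> \<circ> \<phi>\<close> tends to \<open>1\<close>: for \<open>y\<close> in the open ball it is
  the identity of the disc, being the case of equality in the Schwarz lemma, and for \<open>y\<close> on the
  sphere the limit is \<open>\<Lambda>\<close> of the extension at \<open>y\<close>.
\<close>

lemma fixes_copy_if_norm_not_decreasing:
  fixes \<phi> :: "('y::complex_normed_vector, 'x::complex_banach) hlip0"
  assumes \<phi>: "apply_hlip0 \<phi> ` ball 0 1 \<subseteq> ball 0 1"
    and y: "y \<in> cball 0 1" "y \<noteq> 0" "norm y \<le> norm (closed_ball_ext \<phi> y)"
  shows "fixes_copy_of_linfty (comp_hlip0 \<phi>)"
proof -
  obtain \<Lambda> :: "'x \<Rightarrow> complex" where \<Lambda>: "clinear \<Lambda>" "\<And>x. cmod (\<Lambda> x) \<le> norm x"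
    "\<Lambda> (closed_ball_ext \<phi> y) = of_real (norm (closed_ball_ext \<phi> y))"
    using exists_norming_functional by blast
  define u where "u = of_real (1 / norm y) *\<^sub>C y"
  have u: "norm u = 1" "of_real (norm y) *\<^sub>C u = y"
    using y(2) by (simp_all add: u_def norm_scaleC norm_divide flip: of_real_mult)
  let ?h = "\<lambda>z. \<Lambda> (apply_hlip0 \<phi> (z *\<^sub>C u))"
  have "((\<lambda>t. ?h (of_real t)) \<longlongrightarrow> 1) (at_left 1)"
  proof (cases "norm y < 1")
    case True
    have y_ball: "y \<in> ball 0 1" using True by simp
    have ext: "closed_ball_ext \<phi> y = apply_hlip0 \<phi> y"
      using closed_ball_ext(2)[OF y_ball] .
    note hol = functional_along_line(1)[OF \<phi> u(1) \<Lambda>(1,2)]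
    note h0 = functional_along_line(2)[OF \<phi> u(1) \<Lambda>(1,2)]
    have h_lt: "cmod (?h z) < 1" if "cmod z < 1" for z
      using functional_along_line(3)[OF \<phi> u(1) \<Lambda>(1,2), of z] that by simp
    have hy: "?h (of_real (norm y)) = of_real (norm (apply_hlip0 \<phi> y))"
      using \<Lambda>(3) u(2) ext by simp
    have "cmod (?h (of_real (norm y))) \<le> norm y"
      using Schwarz_Lemma(1)[OF hol h0 h_lt, of "of_real (norm y)"] True by simp
    then have eq: "norm (apply_hlip0 \<phi> y) = norm y"
      using y(3) hy ext by simp
    have "\<exists>\<alpha>. (\<forall>z. cmod z < 1 \<longrightarrow> ?h z = \<alpha> * z) \<and> cmod \<alpha> = 1"
    proof (rule Schwarz_Lemma(3)[OF hol h0 h_lt, of 0])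
      show "(\<exists>z. cmod z < 1 \<and> z \<noteq> 0 \<and> cmod (?h z) = cmod z) \<or> cmod (deriv ?h 0) = 1"
        using True y(2) hy eq by (intro disjI1 exI[of _ "of_real (norm y)"]) simp
    qed simp_all
    then obtain \<alpha> where \<alpha>: "\<And>z. cmod z < 1 \<Longrightarrow> ?h z = \<alpha> * z" by blast
    have "\<alpha> * of_real (norm y) = of_real (norm y)"
      using \<alpha>[of "of_real (norm y)"] hy eq True by simp
    then have "\<alpha> = 1" using y(2) by simp
    have "\<forall>\<^sub>F t in at_left 1. ?h (of_real t) = of_real t"
      using \<alpha> \<open>\<alpha> = 1\<close> by (auto simp: eventually_at_left_field intro!: exI[of _ 0])
    moreover have "((\<lambda>t. complex_of_real t) \<longlongrightarrow> of_real 1) (at_left 1)"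
      by (intro tendsto_intros)
    ultimately show ?thesis by (simp add: tendsto_cong)
  next
    case False
    then have ny: "norm y = 1" using y(1) by simp
    then have uy: "u = y" using u(2) by simp
    obtain C where C: "C-lipschitz_on (cball 0 1) (closed_ball_ext \<phi>)"
      using closed_ball_ext(1) by blast
    have lim_y: "((\<lambda>t. complex_of_real t *\<^sub>C y) \<longlongrightarrow> of_real 1 *\<^sub>C y) (at_left 1)"
      by (intro bounded_linear.tendsto[OF bounded_linear_scaleC_left] tendsto_intros)
    have ev: "\<forall>\<^sub>F t in at_left 1. complex_of_real t *\<^sub>C y \<in> ball 0 1"
      using ny by (auto simp: eventually_at_left_field norm_scaleC intro!: exI[of _ 0])
    then have "\<forall>\<^sub>F t in at_left 1. complex_of_real t *\<^sub>C y \<in> cball 0 1"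
      by eventually_elim simp
    with lim_y have "((\<lambda>t. closed_ball_ext \<phi> (complex_of_real t *\<^sub>C y)) \<longlongrightarrow> closed_ball_ext \<phi> y) (at_left 1)"
      using continuous_on_tendsto_compose[OF lipschitz_on_continuous_on[OF C], of _ y] y(1) by simp
    moreover have "\<forall>\<^sub>F t in at_left 1.
        closed_ball_ext \<phi> (complex_of_real t *\<^sub>C y) = apply_hlip0 \<phi> (complex_of_real t *\<^sub>C y)"
      using ev by eventually_elim (rule closed_ball_ext(2))
    ultimately have lim_\<phi>: "((\<lambda>t. apply_hlip0 \<phi> (complex_of_real t *\<^sub>C y)) \<longlongrightarrow> closed_ball_ext \<phi> y) (at_left 1)"
      by (simp add: tendsto_cong)
    have "norm (closed_ball_ext \<phi> y) \<le> 1"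
    proof (rule tendsto_upperbound[OF tendsto_norm[OF lim_\<phi>]])
      show "\<forall>\<^sub>F t in at_left 1. norm (apply_hlip0 \<phi> (complex_of_real t *\<^sub>C y)) \<le> 1"
        using ev by eventually_elim (use \<phi> in force)
    qed simp
    then have n1: "norm (closed_ball_ext \<phi> y) = 1" using y(3) ny by simp
    have "((\<lambda>t. \<Lambda> (apply_hlip0 \<phi> (complex_of_real t *\<^sub>C y))) \<longlongrightarrow> \<Lambda> (closed_ball_ext \<phi> y)) (at_left 1)"
    proof (rule metric_tendsto_imp_tendsto[OF lim_\<phi>])
      show "\<forall>\<^sub>F t in at_left 1. dist (\<Lambda> (apply_hlip0 \<phi> (complex_of_real t *\<^sub>C y))) (\<Lambda> (closed_ball_ext \<phi> y))
          \<le> dist (apply_hlip0 \<phi> (complex_of_real t *\<^sub>C y)) (closed_ball_ext \<phi> y)"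
        using \<Lambda>(2) by (intro always_eventually allI) (simp add: dist_norm flip: clinear_diff[OF \<Lambda>(1)])
    qed
    then show ?thesis using \<Lambda>(3) n1 uy by simp
  qed
  then show ?thesis
    using fixes_copy_if_functional_peaks[OF \<phi> u(1) \<Lambda>(1,2)] by blast
qed


section \<open>Compactness on bounded holomorphic functions\<close>

text \<open>
  The norm of the extension attains its maximum on the compact closed ball, at a point where it is
  less than \<open>1\<close>.
\<close>

lemma norm_ext_bounded_away:
  fixes \<phi> :: "('y::complex_normed_vector, 'x::complex_banach) hlip0"
  assumes Y: "finite_dimensional (UNIV :: 'y set)"
    and dec: "\<And>y. y \<in> cball 0 1 - {0} \<Longrightarrow> norm (closed_ball_ext \<phi> y) < norm y"
  obtains \<rho> where "\<rho> < 1" "\<And>y. y \<in> ball 0 1 \<Longrightarrow> norm (apply_hlip0 \<phi> y) \<le> \<rho>"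
proof -
  obtain C where C: "C-lipschitz_on (cball 0 1) (closed_ball_ext \<phi>)"
    using closed_ball_ext(1) by blast
  have "continuous_on (cball 0 1) (\<lambda>y. norm (closed_ball_ext \<phi> y))"
    using lipschitz_on_continuous_on[OF C] by (rule continuous_on_norm)
  then obtain y0 where y0: "y0 \<in> cball 0 1"
    "\<And>y. y \<in> cball 0 1 \<Longrightarrow> norm (closed_ball_ext \<phi> y) \<le> norm (closed_ball_ext \<phi> y0)"
    using continuous_attains_sup[OF compact_cball_finite_dimensional[OF Y, of 1]]
    by (metis cball_eq_empty not_less zero_le_one less_le_not_le)
  show thesis
  proof
    show "norm (closed_ball_ext \<phi> y0) < 1"
    proof (cases "y0 = 0")
      case True
      then show ?thesis using closed_ball_ext(2)[of 0 \<phi>] by simp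
    next
      case False
      then show ?thesis using dec[of y0] y0(1) by simp
    qed
    show "norm (apply_hlip0 \<phi> y) \<le> norm (closed_ball_ext \<phi> y0)" if "y \<in> ball 0 1" for y
      using y0(2)[of y] closed_ball_ext(2)[OF that, of \<phi>] that by simp
  qed
qed

text \<open>
  The Cauchy estimate on balls of radius \<open>1 - r\<close> bounds the derivative on the smaller ball.
\<close>

lemma bounded_holomorphic_lipschitz:
  fixes f :: "'a::complex_normed_vector hinf"
  assumes r: "r < 1" and xy: "x \<in> cball 0 r" "y \<in> cball 0 r"
  shows "cmod (apply_hinf f x - apply_hinf f y) \<le> 2 * norm f / (1 - r) * norm (x - y)"
proof -
  have sub: "ball z (1 - r) \<subseteq> ball 0 1" if "z \<in> cball 0 r" for z :: 'a
  proof
    fix w assume "w \<in> ball z (1 - r)"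
    then show "w \<in> ball 0 1"
      using that norm_triangle_ineq2[of w z] by (simp add: dist_norm norm_minus_commute)
  qed
  have "\<forall>z. \<exists>D. z \<in> cball 0 r \<longrightarrow> clinear D \<and> (apply_hinf f has_derivative D) (at z)"
  proof
    fix z :: 'a
    show "\<exists>D. z \<in> cball 0 r \<longrightarrow> clinear D \<and> (apply_hinf f has_derivative D) (at z)"
      using holomorphic_apply_hinf[of f] r unfolding holomorphic_map_on_def by (cases "norm z \<le> r") auto
  qed
  then obtain D where D: "\<And>z. z \<in> cball 0 r \<Longrightarrow> clinear (D z)"
    "\<And>z. z \<in> cball 0 r \<Longrightarrow> (apply_hinf f has_derivative D z) (at z)"
    unfolding choice_iff by blast
  show ?thesis
  proof (rule differentiable_bound[OF convex_cball _ _ xy])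
    fix z :: 'a assume z: "z \<in> cball 0 r"
    show "(apply_hinf f has_derivative D z) (at z within cball 0 r)"
      using D(2)[OF z] by (rule has_derivative_at_withinI)
    show "onorm (D z) \<le> 2 * norm f / (1 - r)"
    proof (rule onorm_bound)
      show "norm (D z h) \<le> 2 * norm f / (1 - r) * norm h" for h
      proof (rule Cauchy_estimate[OF _ _ _ D(2,1)[OF z]])
        show "holomorphic_map_on (ball z (1 - r)) (apply_hinf f)"
          using holomorphic_apply_hinf[of f] sub[OF z] unfolding holomorphic_map_on_def by blast
        show "cmod (apply_hinf f w) \<le> norm f" if "w \<in> ball z (1 - r)" for w
          using sub[OF z] that by (intro norm_apply_hinf_le) blast
      qed (use r in simp)
    qed (use r in simp)
  qed
qed

text \<open>
  The functions in the unit ball are equi-Lipschitz on the ball of radius \<open>\<rho>\<close>, so their values at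
  finitely many points of the range of \<open>\<phi>\<close> determine \<open>f \<circ> \<phi>\<close> uniformly up to a small error.
\<close>

lemma compact_comp_hinf_if_range_inside:
  fixes \<phi> :: "('y::complex_normed_vector, 'x::complex_normed_vector) hlip0"
  assumes \<phi>: "apply_hlip0 \<phi> ` ball 0 1 \<subseteq> ball 0 1"
    and comp: "compact (closure (apply_hlip0 \<phi> ` ball 0 1))"
    and \<rho>: "\<rho> < 1" "\<And>y. y \<in> ball 0 1 \<Longrightarrow> norm (apply_hlip0 \<phi> y) \<le> \<rho>"
  shows "compact_operator (comp_hinf \<phi>)"
  unfolding compact_operator_def
proof (intro conjI clinear_comp_hinf compact_closure_if_finite_nets[OF complete_hinf])
  fix e :: real assume e: "0 < e"
  \<comment> \<open>points at distance \<open>\<delta>\<close> then have values differing by at most \<open>e / 4\<close>\<close>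
  define \<delta> where "\<delta> = e / 8 * (1 - \<rho>)"
  have \<delta>: "0 < \<delta>" using e \<rho>(1) by (simp add: \<delta>_def)
  obtain P where P: "finite P" "P \<subseteq> apply_hlip0 \<phi> ` ball 0 1"
    "\<And>x. x \<in> apply_hlip0 \<phi> ` ball 0 1 \<Longrightarrow> \<exists>p\<in>P. dist x p < \<delta>"
    using compact_closure_imp_finite_net[OF comp \<delta>] by blast
  have cl: "compact (closure ((\<lambda>f. apply_hinf f p) ` ball (0 :: 'x hinf) 1))" if "p \<in> P" for p
  proof (rule compact_closure_bounded_range)
    fix f :: "'x hinf" assume "f \<in> ball 0 1"
    moreover have "p \<in> ball 0 1" using that P(2) \<phi> by blast
    ultimately show "cmod (apply_hinf f p) \<le> 1" using norm_apply_hinf_le[of p f] by simp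
  qed
  obtain F where F: "finite F" "F \<subseteq> ball (0 :: 'x hinf) 1"
    "\<And>f. f \<in> ball 0 1 \<Longrightarrow> \<exists>g\<in>F. \<forall>p\<in>P. dist (apply_hinf f p) (apply_hinf g p) < e / 4"
    using finite_common_net[OF P(1), where d = "\<lambda>p f. apply_hinf f p" and A = "ball 0 1" and e = "e / 4"]
      cl e by auto
  have "\<exists>g\<in>F. dist (comp_hinf \<phi> f) (comp_hinf \<phi> g) < e" if f: "f \<in> ball 0 1" for f
  proof -
    obtain g where g: "g \<in> F" "\<And>p. p \<in> P \<Longrightarrow> dist (apply_hinf f p) (apply_hinf g p) < e / 4"
      using F(3)[OF f] by blast
    have near: "cmod (apply_hinf k x - apply_hinf k p) \<le> e / 4"
      if k: "k \<in> ball 0 1" and xp: "x \<in> cball 0 \<rho>" "p \<in> cball 0 \<rho>" "dist x p < \<delta>" for k :: "'x hinf" and x p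
    proof -
      have "2 * norm k / (1 - \<rho>) * norm (x - p) \<le> 2 * 1 / (1 - \<rho>) * \<delta>"
        using k xp(3) \<rho>(1) by (intro mult_mono divide_right_mono) (auto simp: dist_norm)
      also have "\<dots> = e / 4" using \<rho>(1) by (simp add: \<delta>_def)
      finally show ?thesis
        using bounded_holomorphic_lipschitz[OF \<rho>(1) xp(1,2), of k] by simp
    qed
    have "norm (comp_hinf \<phi> f - comp_hinf \<phi> g) \<le> 3 * e / 4"
    proof (rule norm_hinf_le)
      fix y :: 'y assume y: "y \<in> ball 0 1"
      let ?x = "apply_hlip0 \<phi> y"
      obtain p where p: "p \<in> P" "dist ?x p < \<delta>" using P(3) y by blast
      have "?x \<in> cball 0 \<rho>" "p \<in> cball 0 \<rho>" using \<rho>(2) y p(1) P(2) by auto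
      then have "cmod (apply_hinf f ?x - apply_hinf f p) \<le> e / 4"
        "cmod (apply_hinf g ?x - apply_hinf g p) \<le> e / 4"
        using near f g(1) F(2) p(2) by blast+
      moreover have "cmod (apply_hinf f p - apply_hinf g p) \<le> e / 4"
        using g(2)[OF p(1)] by (simp add: dist_norm)
      moreover have "apply_hinf f ?x - apply_hinf g ?x = (apply_hinf f ?x - apply_hinf f p)
          + (apply_hinf f p - apply_hinf g p) - (apply_hinf g ?x - apply_hinf g p)" by simp
      ultimately have "cmod (apply_hinf f ?x - apply_hinf g ?x) \<le> e / 4 + e / 4 + e / 4"
        by (metis norm_triangle_le norm_triangle_le_diff add_mono)
      then show "cmod (apply_hinf (comp_hinf \<phi> f - comp_hinf \<phi> g) y) \<le> 3 * e / 4"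
        using apply_comp_hinf[OF \<phi> y] by (simp add: apply_hinf_diff)
    qed
    then show ?thesis using g(1) e by (intro bexI[of _ g]) (auto simp: dist_norm)
  qed
  then show "\<exists>K. finite K \<and> (\<forall>x\<in>comp_hinf \<phi> ` ball 0 1. \<exists>x'\<in>K. dist x x' < e)"
    using F(1) by (intro exI[of _ "comp_hinf \<phi> ` F"]) blast
qed


section \<open>From bounded holomorphic functions to Lipschitz functions\<close>

lemma directional_derivative_hinf:
  fixes f :: "('a::complex_normed_vector, complex) hlip0"
  assumes D: "\<And>x. x \<in> ball 0 1 \<Longrightarrow> clinear (D x)"
    "\<And>x. x \<in> ball 0 1 \<Longrightarrow> (apply_hlip0 f has_derivative D x) (at x)"
  shows "\<exists>p :: 'a hinf. (\<forall>x\<in>ball 0 1. apply_hinf p x = D x v) \<and> norm p \<le> norm f * norm v"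
proof -
  let ?p = "\<lambda>x. if x \<in> ball 0 1 then D x v else 0"
  have bound: "cmod (D x v) \<le> norm f * norm v" if "x \<in> ball 0 1" for x
    using norm_derivative_le_lipschitz[OF D(2)[OF that] open_ball that] norm_apply_hlip0_diff_le[OF _ that]
    by blast
  have "holomorphic_map_on (ball 0 1) (\<lambda>x. D x v)"
    by (rule holomorphic_map_on_directional_derivative[OF holomorphic_apply_hlip0 norm_apply_hlip0_le_norm D(2,1)])
  then have "holomorphic_map_on (ball 0 1) ?p"
    by (rule holomorphic_map_on_cong[OF open_ball, rotated]) simp
  moreover have "bounded (?p ` ball 0 1)"
    unfolding bounded_iff using bound by (intro exI[of _ "norm f * norm v"]) simp
  ultimately have p: "apply_hinf (Abs_hinf ?p) = ?p"
    by (intro Abs_hinf_inverse) simp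
  show ?thesis
  proof (intro exI conjI ballI)
    show "apply_hinf (Abs_hinf ?p) x = D x v" if "x \<in> ball 0 1" for x
      using that unfolding p by simp
    show "norm (Abs_hinf ?p) \<le> norm f * norm v"
      by (rule norm_hinf_le) (use bound in \<open>unfold p, simp\<close>)
  qed
qed

text \<open>
  By the chain rule, the Lipschitz constant of \<open>(f - g) \<circ> \<phi>\<close> is at most \<open>norm \<phi>\<close> times the
  supremum of the derivative of \<open>f - g\<close> over the range of \<open>\<phi>\<close>. In coordinates this supremum is
  controlled by the directional derivatives along a finite spanning set \<open>B\<close>; these lie in a
  bounded set of bounded holomorphic functions, so composing them with \<open>\<phi>\<close> admits a common
  finite net.
\<close>

lemma compact_comp_hlip0_if_compact_comp_hinf:
  fixes \<phi> :: "('y::complex_normed_vector, 'x::complex_normed_vector) hlip0"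
  assumes \<phi>: "apply_hlip0 \<phi> ` ball 0 1 \<subseteq> ball 0 1"
    and X: "finite_dimensional (UNIV :: 'x set)"
    and C: "compact_operator (comp_hinf \<phi>)"
  shows "compact_operator (comp_hlip0 \<phi>)"
  unfolding compact_operator_def
proof (intro conjI clinear_comp_hlip0 compact_closure_if_finite_nets[OF complete_hlip0])
  fix e :: real assume e: "0 < e"
  obtain B :: "'x set" and M where B: "finite B" "0 \<le> M"
    "\<And>x. \<exists>c. x = (\<Sum>b\<in>B. c b *\<^sub>C b) \<and> (\<forall>b\<in>B. cmod (c b) \<le> M * norm x)"
    using finite_dimensional_coefficients[OF X] by blast
  have "\<forall>f x. \<exists>D. x \<in> ball 0 1 \<longrightarrow> clinear D \<and> (apply_hlip0 f has_derivative D) (at x)"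
    using holomorphic_apply_hlip0 unfolding holomorphic_map_on_def by blast
  then obtain D :: "('x, complex) hlip0 \<Rightarrow> 'x \<Rightarrow> 'x \<Rightarrow> complex"
    where D: "\<And>f x. x \<in> ball 0 1 \<Longrightarrow> clinear (D f x)"
    "\<And>f x. x \<in> ball 0 1 \<Longrightarrow> (apply_hlip0 f has_derivative D f x) (at x)"
    unfolding choice_iff by blast
  have "\<forall>f v. \<exists>p :: 'x hinf. (\<forall>x\<in>ball 0 1. apply_hinf p x = D f x v) \<and> norm p \<le> norm f * norm v"
    using directional_derivative_hinf[OF D] by blast
  then obtain p :: "('x, complex) hlip0 \<Rightarrow> 'x \<Rightarrow> 'x hinf"
    where p: "\<And>f v x. x \<in> ball 0 1 \<Longrightarrow> apply_hinf (p f v) x = D f x v"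
    "\<And>f v. norm (p f v) \<le> norm f * norm v"
    unfolding choice_iff by blast
  \<comment> \<open>the directional derivatives, rescaled into the open unit ball\<close>
  define q where "q b f = of_real (1 / (norm b + 1)) *\<^sub>C p f b" for b f
  have q_ball: "q b f \<in> ball 0 1" if "f \<in> ball 0 1" for b f
  proof -
    have "norm (p f b) \<le> norm b"
      using p(2)[of f b] that mult_right_mono[of "norm f" 1 "norm b"] by simp
    then have "norm (p f b) < norm b + 1" by simp
    moreover have "norm (q b f) = norm (p f b) / (norm b + 1)"
      by (simp add: q_def norm_scaleC norm_divide flip: of_real_add)
    ultimately show ?thesis by (simp add: divide_less_eq add_nonneg_pos)
  qed
  define K where "K = (\<Sum>b\<in>B. norm b + 1)"
  have K: "0 \<le> K" unfolding K_def by (intro sum_nonneg) simp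
  define \<epsilon> where "\<epsilon> = e / (2 * (M * K * norm \<phi> + 1))"
  have MK: "0 \<le> M * K * norm \<phi>" using B(2) K by simp
  have \<epsilon>: "0 < \<epsilon>" "\<epsilon> * (M * K * norm \<phi>) < e"
  proof -
    show pos: "0 < \<epsilon>" using e MK by (simp add: \<epsilon>_def)
    have "\<epsilon> * (M * K * norm \<phi>) \<le> \<epsilon> * (M * K * norm \<phi> + 1)" using pos by simp
    also have "\<dots> = e / 2" using MK by (simp add: \<epsilon>_def field_simps)
    finally show "\<epsilon> * (M * K * norm \<phi>) < e" using e by simp
  qed
  have cl: "compact (closure ((\<lambda>f. comp_hinf \<phi> (q b f)) ` ball 0 1))" for b
  proof -
    have "closure ((\<lambda>f. comp_hinf \<phi> (q b f)) ` ball 0 1) \<subseteq> closure (comp_hinf \<phi> ` ball 0 1)"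
      using q_ball by (intro closure_mono) blast
    moreover have "compact (closure (comp_hinf \<phi> ` ball 0 1))"
      using C by (simp add: compact_operator_def)
    ultimately show ?thesis
      using compact_Int_closed[OF _ closed_closure] by (metis inf.absorb_iff2)
  qed
  obtain F where F: "finite F" "F \<subseteq> ball (0 :: ('x, complex) hlip0) 1"
    "\<And>f. f \<in> ball 0 1 \<Longrightarrow> \<exists>g\<in>F. \<forall>b\<in>B. dist (comp_hinf \<phi> (q b f)) (comp_hinf \<phi> (q b g)) < \<epsilon>"
    by (rule finite_common_net[OF B(1), where d = "\<lambda>b f. comp_hinf \<phi> (q b f)"
          and A = "ball 0 1" and e = \<epsilon>]) (rule cl, rule \<epsilon>(1), blast)
  have "\<exists>g\<in>F. dist (comp_hlip0 \<phi> f) (comp_hlip0 \<phi> g) < e" if f: "f \<in> ball 0 1" for f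
  proof -
    obtain g where g: "g \<in> F" "\<And>b. b \<in> B \<Longrightarrow> dist (comp_hinf \<phi> (q b f)) (comp_hinf \<phi> (q b g)) < \<epsilon>"
      using F(3)[OF f] by blast
    have diff_b: "cmod (D f (apply_hlip0 \<phi> y) b - D g (apply_hlip0 \<phi> y) b) \<le> \<epsilon> * (norm b + 1)"
      if y: "y \<in> ball 0 1" and b: "b \<in> B" for y b
    proof -
      let ?x = "apply_hlip0 \<phi> y"
      have x: "?x \<in> ball 0 1" using \<phi> y by blast
      have q: "apply_hinf (q b k) ?x = of_real (1 / (norm b + 1)) * D k ?x b" for k
        by (simp add: q_def scaleC_hinf.rep_eq p(1)[OF x])
      have "apply_hinf (q b f) ?x - apply_hinf (q b g) ?x
          = of_real (1 / (norm b + 1)) * (D f ?x b - D g ?x b)"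
        unfolding q by (simp only: right_diff_distrib)
      moreover have "cmod (of_real (1 / (norm b + 1))) = 1 / (norm b + 1)"
        by (simp only: norm_of_real) simp
      moreover have "cmod (apply_hinf (q b f) ?x - apply_hinf (q b g) ?x) < \<epsilon>"
        using norm_apply_hinf_le[OF y, of "comp_hinf \<phi> (q b f) - comp_hinf \<phi> (q b g)"] g(2)[OF b]
        by (simp add: apply_hinf_diff apply_comp_hinf[OF \<phi> y] dist_norm)
      ultimately have "1 / (norm b + 1) * cmod (D f ?x b - D g ?x b) < \<epsilon>"
        by (simp only: norm_mult)
      then show ?thesis by (simp add: divide_less_eq add_nonneg_pos)
    qed
    have diff: "cmod (D f (apply_hlip0 \<phi> y) v - D g (apply_hlip0 \<phi> y) v) \<le> \<epsilon> * (M * K) * norm v"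
      if y: "y \<in> ball 0 1" for y v
    proof -
      let ?x = "apply_hlip0 \<phi> y"
      have x: "?x \<in> ball 0 1" using \<phi> y by blast
      obtain c where c: "v = (\<Sum>b\<in>B. c b *\<^sub>C b)" "\<And>b. b \<in> B \<Longrightarrow> cmod (c b) \<le> M * norm v"
        using B(3) by blast
      have lin: "D k ?x v = (\<Sum>b\<in>B. c b * D k ?x b)" for k
      proof -
        have add: "D k ?x (u + w) = D k ?x u + D k ?x w" for u w
          using D(1)[OF x, of k] by (simp add: clinear_iff)
        have zero: "D k ?x 0 = 0"
          using clinear_diff[OF D(1)[OF x], of k 0 0] by simp
        have "D k ?x (\<Sum>b\<in>B. c b *\<^sub>C b) = (\<Sum>b\<in>B. D k ?x (c b *\<^sub>C b))"
          using B(1) by (induction B rule: finite_induct) (simp_all add: add zero)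
        then show ?thesis
          using clinear_imp_mult[OF D(1)[OF x]] c(1) by simp
      qed
      have "D f ?x v - D g ?x v = (\<Sum>b\<in>B. c b * (D f ?x b - D g ?x b))"
        unfolding lin by (simp add: sum_subtractf right_diff_distrib)
      also have "cmod \<dots> \<le> (\<Sum>b\<in>B. M * norm v * (\<epsilon> * (norm b + 1)))"
      proof (rule sum_norm_le)
        fix b assume b: "b \<in> B"
        show "cmod (c b * (D f ?x b - D g ?x b)) \<le> M * norm v * (\<epsilon> * (norm b + 1))"
          unfolding norm_mult using c(2)[OF b] diff_b[OF y b] B(2)
          by (intro mult_mono) auto
      qed
      also have "\<dots> = \<epsilon> * (M * K) * norm v"
        by (simp add: K_def sum_distrib_left sum_distrib_right mult_ac)
      finally show ?thesis .
    qed
    have "norm (comp_hlip0 \<phi> f - comp_hlip0 \<phi> g) \<le> \<epsilon> * (M * K * norm \<phi>)"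
    proof -
      have "\<forall>y. \<exists>E. y \<in> ball 0 1 \<longrightarrow> (apply_hlip0 \<phi> has_derivative E) (at y)"
        using holomorphic_apply_hlip0[of \<phi>] unfolding holomorphic_map_on_def by blast
      then obtain E where E: "\<And>y. y \<in> ball 0 1 \<Longrightarrow> (apply_hlip0 \<phi> has_derivative E y) (at y)"
        unfolding choice_iff by blast
      show ?thesis
      proof (rule norm_hlip0_le_derivative)
        fix y :: 'y assume y: "y \<in> ball 0 1"
        let ?x = "apply_hlip0 \<phi> y"
        have x: "?x \<in> ball 0 1" using \<phi> y by blast
        have "((\<lambda>y. apply_hlip0 f (apply_hlip0 \<phi> y) - apply_hlip0 g (apply_hlip0 \<phi> y)) has_derivative
            (\<lambda>h. D f ?x (E y h) - D g ?x (E y h))) (at y)"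
          by (intro has_derivative_diff has_derivative_compose[OF E[OF y]] D(2)[OF x])
        then show "(apply_hlip0 (comp_hlip0 \<phi> f - comp_hlip0 \<phi> g) has_derivative
            (\<lambda>h. D f ?x (E y h) - D g ?x (E y h))) (at y)"
          by (rule has_derivative_transform_within_open[OF _ open_ball y])
             (simp only: apply_hlip0_diff apply_comp_hlip0[OF \<phi>])
        fix h
        have "cmod (D f ?x (E y h) - D g ?x (E y h)) \<le> \<epsilon> * (M * K) * norm (E y h)"
          using diff[OF y] .
        also have "\<dots> \<le> \<epsilon> * (M * K) * (norm \<phi> * norm h)"
        proof (rule mult_left_mono)
          show "norm (E y h) \<le> norm \<phi> * norm h"
            using norm_derivative_le_lipschitz[OF E[OF y] open_ball y] norm_apply_hlip0_diff_le[OF _ y]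
            by blast
        qed (use \<epsilon>(1) B(2) K in simp)
        finally show "cmod (D f ?x (E y h) - D g ?x (E y h)) \<le> \<epsilon> * (M * K * norm \<phi>) * norm h"
          by (simp only: mult.assoc)
      qed (use \<epsilon>(1) MK in simp)
    qed
    then show ?thesis using g(1) \<epsilon>(2) by (intro bexI[of _ g]) (simp add: dist_norm)
  qed
  then show "\<exists>K. finite K \<and> (\<forall>x\<in>comp_hlip0 \<phi> ` ball 0 1. \<exists>x'\<in>K. dist x x' < e)"
    using F(1) by (intro exI[of _ "comp_hlip0 \<phi> ` F"]) blast
qed

section \<open>The four conditions on a composition operator\<close>

theorem theorem4p11:
  fixes \<phi> :: "('y::complex_banach, 'x::complex_banach) hlip0"
  assumes "apply_hlip0 \<phi> ` ball 0 1 \<subseteq> ball 0 1"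
  shows "let
      S1 = compact_operator (comp_hlip0 \<phi>);
      S2 = (\<not> fixes_copy_of_linfty (comp_hlip0 \<phi>) \<and>
            compact (closure (apply_hlip0 \<phi> ` ball 0 1)));
      S3 = ((\<forall>y\<in>cball 0 1 - {0}. norm (closed_ball_ext \<phi> y) < norm y) \<and>
            compact (closure (apply_hlip0 \<phi> ` ball 0 1)));
      S4 = compact_operator (comp_hinf \<phi>)
    in (S1 \<longrightarrow> S2) \<and> (S2 \<longrightarrow> S3) \<and>
       (finite_dimensional (UNIV :: 'y set) \<longrightarrow> S3 \<longrightarrow> S4) \<and>
       (finite_dimensional (UNIV :: 'x set) \<longrightarrow> S4 \<longrightarrow> S1) \<and>
       (finite_dimensional (UNIV :: 'x set) \<and> finite_dimensional (UNIV :: 'y set) \<longrightarrow>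
          (S1 \<longleftrightarrow> S2) \<and> (S2 \<longleftrightarrow> S3) \<and> (S3 \<longleftrightarrow> S4))"
proof -
  let ?K = "compact (closure (apply_hlip0 \<phi> ` ball 0 1))"
  let ?S1 = "compact_operator (comp_hlip0 \<phi>)"
  let ?S2 = "\<not> fixes_copy_of_linfty (comp_hlip0 \<phi>) \<and> ?K"
  let ?S3 = "(\<forall>y\<in>cball 0 1 - {0}. norm (closed_ball_ext \<phi> y) < norm y) \<and> ?K"
  let ?S4 = "compact_operator (comp_hinf \<phi>)"
  have 12: "?S1 \<longrightarrow> ?S2"
    using compact_operator_not_fixes_linfty compact_comp_hlip0_imp_compact_range[OF assms] by blast
  have 23: "?S2 \<longrightarrow> ?S3"
    using fixes_copy_if_norm_not_decreasing[OF assms] by (metis DiffE not_less singletonI)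
  have 34: "finite_dimensional (UNIV :: 'y set) \<longrightarrow> ?S3 \<longrightarrow> ?S4"
  proof (intro impI)
    assume Y: "finite_dimensional (UNIV :: 'y set)" and S3: ?S3
    obtain \<rho> where "\<rho> < 1" "\<And>y. y \<in> ball 0 1 \<Longrightarrow> norm (apply_hlip0 \<phi> y) \<le> \<rho>"
      using norm_ext_bounded_away[OF Y, of \<phi>] S3 by blast
    then show ?S4
      using compact_comp_hinf_if_range_inside[OF assms] S3 by blast
  qed
  have 41: "finite_dimensional (UNIV :: 'x set) \<longrightarrow> ?S4 \<longrightarrow> ?S1"
    using compact_comp_hlip0_if_compact_comp_hinf[OF assms] by blast
  show ?thesis
    unfolding Let_def using 12 23 34 41 by blast
qed

end
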